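(* Let $H=\langle a_1,a_2,a_3\rangle$ be a numerical semigroup minimally generated by three positive integers $a_1,a_2,a_3$ with $\gcd(a_1,a_2,a_3)=1$, let $k$ be a field, and let $R=k[[H]]=k[[t^{a_1},t^{a_2},t^{a_3}]]$. Suppose that $R$ is not a Gorenstein ring. Let $\alpha,\beta,\gamma,\alpha',\beta',\gamma'$ be positive integers such that the kernel of the $k$-algebra map $\varphi:k[X,Y,Z]\to k[t]$, $X\mapsto t^{a_1}$, $Y\mapsto t^{a_2}$, $Z\mapsto t^{a_3}$, is $$\operatorname{Ker}\varphi=\mathrm I_2\begin{pmatrix} X^{\alpha} & Y^{\beta} & Z^{\gamma} \\ Y^{\beta'} & Z^{\gamma'} & X^{\alpha'} \end{pmatrix},$$ and set $m=a_1\alpha+a_3(\gamma+\gamma')$, $m'=a_1\alpha'+a_2(\beta+\beta')$ and $b=|m-m'|$. Let $n\ge1$ be an integer. Then the following conditions are equivalent. (1) The semigroup ring $R=k[[H]]$ is an $n$-Goto ring. (2) $3b\in H$, and $n=\alpha\beta\gamma$ if $m'>m$ (respectively $n=\alpha'\beta'\gamma'$ if $m>m'$).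
   Context: $k[[t]]$ is the formal power series ring and $R=k[[t^{a_1},t^{a_2},t^{a_3}]]\subseteq k[[t]]$ is a one-dimensional Cohen-Macaulay local domain. $\mathrm I_2(-)$ denotes the ideal generated by the $2\times2$ minors. By a theorem of Herzog, when $R$ (equivalently $k[t^{a_1},t^{a_2},t^{a_3}]$) is not Gorenstein such positive integers $\alpha,\beta,\gamma,\alpha',\beta',\gamma'$ exist; one has $m'-m=a_2\beta'-a_1\alpha=a_3\gamma'-a_2\beta=a_1\alpha'-a_3\gamma$, and $m\ne m'$. A canonical ideal of a one-dimensional Cohen-Macaulay local ring $R$ is an ideal $I\ne R$ isomorphic to the canonical module $\mathrm K_R$. For $n\ge0$, $R$ is an $n$-Goto ring if there is a parameter ideal $(a)$ with $a\in I$, $I^3=aI^2$ and $\ell_R(I^2/aI)=n$; this does not depend on the choice of $I$ or of $a$. *)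

theory Defs
  imports
    "HOL-Algebra.Module"
    "HOL-Algebra.Ideal_Product"
    "HOL-Algebra.Ring_Divisibility"
    "HOL-Computational_Algebra.Formal_Power_Series"
    "HOL-Computational_Algebra.Polynomial"
    "HOL-Library.Extended_Nat"
begin

section \<open>Modules over a commutative ring\<close>

text \<open>The record fields \<open>mult\<close> and \<open>one\<close>, which a module record inherits from the ring
  records, carry no information for a module; they are left undefined where there is no natural
  choice.\<close>

definition regular_mod :: "('r, 'x) ring_scheme \<Rightarrow> ('r, 'r) module" where
  "regular_mod R = \<lparr>carrier = carrier R, monoid.mult = monoid.mult R, one = one R,
     zero = zero R, add = add R, module.smult = monoid.mult R\<rparr>"

definition ideal_mod :: "('r, 'x) ring_scheme \<Rightarrow> 'r set \<Rightarrow> ('r, 'r) module" where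
  "ideal_mod R I = (regular_mod R)\<lparr>carrier := I\<rparr>"

definition quot_mod :: "('r, 'x) ring_scheme \<Rightarrow> 'r set \<Rightarrow> ('r, 'r set) module" where
  "quot_mod R J = \<lparr>carrier = carrier (R Quot J), monoid.mult = monoid.mult (R Quot J),
     one = one (R Quot J),
     zero = zero (R Quot J), add = add (R Quot J),
     module.smult = (\<lambda>r X. (J +>\<^bsub>R\<^esub> r) \<otimes>\<^bsub>R Quot J\<^esub> X)\<rparr>"

definition free_mod :: "('r, 'x) ring_scheme \<Rightarrow> nat \<Rightarrow> ('r, nat \<Rightarrow> 'r) module" where
  "free_mod R n = \<lparr>carrier = {..<n} \<rightarrow>\<^sub>E carrier R, monoid.mult = undefined, one = undefined,
     zero = (\<lambda>i\<in>{..<n}. \<zero>\<^bsub>R\<^esub>),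
     add = (\<lambda>x y. \<lambda>i\<in>{..<n}. x i \<oplus>\<^bsub>R\<^esub> y i),
     module.smult = (\<lambda>r x. \<lambda>i\<in>{..<n}. r \<otimes>\<^bsub>R\<^esub> x i)\<rparr>"

definition mod_homs ::
  "('r, 'x) ring_scheme \<Rightarrow> ('r, 'm) module \<Rightarrow> ('r, 'n) module \<Rightarrow> ('m \<Rightarrow> 'n) set" where
  "mod_homs R M N = {f \<in> carrier M \<rightarrow>\<^sub>E carrier N.
     (\<forall>x\<in>carrier M. \<forall>y\<in>carrier M. f (x \<oplus>\<^bsub>M\<^esub> y) = f x \<oplus>\<^bsub>N\<^esub> f y) \<and>
     (\<forall>r\<in>carrier R. \<forall>x\<in>carrier M. f (r \<odot>\<^bsub>M\<^esub> x) = r \<odot>\<^bsub>N\<^esub> f x)}"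

definition Hom_mod ::
  "('r, 'x) ring_scheme \<Rightarrow> ('r, 'm) module \<Rightarrow> ('r, 'n) module \<Rightarrow> ('r, 'm \<Rightarrow> 'n) module" where
  "Hom_mod R M N = \<lparr>carrier = mod_homs R M N, monoid.mult = undefined, one = undefined,
     zero = (\<lambda>x\<in>carrier M. \<zero>\<^bsub>N\<^esub>),
     add = (\<lambda>f g. \<lambda>x\<in>carrier M. f x \<oplus>\<^bsub>N\<^esub> g x),
     module.smult = (\<lambda>r f. \<lambda>x\<in>carrier M. r \<odot>\<^bsub>N\<^esub> f x)\<rparr>"

definition finitely_generated_mod :: "('r, 'x) ring_scheme \<Rightarrow> ('r, 'm) module \<Rightarrow> bool" where
  "finitely_generated_mod R M \<longleftrightarrow>
     (\<exists>n. \<exists>p\<in>mod_homs R (free_mod R n) M. p ` carrier (free_mod R n) = carrier M)"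

text \<open>The length of \<open>N/L\<close> for submodules \<open>L \<subseteq> N\<close> of \<open>M\<close>: the supremum of the lengths of the
  strictly increasing chains of submodules from \<open>L\<close> to \<open>N\<close>.\<close>

definition quot_length ::
  "('r, 'x) ring_scheme \<Rightarrow> ('r, 'm) module \<Rightarrow> 'm set \<Rightarrow> 'm set \<Rightarrow> enat" where
  "quot_length R M N L = Sup {enat s | s. \<exists>C :: nat \<Rightarrow> 'm set.
     C 0 = L \<and> C s = N \<and> (\<forall>i\<le>s. submodule (C i) R M) \<and> (\<forall>i<s. C i \<subset> C (Suc i))}"


section \<open>Free resolutions and Ext\<close>

text \<open>\<open>free_resolution R b d\<close> says that
  \<open>\<cdots> \<rightarrow> R\<^bsup>b 2\<^esup> \<rightarrow> R\<^bsup>b 1\<^esup> \<rightarrow> R\<^bsup>b 0\<^esup>\<close>, with maps \<open>d i : R\<^bsup>b (i+1)\<^esup> \<rightarrow> R\<^bsup>b i\<^esup>\<close>, is exact at every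
  \<open>R\<^bsup>b (i+1)\<^esup>\<close>; it is then a free resolution of the cokernel of \<open>d 0\<close>. Over a Noetherian ring every
  finitely generated module is such a cokernel.\<close>

definition free_resolution ::
  "('r, 'x) ring_scheme \<Rightarrow> (nat \<Rightarrow> nat) \<Rightarrow> (nat \<Rightarrow> (nat \<Rightarrow> 'r) \<Rightarrow> nat \<Rightarrow> 'r) \<Rightarrow> bool" where
  "free_resolution R b d \<longleftrightarrow>
     (\<forall>i. d i \<in> mod_homs R (free_mod R (b (Suc i))) (free_mod R (b i))) \<and>
     (\<forall>i. {x \<in> carrier (free_mod R (b (Suc i))). d i x = \<zero>\<^bsub>free_mod R (b i)\<^esub>} =
          d (Suc i) ` carrier (free_mod R (b (Suc (Suc i)))))"

definition free_resolution_of ::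
  "('r, 'x) ring_scheme \<Rightarrow> ('r, 'm) module \<Rightarrow> (nat \<Rightarrow> nat) \<Rightarrow>
     (nat \<Rightarrow> (nat \<Rightarrow> 'r) \<Rightarrow> nat \<Rightarrow> 'r) \<Rightarrow> bool" where
  "free_resolution_of R N b d \<longleftrightarrow> free_resolution R b d \<and>
     (\<exists>e\<in>mod_homs R (free_mod R (b 0)) N.
        e ` carrier (free_mod R (b 0)) = carrier N \<and>
        {x \<in> carrier (free_mod R (b 0)). e x = \<zero>\<^bsub>N\<^esub>} = d 0 ` carrier (free_mod R (b 1)))"

text \<open>If \<open>b, d\<close> is a free resolution of \<open>N\<close>, then \<open>Ext\<^sup>i(N, M)\<close> is the quotient of
  \<open>Ext_cocycles R b d M i\<close> by \<open>Ext_coboundaries R b d M i\<close>, both submodules of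
  \<open>Hom(R\<^bsup>b i\<^esup>, M)\<close>.\<close>

definition Ext_cocycles ::
  "('r, 'x) ring_scheme \<Rightarrow> (nat \<Rightarrow> nat) \<Rightarrow> (nat \<Rightarrow> (nat \<Rightarrow> 'r) \<Rightarrow> nat \<Rightarrow> 'r) \<Rightarrow>
     ('r, 'm) module \<Rightarrow> nat \<Rightarrow> ((nat \<Rightarrow> 'r) \<Rightarrow> 'm) set" where
  "Ext_cocycles R b d M i = {f \<in> mod_homs R (free_mod R (b i)) M.
     \<forall>x\<in>carrier (free_mod R (b (Suc i))). f (d i x) = \<zero>\<^bsub>M\<^esub>}"

definition Ext_coboundaries ::
  "('r, 'x) ring_scheme \<Rightarrow> (nat \<Rightarrow> nat) \<Rightarrow> (nat \<Rightarrow> (nat \<Rightarrow> 'r) \<Rightarrow> nat \<Rightarrow> 'r) \<Rightarrow>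
     ('r, 'm) module \<Rightarrow> nat \<Rightarrow> ((nat \<Rightarrow> 'r) \<Rightarrow> 'm) set" where
  "Ext_coboundaries R b d M i = (case i of
       0 \<Rightarrow> {\<lambda>x\<in>carrier (free_mod R (b 0)). \<zero>\<^bsub>M\<^esub>}
     | Suc j \<Rightarrow> (\<lambda>g. \<lambda>x\<in>carrier (free_mod R (b (Suc j))). g (d j x)) `
                 mod_homs R (free_mod R (b j)) M)"

text \<open>Finite injective dimension over a Noetherian ring: for some \<open>n\<close>, \<open>Ext\<^sup>i(N, M) = 0\<close> for all
  \<open>i > n\<close> and all finitely generated \<open>N\<close>.\<close>

definition finite_injective_dimension :: "('r, 'x) ring_scheme \<Rightarrow> ('r, 'm) module \<Rightarrow> bool" where
  "finite_injective_dimension R M \<longleftrightarrow>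
     (\<exists>n. \<forall>b d. free_resolution R b d \<longrightarrow>
        (\<forall>i>n. Ext_cocycles R b d M i = Ext_coboundaries R b d M i))"


section \<open>Gorenstein rings, canonical ideals and Goto rings\<close>

definition noetherian_local_ring :: "('r, 'x) ring_scheme \<Rightarrow> bool" where
  "noetherian_local_ring R \<longleftrightarrow> cring R \<and> noetherian_ring R \<and> (\<exists>!J. maximalideal J R)"

text \<open>The residue field of a local ring, as a module; the maximal ideal is the set of
  non-units.\<close>

definition residue_field_mod :: "('r, 'x) ring_scheme \<Rightarrow> ('r, 'r set) module" where
  "residue_field_mod R = quot_mod R (carrier R - Units R)"

definition gorenstein_local_ring :: "('r, 'x) ring_scheme \<Rightarrow> bool" where
  "gorenstein_local_ring R \<longleftrightarrow>
     noetherian_local_ring R \<and> finite_injective_dimension R (regular_mod R)"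

text \<open>The remaining definitions are meant for a one-dimensional Cohen-Macaulay local ring \<open>R\<close>.
  There, a nonzero finitely generated module is maximal Cohen-Macaulay, i.e. of depth 1, iff
  some element of the maximal ideal is a nonzerodivisor on it.\<close>

definition maximal_CM_mod :: "('r, 'x) ring_scheme \<Rightarrow> ('r, 'm) module \<Rightarrow> bool" where
  "maximal_CM_mod R C \<longleftrightarrow> module R C \<and> finitely_generated_mod R C \<and> carrier C \<noteq> {\<zero>\<^bsub>C\<^esub>} \<and>
     (\<exists>x\<in>carrier R - Units R. \<forall>c\<in>carrier C. x \<odot>\<^bsub>C\<^esub> c = \<zero>\<^bsub>C\<^esub> \<longrightarrow> c = \<zero>\<^bsub>C\<^esub>)"

text \<open>A module \<open>C\<close> of depth 1 has Cohen-Macaulay type 1 iff \<open>Ext\<^sup>1(k, C)\<close> is one-dimensional over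
  the residue field \<open>k\<close>. That \<open>Ext\<close> is annihilated by the maximal ideal, so its dimension over \<open>k\<close> is
  its length over \<open>R\<close>; it does not depend on the resolution of \<open>k\<close>.\<close>

definition CM_type_one :: "('r, 'x) ring_scheme \<Rightarrow> ('r, 'm) module \<Rightarrow> bool" where
  "CM_type_one R C \<longleftrightarrow> (\<exists>b d. free_resolution_of R (residue_field_mod R) b d \<and>
     quot_length R (Hom_mod R (free_mod R (b 1)) C)
       (Ext_cocycles R b d C 1) (Ext_coboundaries R b d C 1) = 1)"

text \<open>The definition of Bruns and Herzog: a canonical module is a maximal Cohen-Macaulay module of
  type 1 and of finite injective dimension. It is unique up to isomorphism, so an ideal is
  isomorphic to the canonical module iff it is one itself.\<close>

definition canonical_mod :: "('r, 'x) ring_scheme \<Rightarrow> ('r, 'm) module \<Rightarrow> bool" where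
  "canonical_mod R C \<longleftrightarrow>
     maximal_CM_mod R C \<and> CM_type_one R C \<and> finite_injective_dimension R C"

definition canonical_ideal :: "('r, 'x) ring_scheme \<Rightarrow> 'r set \<Rightarrow> bool" where
  "canonical_ideal R I \<longleftrightarrow> ideal I R \<and> I \<noteq> carrier R \<and> canonical_mod R (ideal_mod R I)"

definition parameter_element :: "('r, 'x) ring_scheme \<Rightarrow> 'r \<Rightarrow> bool" where
  "parameter_element R a \<longleftrightarrow> a \<in> carrier R \<and> a \<notin> Units R \<and>
     quot_length R (regular_mod R) (carrier R) (PIdl\<^bsub>R\<^esub> a) < \<infinity>"

definition Goto_ring :: "nat \<Rightarrow> ('r, 'x) ring_scheme \<Rightarrow> bool" where
  "Goto_ring n R \<longleftrightarrow> (\<exists>I a. canonical_ideal R I \<and> parameter_element R a \<and> a \<in> I \<and>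
     I \<cdot>\<^bsub>R\<^esub> (I \<cdot>\<^bsub>R\<^esub> I) = (PIdl\<^bsub>R\<^esub> a) \<cdot>\<^bsub>R\<^esub> (I \<cdot>\<^bsub>R\<^esub> I) \<and>
     quot_length R (regular_mod R) (I \<cdot>\<^bsub>R\<^esub> I) ((PIdl\<^bsub>R\<^esub> a) \<cdot>\<^bsub>R\<^esub> I) = enat n)"


section \<open>Numerical semigroups and their rings\<close>

inductive_set gen_semigroup :: "nat set \<Rightarrow> nat set" for A :: "nat set" where
  zero: "0 \<in> gen_semigroup A"
| add: "a \<in> A \<Longrightarrow> s \<in> gen_semigroup A \<Longrightarrow> a + s \<in> gen_semigroup A"

definition minimal_gens :: "nat set \<Rightarrow> bool" where
  "minimal_gens A \<longleftrightarrow> (\<forall>B. B \<subset> A \<longrightarrow> gen_semigroup B \<noteq> gen_semigroup A)"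

definition ring_on :: "'a::comm_ring_1 set \<Rightarrow> 'a ring" where
  "ring_on A = \<lparr>carrier = A, monoid.mult = (*), one = 1, zero = 0, add = (+)\<rparr>"

text \<open>\<open>k[[H]]\<close> consists of the power series whose exponents all lie in \<open>H\<close>; if \<open>H\<close> is generated
  by \<open>a\<^sub>1, a\<^sub>2, a\<^sub>3\<close>, this is \<open>k[[t\<^bsup>a\<^sub>1\<^esup>, t\<^bsup>a\<^sub>2\<^esup>, t\<^bsup>a\<^sub>3\<^esup>]]\<close>.\<close>

definition semigroup_ring :: "nat set \<Rightarrow> 'k::field fps ring" where
  "semigroup_ring H = ring_on {f. \<forall>n. n \<notin> H \<longrightarrow> fps_nth f n = 0}"

text \<open>\<open>k[X, Y, Z]\<close> is represented as \<open>k[X][Y][Z]\<close>.\<close>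

definition varX :: "'k::field poly poly poly" where "varX = [:[:[:0, 1:]:]:]"
definition varY :: "'k::field poly poly poly" where "varY = [:[:0, 1:]:]"
definition varZ :: "'k::field poly poly poly" where "varZ = [:0, 1:]"

definition monomial_map :: "nat \<Rightarrow> nat \<Rightarrow> nat \<Rightarrow> 'k::field poly poly poly \<Rightarrow> 'k poly" where
  "monomial_map a1 a2 a3 f =
     poly (map_poly (\<lambda>g. poly (map_poly (\<lambda>p. pcompose p (monom 1 a1)) g) (monom 1 a2)) f)
       (monom 1 a3)"

lemma monomial_map_gens:
  "monomial_map a1 a2 a3 varX = monom 1 a1"
  "monomial_map a1 a2 a3 varY = monom 1 a2"
  "monomial_map a1 a2 a3 varZ = monom 1 a3"
  "monomial_map a1 a2 a3 [:[:[:c:]:]:] = [:c:]"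
  by (simp_all add: monomial_map_def varX_def varY_def varZ_def map_poly_pCons map_poly_1'
      pcompose_pCons pcompose_1)

text \<open>The ideal generated by the \<open>2 \<times> 2\<close> minors of a matrix with two rows, given as lists.\<close>

definition I2 :: "'a::comm_ring_1 list \<Rightarrow> 'a list \<Rightarrow> 'a set" where
  "I2 u v = Idl\<^bsub>ring_on UNIV\<^esub>
     {u ! i * v ! j - u ! j * v ! i | i j. i < j \<and> j < length u}"

end

theory Submission
  imports Defs
begin

text \<open>
  Let \<open>K\<close> be the canonical module of \<open>R = k[[H]]\<close>, normalised to \<open>R \<subseteq> K \<subseteq> k[[t]]\<close>: the series with
  exponents in \<open>{n. F - n \<notin> H}\<close>, where \<open>F\<close> is the Frobenius number of \<open>H\<close>. A canonical ideal is
  \<open>I = q K\<close> for a series \<open>q \<noteq> 0\<close>. For \<open>a = q x\<close> with \<open>x \<in> K\<close>, the condition \<open>I\<^sup>3 = a I\<^sup>2\<close> says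
  \<open>K\<^sup>3 = x K\<^sup>2\<close>; since \<open>1 \<in> K\<^sup>3\<close> this makes \<open>x\<close> a unit of \<open>k[[t]]\<close>, so that \<open>K\<^sup>2\<close> and \<open>K\<^sup>3\<close> have the same
  orders, and the length of \<open>I\<^sup>2/aI\<close> is the number of exponents of \<open>K\<^sup>2\<close> outside \<open>K\<close>. Conversely, if
  \<open>K\<^sup>3 = K\<^sup>2\<close>, then \<open>q = a = t\<^bsup>F + 1\<^esup>\<close> will do. The \<open>n\<close>-Goto property is thus a property of the set of
  exponents of \<open>K\<close> (\<open>Goto_ring_imp\<close>, \<open>Goto_ring_if\<close>).

  The matrix determines this set. If \<open>m < m'\<close>, the pseudo-Frobenius numbers of \<open>H\<close> are
  \<open>F = m' - (a1 + a2 + a3)\<close> and \<open>m - (a1 + a2 + a3) = F - b\<close>, whence \<open>K = R + R t\<^sup>b\<close>,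
  \<open>K\<^sup>2 = K + R t\<^bsup>2b\<^esup>\<close> and \<open>K\<^sup>3 = K\<^sup>2 + R t\<^bsup>3b\<^esup>\<close>. As \<open>b\<close> and \<open>2b\<close> are not in \<open>H\<close>, the equality
  \<open>K\<^sup>3 = K\<^sup>2\<close> means \<open>3b \<in> H\<close>. Because \<open>K : K = R\<close>, the exponent \<open>h + 2b\<close> with \<open>h \<in> H\<close> is new in \<open>K\<^sup>2\<close>
  exactly if \<open>h + b \<notin> H\<close>, and these \<open>h\<close> are the values of the monomials \<open>X\<^sup>iY\<^sup>jZ\<^sup>l\<close> with
  \<open>i < \<alpha>\<close>, \<open>j < \<beta>\<close>, \<open>l < \<gamma>\<close>, all distinct (\<open>type_two\<close>, \<open>card_gaps_of_shift\<close>). If \<open>m > m'\<close>, exchange the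
  rows of the matrix and the variables \<open>Y\<close>, \<open>Z\<close>.

  Facts about \<open>H\<close> are read off the ideal of minors as follows: two monomials with the same image in
  \<open>k[t]\<close> are connected by the moves that replace one term of a minor by the other
  (\<open>move_closed_of_kernel\<close>), so a set of exponent vectors closed under the moves is closed under equality
  of values.

  Two facts link \<open>K\<close> with the homological definition of a canonical ideal. First, a nonzero proper ideal \<open>I\<close> of type
  one is a multiple of \<open>K\<close>: \<open>Ext\<^sup>1(k, I)\<close> is \<open>(I : m)/I\<close> for every resolution (\<open>type_transfer\<close>), and a
  functional that vanishes on \<open>I\<close> but not on \<open>I : m\<close> has the form \<open>f \<mapsto> [t\<^sup>N] (f g)\<close>, which
  forces \<open>I = {f. f g \<in> t\<^bsup>N - F\<^esup> K}\<close> (\<open>type_one_is_canon_multiple\<close>). Secondly, \<open>K\<close> has finite injective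
  dimension: over the discrete valuation ring \<open>A = k[[t\<^sup>e]]\<close>, with \<open>e\<close> the multiplicity, \<open>R\<close> is free and
  \<open>Hom\<^sub>R(M, K) = Hom\<^sub>A(M, A)\<close>, and \<open>A\<close>-linear functionals extend from a saturated submodule of a free
  module (\<open>extend_hom_to_canon\<close>). Finite generation over \<open>A\<close> also provides the free resolutions.
\<close>

section \<open>Subrings of a commutative ring\<close>

lemma ring_on_simps [simp]:
  "carrier (ring_on A) = A" "x \<otimes>\<^bsub>ring_on A\<^esub> y = x * y" "x \<oplus>\<^bsub>ring_on A\<^esub> y = x + y"
  "\<one>\<^bsub>ring_on A\<^esub> = 1" "\<zero>\<^bsub>ring_on A\<^esub> = 0"
  by (simp_all add: ring_on_def)

lemma cring_ring_on:
  assumes "0 \<in> A" "1 \<in> A" "\<And>x y. x \<in> A \<Longrightarrow> y \<in> A \<Longrightarrow> x + y \<in> A"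
    "\<And>x. x \<in> A \<Longrightarrow> - x \<in> A" "\<And>x y. x \<in> A \<Longrightarrow> y \<in> A \<Longrightarrow> x * y \<in> A"
  shows "cring (ring_on A)"
proof -
  have "\<exists>y\<in>A. y + x = 0" if "x \<in> A" for x
    using that assms by (intro bexI[of _ "- x"]) auto
  then show ?thesis
    using assms by (intro cringI abelian_groupI comm_monoidI) (auto simp: algebra_simps)
qed

lemma a_inv_ring_on:
  assumes "cring (ring_on A)" "x \<in> A" "- x \<in> A"
  shows "\<ominus>\<^bsub>ring_on A\<^esub> x = - x"
proof -
  interpret cring "ring_on A" by fact
  show ?thesis using assms by (intro minus_equality) auto
qed

lemma ideal_ring_onI:
  assumes R: "cring (ring_on A)" and "J \<subseteq> A" "0 \<in> J"
    and "\<And>x y. x \<in> J \<Longrightarrow> y \<in> J \<Longrightarrow> x + y \<in> J"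
    and neg: "\<And>x. x \<in> J \<Longrightarrow> - x \<in> J"
    and "\<And>a x. a \<in> A \<Longrightarrow> x \<in> J \<Longrightarrow> a * x \<in> J"
  shows "ideal J (ring_on A)"
proof (rule idealI)
  interpret cring "ring_on A" by fact
  show "ring (ring_on A)" by (rule ring_axioms)
  have "inv\<^bsub>add_monoid (ring_on A)\<^esub> x = - x" if "x \<in> J" for x
    using a_inv_ring_on[OF R, of x] neg[OF that] that \<open>J \<subseteq> A\<close> by (auto simp: a_inv_def)
  then show "subgroup J (add_monoid (ring_on A))"
    using assms by (auto simp: subgroup_def)
  show "x \<otimes>\<^bsub>ring_on A\<^esub> a \<in> J" if "a \<in> J" "x \<in> carrier (ring_on A)" for a x
    using that assms by simp
  then show "a \<otimes>\<^bsub>ring_on A\<^esub> x \<in> J" if "a \<in> J" "x \<in> carrier (ring_on A)" for a x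
    using that by (simp add: mult.commute)
qed

section \<open>The ideal of minors and connected monomials\<close>

definition monom3 :: "'a::zero \<Rightarrow> nat \<Rightarrow> nat \<Rightarrow> nat \<Rightarrow> 'a poly poly poly" where
  "monom3 c i j l = monom (monom (monom c i) j) l"

lemma mult_monom3:
  "monom3 (c::'a::comm_semiring_0) i j l * monom3 d p q r = monom3 (c * d) (i + p) (j + q) (l + r)"
  by (simp add: monom3_def mult_monom)

lemma monom3_eq_vars: "monom3 (1::'a::field) i j l = varX ^ i * varY ^ j * varZ ^ l"
proof -
  have "varX = monom3 (1::'a) 1 0 0" "varY = monom3 (1::'a) 0 1 0" "varZ = monom3 (1::'a) 0 0 1"
    by (simp_all add: varX_def varY_def varZ_def monom3_def monom_Suc monom_0 flip: one_pCons)
  moreover have "monom3 (1::'a) 1 0 0 ^ i = monom3 1 i 0 0" "monom3 (1::'a) 0 1 0 ^ j = monom3 1 0 j 0"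
    "monom3 (1::'a) 0 0 1 ^ l = monom3 1 0 0 l"
    by (simp_all add: monom3_def monom_power)
  ultimately show ?thesis
    by (simp add: mult_monom3)
qed

text \<open>A trivariate polynomial is a sum of monomials, so additive properties need only be checked there.\<close>

lemma poly3_additive_induct:
  fixes f :: "'a::comm_ring_1 poly poly poly"
  assumes add: "\<And>f g. P f \<Longrightarrow> P g \<Longrightarrow> P (f + g)"
    and monom: "\<And>c i j l. P (monom3 c i j l)"
  shows "P f"
proof -
  have sums: "P (\<Sum>x\<in>A. F x)" if "finite A" "\<And>x. x \<in> A \<Longrightarrow> P (F x)" for A and F :: "nat \<Rightarrow> _"
    using that
  proof (induction A rule: finite_induct)
    case empty
    have "P (monom3 0 0 0 0)" by (rule monom)
    then show ?case by (simp add: monom3_def)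
  qed (auto intro: add)
  have sum_hom: "monom (\<Sum>x\<in>A. G x) l = (\<Sum>x\<in>A. monom (G x) l)"
    for A l and G :: "nat \<Rightarrow> 'b::comm_ring_1"
    by (induction A rule: infinite_finite_induct) (auto simp: add_monom[symmetric])
  have 1: "P (monom (monom p j) l)" for p j l
  proof -
    have "monom (monom p j) l = (\<Sum>i\<le>degree p. monom3 (coeff p i) i j l)"
      by (subst poly_as_sum_of_monoms[of p, symmetric]) (simp only: sum_hom monom3_def)
    then show ?thesis using sums[of "{..degree p}"] monom by simp
  qed
  have 2: "P (monom q l)" for q l
  proof -
    have "monom q l = (\<Sum>j\<le>degree q. monom (monom (coeff q j) j) l)"
      by (subst poly_as_sum_of_monoms[of q, symmetric]) (simp only: sum_hom)
    then show ?thesis using sums[of "{..degree q}"] 1 by simp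
  qed
  have "f = (\<Sum>l\<le>degree f. monom (coeff f l) l)"
    by (simp add: poly_as_sum_of_monoms)
  moreover have "P (\<Sum>l\<le>degree f. monom (coeff f l) l)"
    using 2 by (intro sums) auto
  ultimately show ?thesis by simp
qed



text \<open>Applied three times, this turns a weight on the monomials into a linear functional on
  \<open>k[X][Y][Z]\<close>.\<close>

definition coeff_sum :: "(nat \<Rightarrow> 'b::zero \<Rightarrow> 'c::comm_monoid_add) \<Rightarrow> 'b poly \<Rightarrow> 'c" where
  "coeff_sum w p = (\<Sum>l\<le>degree p. w l (coeff p l))"

lemma coeff_sum_upto:
  assumes "\<And>l. w l 0 = 0" "degree p \<le> N"
  shows "coeff_sum w p = (\<Sum>l\<le>N. w l (coeff p l))"
  unfolding coeff_sum_def using assms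
  by (intro sum.mono_neutral_left) (auto simp: coeff_eq_0 not_le)

lemma coeff_sum_monom:
  assumes "\<And>l. w l 0 = 0"
  shows "coeff_sum w (monom c n) = w n c"
proof -
  have "coeff_sum w (monom c n) = (\<Sum>l\<le>n. w l (coeff (monom c n) l))"
    using assms degree_monom_le by (intro coeff_sum_upto) auto
  also have "\<dots> = (\<Sum>l\<le>n. if l = n then w n c else 0)"
    using assms by (intro sum.cong) auto
  finally show ?thesis by simp
qed

lemma coeff_sum_0: "(\<And>l. w l 0 = 0) \<Longrightarrow> coeff_sum w 0 = 0"
  by (simp add: coeff_sum_def)

lemma coeff_sum_add:
  fixes p q :: "'b::comm_monoid_add poly"
  assumes "\<And>l. w l 0 = 0" "\<And>l x y. w l (x + y) = w l x + w l y"
  shows "coeff_sum w (p + q) = coeff_sum w p + coeff_sum w q"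
proof -
  have "degree (p + q) \<le> max (degree p) (degree q)"
    by (rule degree_add_le_max)
  then show ?thesis
    using assms by (simp add: coeff_sum_upto[of w _ "max (degree p) (degree q)"] sum.distrib)
qed

text \<open>If \<open>E\<close> is a union of classes of monomials modulo some binomials, this functional annihilates the
  ideal that the binomials generate. It detects that two monomials with a difference in the ideal
  lie in the same class.\<close>

definition class_sum :: "(nat \<Rightarrow> nat \<Rightarrow> nat \<Rightarrow> bool) \<Rightarrow> 'a::comm_ring_1 poly poly poly \<Rightarrow> 'a" where
  "class_sum E = coeff_sum (\<lambda>l. coeff_sum (\<lambda>j. coeff_sum (\<lambda>i c. if E i j l then c else 0)))"

lemma class_sum_add: "class_sum E (f + g) = class_sum E f + class_sum E g"
  unfolding class_sum_def by (intro coeff_sum_add coeff_sum_0) auto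

lemma class_sum_0: "class_sum E 0 = 0"
  unfolding class_sum_def by (intro coeff_sum_0) auto

lemma class_sum_diff: "class_sum E (f - g) = class_sum E f - class_sum E g"
  using class_sum_add[of E "f - g" g] by (simp add: algebra_simps)

lemma class_sum_minus: "class_sum E (- f) = - class_sum E f"
  using class_sum_diff[of E 0 f] by (simp add: class_sum_0)

lemma class_sum_monom3: "class_sum E (monom3 c i j l) = (if E i j l then c else 0)"
  unfolding class_sum_def monom3_def by (subst coeff_sum_monom; simp add: coeff_sum_0 coeff_sum_monom)+

lemma cring_ring_on_UNIV: "cring (ring_on (UNIV :: 'a::comm_ring_1 set))"
  by (rule cring_ring_on) auto

text \<open>Replacing one term of a \<open>2 \<times> 2\<close> minor by the other is a move on exponent vectors; there is one
  clause for each minor.\<close>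

definition move_closed :: "nat \<Rightarrow> nat \<Rightarrow> nat \<Rightarrow> nat \<Rightarrow> nat \<Rightarrow> nat \<Rightarrow> (nat \<Rightarrow> nat \<Rightarrow> nat \<Rightarrow> bool) \<Rightarrow> bool" where
  "move_closed \<alpha> \<beta> \<gamma> \<alpha>' \<beta>' \<gamma>' E \<longleftrightarrow>
     (\<forall>i j l. E (i + \<alpha>) j (l + \<gamma>') = E i (j + (\<beta> + \<beta>')) l) \<and>
     (\<forall>i j l. E (i + (\<alpha> + \<alpha>')) j l = E i (j + \<beta>') (l + \<gamma>)) \<and>
     (\<forall>i j l. E (i + \<alpha>') (j + \<beta>) l = E i j (l + (\<gamma> + \<gamma>')))"

lemma class_sum_mult_binomial:
  fixes f :: "'a::comm_ring_1 poly poly poly"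
  assumes "\<And>i j l. E (i + p) (j + q) (l + r) = E (i + p') (j + q') (l + r')"
  shows "class_sum E (f * (monom3 1 p q r - monom3 1 p' q' r')) = 0"
proof (induction f rule: poly3_additive_induct)
  case (1 f g)
  then show ?case by (simp add: distrib_right class_sum_add)
next
  case (2 c i j l)
  then show ?case
    using assms by (simp add: right_diff_distrib class_sum_diff mult_monom3 class_sum_monom3)
qed

text \<open>The polynomials all of whose multiples have class sum \<open>0\<close> form an ideal. It contains the minors,
  because \<open>E\<close> does not separate the two terms of any multiple of a minor by a monomial.\<close>

lemma class_sum_I2:
  fixes f :: "'a::field poly poly poly"
  assumes E: "move_closed \<alpha> \<beta> \<gamma> \<alpha>' \<beta>' \<gamma>' E"
    and f: "f \<in> I2 [varX ^ \<alpha>, varY ^ \<beta>, varZ ^ \<gamma>] [varY ^ \<beta>', varZ ^ \<gamma>', varX ^ \<alpha>']"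
  shows "class_sum E f = 0"
proof -
  interpret cring "ring_on (UNIV :: 'a poly poly poly set)" by (rule cring_ring_on_UNIV)
  \<comment> \<open>Quantifying over all multiples makes \<open>?J\<close> an ideal.\<close>
  let ?J = "{f :: 'a poly poly poly. \<forall>h. class_sum E (h * f) = 0}"
  let ?u = "[varX ^ \<alpha>, varY ^ \<beta>, varZ ^ \<gamma>] :: 'a poly poly poly list"
  let ?v = "[varY ^ \<beta>', varZ ^ \<gamma>', varX ^ \<alpha>'] :: 'a poly poly poly list"
  have "ideal ?J (ring_on UNIV)"
  proof (rule ideal_ring_onI[OF cring_ring_on_UNIV])
    show "- x \<in> ?J" if "x \<in> ?J" for x
      using that by (simp add: class_sum_minus)
    show "a * x \<in> ?J" if "x \<in> ?J" for a x
      using that by (simp add: mult.assoc[symmetric])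
  qed (auto simp: class_sum_0 class_sum_add distrib_left)
  moreover have "{?u ! i * ?v ! j - ?u ! j * ?v ! i | i j. i < j \<and> j < length ?u} \<subseteq> ?J"
  proof -
    have vars: "varX ^ i = monom3 (1::'a) i 0 0" "varY ^ i = monom3 (1::'a) 0 i 0"
      "varZ ^ i = monom3 (1::'a) 0 0 i" for i
      by (simp_all add: monom3_eq_vars)
    have "?u ! i * ?v ! j - ?u ! j * ?v ! i \<in> ?J" if "i < j" "j < 3" for i j
    proof -
      have "i = 0 \<and> j = 1 \<or> i = 0 \<and> j = 2 \<or> i = 1 \<and> j = 2"
        using that by auto
      then show ?thesis
        using E by (auto simp: vars mult_monom3 move_closed_def ac_simps intro!: class_sum_mult_binomial)
    qed
    then show ?thesis by fastforce
  qed
  ultimately have "f \<in> ?J"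
    using f genideal_minimal unfolding I2_def by blast
  then have "class_sum E (1 * f) = 0" by blast
  then show ?thesis by simp
qed

lemma monomial_map_diff:
  "monomial_map a1 a2 a3 (f - g) = monomial_map a1 a2 a3 f - monomial_map a1 a2 a3 (g :: 'k::field poly poly poly)"
proof -
  have map_diff: "map_poly h (p - q) = map_poly h p - map_poly h q"
    if "h 0 = 0" "\<And>x y. h (x - y) = h x - h y"
    for h :: "'b::comm_ring_1 \<Rightarrow> 'c::comm_ring_1" and p q
    using that by (intro poly_eqI) (simp add: coeff_map_poly)
  show ?thesis
    unfolding monomial_map_def
    by (subst map_diff) (auto simp: map_diff pcompose_diff)
qed

lemma monomial_map_monom3:
  "monomial_map a1 a2 a3 (monom3 1 i j l) = (monom 1 (i * a1 + j * a2 + l * a3) :: 'k::field poly)"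
proof -
  have "pcompose (monom 1 i) (monom 1 a1) = (monom 1 (i * a1) :: 'k poly)"
    by (induction i) (simp_all add: monom_Suc monom_0 pcompose_pCons pcompose_1 mult_monom flip: one_pCons)
  then show ?thesis
    by (simp add: monomial_map_def monom3_def map_poly_monom poly_monom monom_power mult_monom ac_simps)
qed

text \<open>The difference of two monomials with the same value lies in the kernel, hence in the ideal of
  minors, hence has class sum \<open>0\<close>.\<close>

lemma move_closed_of_kernel:
  assumes ker: "a_kernel (ring_on UNIV) (ring_on UNIV)
           (monomial_map a1 a2 a3 :: 'k::field poly poly poly \<Rightarrow> 'k poly) =
         I2 [varX ^ \<alpha>, varY ^ \<beta>, varZ ^ \<gamma>] [varY ^ \<beta>', varZ ^ \<gamma>', varX ^ \<alpha>']"
    and E: "move_closed \<alpha> \<beta> \<gamma> \<alpha>' \<beta>' \<gamma>' E"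
    and val: "i * a1 + j * a2 + l * a3 = p * a1 + q * a2 + r * a3"
    and u: "E i j l"
  shows "E p q r"
proof -
  have "monomial_map a1 a2 a3 (monom3 1 i j l - monom3 (1::'k) p q r) = 0"
    using val by (simp add: monomial_map_diff monomial_map_monom3)
  then have "monom3 1 i j l - monom3 (1::'k) p q r \<in>
      I2 [varX ^ \<alpha>, varY ^ \<beta>, varZ ^ \<gamma>] [varY ^ \<beta>', varZ ^ \<gamma>', varX ^ \<alpha>']"
    unfolding ker[symmetric] by (simp add: a_kernel_def' ring_on_def)
  then have "class_sum E (monom3 1 i j l - monom3 (1::'k) p q r) = 0"
    by (rule class_sum_I2[OF E])
  then show ?thesis
    using u by (auto simp: class_sum_diff class_sum_monom3 split: if_splits)
qed

lemma minors_in_kernel: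
  assumes ker: "a_kernel (ring_on UNIV) (ring_on UNIV)
           (monomial_map a1 a2 a3 :: 'k::field poly poly poly \<Rightarrow> 'k poly) =
         I2 [varX ^ \<alpha>, varY ^ \<beta>, varZ ^ \<gamma>] [varY ^ \<beta>', varZ ^ \<gamma>', varX ^ \<alpha>']"
  shows "a1 * \<alpha> + a3 * \<gamma>' = a2 * (\<beta> + \<beta>')" "a1 * (\<alpha> + \<alpha>') = a2 * \<beta>' + a3 * \<gamma>"
    "a2 * \<beta> + a1 * \<alpha>' = a3 * (\<gamma> + \<gamma>')"
proof -
  interpret cring "ring_on (UNIV :: 'k poly poly poly set)" by (rule cring_ring_on_UNIV)
  let ?u = "[varX ^ \<alpha>, varY ^ \<beta>, varZ ^ \<gamma>] :: 'k poly poly poly list"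
  let ?v = "[varY ^ \<beta>', varZ ^ \<gamma>', varX ^ \<alpha>'] :: 'k poly poly poly list"
  have vars: "varX ^ i = monom3 (1::'k) i 0 0" "varY ^ i = monom3 (1::'k) 0 i 0"
    "varZ ^ i = monom3 (1::'k) 0 0 i" for i
    by (simp_all add: monom3_eq_vars)
  have "monomial_map a1 a2 a3 (?u ! i * ?v ! j - ?u ! j * ?v ! i) = 0" if "i < j" "j < 3" for i j
  proof -
    have "?u ! i * ?v ! j - ?u ! j * ?v ! i \<in> I2 ?u ?v"
      unfolding I2_def
    proof (rule subsetD[OF genideal_self])
      have "j < length ?u" using that by simp
      then show "?u ! i * ?v ! j - ?u ! j * ?v ! i \<in>
          {?u ! i * ?v ! j - ?u ! j * ?v ! i | i j. i < j \<and> j < length ?u}"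
        using that by blast
    qed (simp add: ring_on_def)
    then show ?thesis
      unfolding ker[symmetric] by (simp add: a_kernel_def' ring_on_def)
  qed
  from this[of 0 1] this[of 0 2] this[of 1 2]
  have "monom (1::'k) (\<alpha> * a1 + \<gamma>' * a3) = monom 1 ((\<beta> + \<beta>') * a2)"
    "monom (1::'k) ((\<alpha> + \<alpha>') * a1) = monom 1 (\<beta>' * a2 + \<gamma> * a3)"
    "monom (1::'k) (\<alpha>' * a1 + \<beta> * a2) = monom 1 ((\<gamma> + \<gamma>') * a3)"
    by (simp_all add: vars mult_monom3 monomial_map_diff monomial_map_monom3 add.commute)
  then have "\<alpha> * a1 + \<gamma>' * a3 = (\<beta> + \<beta>') * a2" "(\<alpha> + \<alpha>') * a1 = \<beta>' * a2 + \<gamma> * a3"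
    "\<alpha>' * a1 + \<beta> * a2 = (\<gamma> + \<gamma>') * a3"
    by (metis degree_monom_eq one_neq_zero)+
  then show "a1 * \<alpha> + a3 * \<gamma>' = a2 * (\<beta> + \<beta>')" "a1 * (\<alpha> + \<alpha>') = a2 * \<beta>' + a3 * \<gamma>"
    "a2 * \<beta> + a1 * \<alpha>' = a3 * (\<gamma> + \<gamma>')"
    by (simp_all add: algebra_simps)
qed


section \<open>Semigroups generated by three numbers\<close>

lemma gen_semigroup_three:
  "gen_semigroup {a1, a2, a3} = {i * a1 + j * a2 + l * a3 | i j l. True}" (is "_ = ?S")
proof
  show "gen_semigroup {a1, a2, a3} \<subseteq> ?S"
  proof
    fix x assume "x \<in> gen_semigroup {a1, a2, a3}"
    then show "x \<in> ?S"
    proof induction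
      case zero
      have "0 = 0 * a1 + 0 * a2 + 0 * a3" by simp
      then show ?case by blast
    next
      case (add a s)
      then obtain i j l where s: "s = i * a1 + j * a2 + l * a3" by blast
      have "a1 + s = Suc i * a1 + j * a2 + l * a3" "a2 + s = i * a1 + Suc j * a2 + l * a3"
        "a3 + s = i * a1 + j * a2 + Suc l * a3"
        using s by simp_all
      then show ?case using add(1) by blast
    qed
  qed
next
  have mult: "s + i * a \<in> gen_semigroup {a1, a2, a3}"
    if "a \<in> {a1, a2, a3}" "s \<in> gen_semigroup {a1, a2, a3}" for a i s
    using that
  proof (induction i)
    case (Suc i)
    then have "a + (s + i * a) \<in> gen_semigroup {a1, a2, a3}"
      by (blast intro: gen_semigroup.add)
    then show ?case by (simp add: ac_simps)
  qed auto
  have "0 + i * a1 + j * a2 + l * a3 \<in> gen_semigroup {a1, a2, a3}" for i j l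
    by (intro mult gen_semigroup.zero) auto
  then show "?S \<subseteq> gen_semigroup {a1, a2, a3}" by auto
qed

text \<open>Write \<open>n = q h + r\<close> with \<open>r < h\<close>. As soon as \<open>r \<le> q\<close>, this is \<open>(q - r) h + r (h + 1)\<close>.\<close>

lemma cofinite_semigroup:
  fixes H :: "nat set"
  assumes zero: "0 \<in> H" and add: "\<And>x y. x \<in> H \<Longrightarrow> y \<in> H \<Longrightarrow> x + y \<in> H"
    and h: "h \<in> H" "Suc h \<in> H"
  shows "\<exists>c. \<forall>n\<ge>c. n \<in> H"
proof (intro exI allI impI)
  have mult: "k * x \<in> H" if "x \<in> H" for k x
    using that by (induction k) (auto intro: zero add)
  fix n assume n: "n \<ge> h * h"
  show "n \<in> H"
  proof (cases "h = 0")
    case True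
    then show ?thesis using mult[of 1 n] h by simp
  next
    case False
    have "n mod h < h" using False by simp
    also have "h \<le> n div h"
      using n False by (simp add: less_eq_div_iff_mult_less_eq)
    finally have le: "n mod h \<le> n div h" by simp
    then have "n mod h * Suc h + (n div h - n mod h) * h = n mod h + n div h * h"
      by (simp add: diff_mult_distrib)
    also have "\<dots> = n" by simp
    finally show ?thesis using add mult h by metis
  qed
qed

text \<open>The positive and the negative part of a Bezout combination of the generators are consecutive
  elements of the semigroup.\<close>

lemma numerical_semigroup_cofinite:
  assumes "gcd a1 (gcd a2 a3) = (1::nat)"
  shows "\<exists>c. \<forall>n\<ge>c. n \<in> gen_semigroup {a1, a2, a3}"
proof -
  have H: "i * a1 + j * a2 + l * a3 \<in> gen_semigroup {a1, a2, a3}" for i j l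
    unfolding gen_semigroup_three by blast
  have add: "x + y \<in> gen_semigroup {a1, a2, a3}"
    if xy: "x \<in> gen_semigroup {a1, a2, a3}" "y \<in> gen_semigroup {a1, a2, a3}" for x y
  proof -
    obtain i j l i' j' l' where "x = i * a1 + j * a2 + l * a3" "y = i' * a1 + j' * a2 + l' * a3"
      using xy unfolding gen_semigroup_three by blast
    then have "x + y = (i + i') * a1 + (j + j') * a2 + (l + l') * a3"
      by (simp add: algebra_simps)
    then show ?thesis using H by metis
  qed
  obtain u v where uv: "u * int a2 + v * int a3 = int (gcd a2 a3)"
    using bezout_int[of "int a2" "int a3"] by auto
  obtain x y where xy: "x * int a1 + y * int (gcd a2 a3) = 1"
    using bezout_int[of "int a1" "int (gcd a2 a3)"] assms by (metis gcd_int_int_eq of_nat_1) 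
  define p q r where "p = x" and "q = y * u" and "r = y * v"
  have "p * int a1 + q * int a2 + r * int a3 = x * int a1 + y * (u * int a2 + v * int a3)"
    by (simp add: p_def q_def r_def algebra_simps)
  then have "p * int a1 + q * int a2 + r * int a3 = 1"
    using xy uv by simp
  moreover have "z = int (nat z) - int (nat (- z))" for z by simp
  ultimately have "(int (nat p) - int (nat (- p))) * int a1 + (int (nat q) - int (nat (- q))) * int a2
      + (int (nat r) - int (nat (- r))) * int a3 = 1"
    by metis
  then have "int (nat p * a1 + nat q * a2 + nat r * a3) =
      int (Suc (nat (- p) * a1 + nat (- q) * a2 + nat (- r) * a3))"
    by (simp add: algebra_simps)
  then have "nat p * a1 + nat q * a2 + nat r * a3 = Suc (nat (- p) * a1 + nat (- q) * a2 + nat (- r) * a3)"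
    by (simp only: of_nat_eq_iff)
  then show ?thesis
    using cofinite_semigroup[OF gen_semigroup.zero add H] H by metis
qed

section \<open>The pseudo-Frobenius numbers of a Herzog semigroup\<close>

text \<open>The data that a Herzog matrix provides: the equality of the degrees of the two terms of each
  minor, and, in place of the kernel itself, the connectedness of monomials of equal value.\<close>

locale herzog_data =
  fixes a1 a2 a3 \<alpha> \<beta> \<gamma> \<alpha>' \<beta>' \<gamma>' :: nat and H :: "nat set"
  assumes a_pos: "a1 > 0" "a2 > 0" "a3 > 0"
    and exp_pos: "\<alpha> > 0" "\<beta> > 0" "\<gamma> > 0" "\<alpha>' > 0" "\<beta>' > 0" "\<gamma>' > 0"
    and H_iff: "x \<in> H \<longleftrightarrow> (\<exists>i j l. x = i * a1 + j * a2 + l * a3)"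
    and cofinite: "\<exists>c. \<forall>n\<ge>c. n \<in> H"
    and rel1: "a1 * \<alpha> + a3 * \<gamma>' = a2 * (\<beta> + \<beta>')"
    and rel2: "a1 * (\<alpha> + \<alpha>') = a2 * \<beta>' + a3 * \<gamma>"
    and rel3: "a2 * \<beta> + a1 * \<alpha>' = a3 * (\<gamma> + \<gamma>')"
    and connected: "move_closed \<alpha> \<beta> \<gamma> \<alpha>' \<beta>' \<gamma>' E \<Longrightarrow>
      i * a1 + j * a2 + l * a3 = p * a1 + q * a2 + r * a3 \<Longrightarrow> E i j l \<Longrightarrow> E p q r"
begin

abbreviation val :: "nat \<Rightarrow> nat \<Rightarrow> nat \<Rightarrow> nat" where
  "val i j l \<equiv> i * a1 + j * a2 + l * a3"

definition "m = a1 * \<alpha> + a3 * (\<gamma> + \<gamma>')"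
definition "m' = a1 * \<alpha>' + a2 * (\<beta> + \<beta>')"

lemma val_in_H: "val i j l \<in> H"
  using H_iff by blast

lemma zero_in_H: "0 \<in> H"
  using val_in_H[of 0 0 0] by simp

lemma add_in_H: "x \<in> H \<Longrightarrow> y \<in> H \<Longrightarrow> x + y \<in> H"
proof -
  assume "x \<in> H" "y \<in> H"
  then obtain i j l p q r where "x = val i j l" "y = val p q r"
    using H_iff by metis
  then have "x + y = val (i + p) (j + q) (l + r)" by (simp add: algebra_simps)
  then show "x + y \<in> H" using val_in_H by metis
qed

text \<open>To such a monomial no move applies.\<close>

lemma isolated:
  assumes "\<not> (\<alpha> \<le> i \<and> \<gamma>' \<le> l)" "\<not> \<beta> + \<beta>' \<le> j" "\<not> \<alpha> + \<alpha>' \<le> i"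
    "\<not> (\<beta>' \<le> j \<and> \<gamma> \<le> l)" "\<not> (\<alpha>' \<le> i \<and> \<beta> \<le> j)" "\<not> \<gamma> + \<gamma>' \<le> l"
    and "val i j l = val p q r"
  shows "p = i \<and> q = j \<and> r = l"
proof (rule connected[where E = "\<lambda>p q r. p = i \<and> q = j \<and> r = l"])
  show "move_closed \<alpha> \<beta> \<gamma> \<alpha>' \<beta>' \<gamma>' (\<lambda>p q r. p = i \<and> q = j \<and> r = l)"
    unfolding move_closed_def using assms(1-6) exp_pos by auto
qed (use assms in auto)

text \<open>The moves relate \<open>(i, j + \<beta>', l)\<close> to the vectors \<open>(i - s \<alpha>', j + \<beta>' - s \<beta>, l + s (\<gamma> + \<gamma>'))\<close> and to
  nothing else: only the third minor ever applies.\<close>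

lemma class_of_box:
  assumes "i < \<alpha>" "j < \<beta>" "l < \<gamma>" and eq: "val i (j + \<beta>') l = val p q r"
  shows "p < \<alpha>"
proof -
  let ?E = "\<lambda>x y z. \<exists>s. x + s * \<alpha>' = i \<and> y + s * \<beta> = j + \<beta>' \<and> z = l + s * (\<gamma> + \<gamma>')"
  have "?E p q r"
  proof (rule connected[OF _ eq])
    have step: "?E (x + \<alpha>') (y + \<beta>) z \<longleftrightarrow> ?E x y (z + (\<gamma> + \<gamma>'))" for x y z
    proof
      assume "?E (x + \<alpha>') (y + \<beta>) z"
      then obtain s where "x + \<alpha>' + s * \<alpha>' = i \<and> y + \<beta> + s * \<beta> = j + \<beta>' \<and> z = l + s * (\<gamma> + \<gamma>')"
        by blast
      then show "?E x y (z + (\<gamma> + \<gamma>'))" by (intro exI[of _ "Suc s"]) auto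
    next
      assume "?E x y (z + (\<gamma> + \<gamma>'))"
      then obtain s where s: "x + s * \<alpha>' = i" "y + s * \<beta> = j + \<beta>'" "z + (\<gamma> + \<gamma>') = l + s * (\<gamma> + \<gamma>')"
        by blast
      then obtain s' where "s = Suc s'"
        using \<open>l < \<gamma>\<close> by (cases s) auto
      with s show "?E (x + \<alpha>') (y + \<beta>) z" by (intro exI[of _ s']) auto
    qed
    have no1: "\<not> ?E (x + \<alpha>) y z" for x y z
      using \<open>i < \<alpha>\<close> by auto
    have no2: "\<not> ?E x (y + (\<beta> + \<beta>')) z" for x y z
      using \<open>j < \<beta>\<close> by auto
    have no3: "\<not> ?E x (y + \<beta>') (z + \<gamma>)" for x y z
    proof
      assume "?E x (y + \<beta>') (z + \<gamma>)"
      then obtain s where s: "y + \<beta>' + s * \<beta> = j + \<beta>'" "z + \<gamma> = l + s * (\<gamma> + \<gamma>')" by blast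
      then show False using \<open>j < \<beta>\<close> \<open>l < \<gamma>\<close> by (cases s) auto
    qed
    show "move_closed \<alpha> \<beta> \<gamma> \<alpha>' \<beta>' \<gamma>' ?E"
      unfolding move_closed_def
      using step no1 no2 no3 no1[of "_ + \<alpha>'"] by (simp only: add.assoc add.commute[of \<alpha>]) blast
    show "?E i (j + \<beta>') l" by (intro exI[of _ 0]) auto
  qed
  then show ?thesis using \<open>i < \<alpha>\<close> by auto
qed

lemma m_eqs: "m = val \<alpha> 0 (\<gamma> + \<gamma>')" "m = val (\<alpha> + \<alpha>') \<beta> 0" "m = val 0 (\<beta> + \<beta>') \<gamma>"
  using rel1 rel2 rel3 by (simp_all add: m_def algebra_simps)

lemma m'_eqs: "m' = val \<alpha>' (\<beta> + \<beta>') 0" "m' = val (\<alpha> + \<alpha>') 0 \<gamma>'" "m' = val 0 \<beta>' (\<gamma> + \<gamma>')"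
  using rel1 rel2 rel3 by (simp_all add: m'_def algebra_simps)

text \<open>The numbers \<open>m\<close> and \<open>m'\<close> are the degrees of the two syzygies of the minors. All monomials of these
  degrees are listed; none is divisible by \<open>XYZ\<close>, which makes \<open>m - (a1 + a2 + a3)\<close> and
  \<open>m' - (a1 + a2 + a3)\<close> gaps of \<open>H\<close>.\<close>

lemma m_class:
  assumes "m = val p q r"
  shows "(p, q, r) \<in> {(\<alpha>, 0, \<gamma> + \<gamma>'), (\<alpha> + \<alpha>', \<beta>, 0), (0, \<beta> + \<beta>', \<gamma>)}"
proof (rule connected[where E = "\<lambda>p q r. (p, q, r) \<in> {(\<alpha>, 0, \<gamma> + \<gamma>'), (\<alpha> + \<alpha>', \<beta>, 0), (0, \<beta> + \<beta>', \<gamma>)}"])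
  show "val \<alpha> 0 (\<gamma> + \<gamma>') = val p q r" using assms m_eqs(1) by simp
  show "move_closed \<alpha> \<beta> \<gamma> \<alpha>' \<beta>' \<gamma>' (\<lambda>p q r. (p, q, r) \<in> {(\<alpha>, 0, \<gamma> + \<gamma>'), (\<alpha> + \<alpha>', \<beta>, 0), (0, \<beta> + \<beta>', \<gamma>)})"
    unfolding move_closed_def using exp_pos by auto
qed auto

lemma m'_class:
  assumes "m' = val p q r"
  shows "(p, q, r) \<in> {(\<alpha>', \<beta> + \<beta>', 0), (\<alpha> + \<alpha>', 0, \<gamma>'), (0, \<beta>', \<gamma> + \<gamma>')}"
proof (rule connected[where E = "\<lambda>p q r. (p, q, r) \<in> {(\<alpha>', \<beta> + \<beta>', 0), (\<alpha> + \<alpha>', 0, \<gamma>'), (0, \<beta>', \<gamma> + \<gamma>')}"])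
  show "val \<alpha>' (\<beta> + \<beta>') 0 = val p q r" using assms m'_eqs(1) by simp
  show "move_closed \<alpha> \<beta> \<gamma> \<alpha>' \<beta>' \<gamma>' (\<lambda>p q r. (p, q, r) \<in> {(\<alpha>', \<beta> + \<beta>', 0), (\<alpha> + \<alpha>', 0, \<gamma>'), (0, \<beta>', \<gamma> + \<gamma>')})"
    unfolding move_closed_def using exp_pos by auto
qed auto

lemma m_neq_m': "m \<noteq> m'"
proof
  assume "m = m'"
  then show False using m_class[of \<alpha>' "\<beta> + \<beta>'" 0] m'_eqs(1) exp_pos by auto
qed

lemma m_minus_sum_gap: "x + a1 + a2 + a3 \<in> {m, m'} \<Longrightarrow> x \<notin> H"
proof
  assume x: "x + a1 + a2 + a3 \<in> {m, m'}" "x \<in> H"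
  then obtain i j l where "x = val i j l" using H_iff by blast
  then have "x + a1 + a2 + a3 = val (Suc i) (Suc j) (Suc l)" by (simp add: algebra_simps)
  then show False using x(1) m_class[of "Suc i" "Suc j" "Suc l"] m'_class[of "Suc i" "Suc j" "Suc l"] by auto
qed

text \<open>As \<open>y\<close> is a gap, no monomial of degree \<open>y + a1 + a2\<close> is divisible by \<open>XY\<close>, and no monomial of degree
  \<open>y + a1\<close> by \<open>X\<close>. So there are monomials of degree \<open>y + a1 + a2\<close> with and without \<open>X\<close>, and some move
  leads from the latter to the former. The two moves that do so without producing a multiple of \<open>XY\<close>
  are the two alternatives; for larger \<open>r\<close> a further move would produce one.\<close>

lemma leave_face:
  assumes y: "y \<notin> H" and "y + a1 \<in> H" "y + a2 \<in> H"
  shows "(\<exists>r<\<gamma>. y + a1 + a2 = val 0 (\<beta> + \<beta>') r) \<or> (\<exists>r<\<gamma>'. y + a1 + a2 = val 0 \<beta>' (\<gamma> + r))"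
proof (rule ccontr)
  assume neg: "\<not> ?thesis"
  have no: "p = 0 \<or> q = 0" if "y + a1 + a2 = val p q r" for p q r
  proof (rule ccontr)
    assume "\<not> (p = 0 \<or> q = 0)"
    then obtain p' q' where "p = Suc p'" "q = Suc q'" by (meson not0_implies_Suc)
    then have "y = val p' q' r" using that by simp
    then show False using y val_in_H by blast
  qed
  have A: False if "y + a1 + a2 = val 0 (\<beta> + \<beta>') r" for r
  proof -
    have "r \<ge> \<gamma>" using that neg by (meson not_less)
    then have "y + a1 + a2 = val (\<alpha> + \<alpha>') \<beta> (r - \<gamma>)"
      using that rel2 m_eqs by (simp add: algebra_simps diff_mult_distrib2)
    then show False using no exp_pos by fastforce
  qed
  have B: False if "y + a1 + a2 = val 0 \<beta>' (\<gamma> + r)" for r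
  proof -
    have "r \<ge> \<gamma>'" using that neg by (meson not_less)
    then obtain s where "r = \<gamma>' + s" using le_Suc_ex by blast
    then have "y + a1 + a2 = val \<alpha>' (\<beta> + \<beta>') s"
      using that rel3 by (simp add: algebra_simps)
    then show False using no exp_pos by fastforce
  qed
  obtain i j l where u: "y + a1 = val i j l" using assms H_iff by metis
  obtain p q r where v: "y + a2 = val p q r" using assms H_iff by metis
  have i: "i = 0"
  proof (rule ccontr)
    assume "i \<noteq> 0"
    then obtain i' where "i = Suc i'" by (meson not0_implies_Suc)
    then have "y = val i' j l" using u by simp
    then show False using y val_in_H by blast
  qed
  \<comment> \<open>The monomials of degree \<open>y + a1 + a2\<close> that are free of \<open>X\<close>; if the conclusion fails, no move leaves
    this set.\<close>
  define E where "E = (\<lambda>p q r. y + a1 + a2 = val p q r \<and> p = 0)"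
  have "move_closed \<alpha> \<beta> \<gamma> \<alpha>' \<beta>' \<gamma>' E"
    unfolding move_closed_def
  proof (intro conjI allI)
    fix i j l
    have "val (i + \<alpha>) j (l + \<gamma>') = val i (j + (\<beta> + \<beta>')) l"
      using rel1 by (simp add: algebra_simps)
    moreover have "\<not> E i (j + (\<beta> + \<beta>')) l"
    proof
      assume E: "E i (j + (\<beta> + \<beta>')) l"
      then have "y + a1 + a2 = val (i + \<alpha>) j (l + \<gamma>')"
        using calculation by (simp add: E_def)
      then have "j = 0" using no exp_pos by (metis add_is_0 not_gr0)
      then show False using A[of l] E by (simp add: E_def)
    qed
    ultimately show "E (i + \<alpha>) j (l + \<gamma>') = E i (j + (\<beta> + \<beta>')) l"
      using exp_pos by (simp add: E_def)
  next
    fix i j l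
    have "val (i + (\<alpha> + \<alpha>')) j l = val i (j + \<beta>') (l + \<gamma>)"
      using rel2 by (simp add: algebra_simps)
    moreover have "\<not> E i (j + \<beta>') (l + \<gamma>)"
    proof
      assume E: "E i (j + \<beta>') (l + \<gamma>)"
      then have "y + a1 + a2 = val (i + (\<alpha> + \<alpha>')) j l"
        using calculation by (simp add: E_def)
      then have "j = 0" using no exp_pos by (metis add_is_0 not_gr0)
      then show False using B[of l] E by (simp add: E_def add.commute)
    qed
    ultimately show "E (i + (\<alpha> + \<alpha>')) j l = E i (j + \<beta>') (l + \<gamma>)"
      using exp_pos by (simp add: E_def)
  next
    fix i j l
    have "val (i + \<alpha>') (j + \<beta>) l = val i j (l + (\<gamma> + \<gamma>'))"
      using rel3 by (simp add: algebra_simps)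
    moreover have "\<not> E i j (l + (\<gamma> + \<gamma>'))"
    proof
      assume E: "E i j (l + (\<gamma> + \<gamma>'))"
      then have "y + a1 + a2 = val (i + \<alpha>') (j + \<beta>) l"
        using calculation by (simp add: E_def)
      then show False using no exp_pos by (metis add_is_0 not_gr0)
    qed
    ultimately show "E (i + \<alpha>') (j + \<beta>) l = E i j (l + (\<gamma> + \<gamma>'))"
      using exp_pos by (simp add: E_def)
  qed
  moreover have "val 0 (Suc j) l = val (Suc p) q r" "E 0 (Suc j) l"
    using u v i by (simp_all add: E_def)
  ultimately have "E (Suc p) q r" using connected by blast
  then show False by (simp add: E_def)
qed

lemma move_closed_rotate:
  "move_closed \<beta> \<gamma> \<alpha> \<beta>' \<gamma>' \<alpha>' E \<Longrightarrow> move_closed \<alpha> \<beta> \<gamma> \<alpha>' \<beta>' \<gamma>' (\<lambda>i j l. E j l i)"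
  unfolding move_closed_def by metis

lemma move_closed_swap:
  "move_closed \<alpha>' \<gamma>' \<beta>' \<alpha> \<gamma> \<beta> E \<Longrightarrow> move_closed \<alpha> \<beta> \<gamma> \<alpha>' \<beta>' \<gamma>' (\<lambda>i j l. E i l j)"
  unfolding move_closed_def by (simp add: add.commute)

text \<open>The matrix is unchanged in shape if the variables are permuted cyclically, and also if its rows
  are exchanged together with \<open>Y\<close> and \<open>Z\<close>.\<close>

lemma rotated: "herzog_data a2 a3 a1 \<beta> \<gamma> \<alpha> \<beta>' \<gamma>' \<alpha>' H"
proof
  show "x \<in> H \<longleftrightarrow> (\<exists>i j l. x = i * a2 + j * a3 + l * a1)" for x
    unfolding H_iff by (metis add.commute add.assoc)
  show "E p q r" if "move_closed \<beta> \<gamma> \<alpha> \<beta>' \<gamma>' \<alpha>' E" "i * a2 + j * a3 + l * a1 = p * a2 + q * a3 + r * a1"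
    "E i j l" for E i j l p q r
    using connected[OF move_closed_rotate[OF that(1)], of l i j r p q] that(2,3) by simp
qed (use a_pos exp_pos cofinite rel1 rel2 rel3 in \<open>auto simp: algebra_simps\<close>)

lemma swapped: "herzog_data a1 a3 a2 \<alpha>' \<gamma>' \<beta>' \<alpha> \<gamma> \<beta> H"
proof
  show "x \<in> H \<longleftrightarrow> (\<exists>i j l. x = i * a1 + j * a3 + l * a2)" for x
    unfolding H_iff by (metis add.commute add.assoc)
  show "E p q r" if "move_closed \<alpha>' \<gamma>' \<beta>' \<alpha> \<gamma> \<beta> E" "i * a1 + j * a3 + l * a2 = p * a1 + q * a3 + r * a2"
    "E i j l" for E i j l p q r
    using connected[OF move_closed_swap[OF that(1)], of i l j p r q] that(2,3) by simp
qed (use a_pos exp_pos cofinite rel1 rel2 rel3 in \<open>auto simp: algebra_simps\<close>)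

text \<open>Compare the alternatives for \<open>y + a1 + a2\<close> with those for \<open>y + a2 + a3\<close>. Each of the four
  combinations gives an equality between a power of \<open>X\<close> and a power of \<open>Z\<close> with small exponents,
  which must be trivial. This is impossible in the mixed combinations and determines \<open>y\<close> in the other
  two.\<close>

lemma pseudo_frobenius:
  assumes y: "y \<notin> H" and "y + a1 \<in> H" "y + a2 \<in> H" "y + a3 \<in> H"
  shows "y + a1 + a2 + a3 \<in> {m, m'}"
proof -
  have multiples: "k = 0 \<and> l = 0" if "k * a1 = l * a3" "k < \<alpha> + \<alpha>'" for k l
    using isolated[of k 0 0 0 0 l] that exp_pos a_pos by auto
  have multiples': "k = 0 \<and> l = 0" if "k * a1 = l * a3" "l < \<gamma> + \<gamma>'" for k l
    using isolated[of 0 l 0 k 0 0] that exp_pos a_pos by auto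
  interpret rot: herzog_data a2 a3 a1 \<beta> \<gamma> \<alpha> \<beta>' \<gamma>' \<alpha>' H by (rule rotated)
  from leave_face[OF y] rot.leave_face[OF y] assms
  consider (AA) r p where "r < \<gamma>" "y + a1 + a2 = val 0 (\<beta> + \<beta>') r" "p < \<alpha>" "y + a2 + a3 = val p 0 (\<gamma> + \<gamma>')"
    | (AB) r p where "r < \<gamma>" "y + a1 + a2 = val 0 (\<beta> + \<beta>') r" "p < \<alpha>'" "y + a2 + a3 = val (\<alpha> + p) 0 \<gamma>'"
    | (BA) r p where "r < \<gamma>'" "y + a1 + a2 = val 0 \<beta>' (\<gamma> + r)" "p < \<alpha>" "y + a2 + a3 = val p 0 (\<gamma> + \<gamma>')"
    | (BB) r p where "r < \<gamma>'" "y + a1 + a2 = val 0 \<beta>' (\<gamma> + r)" "p < \<alpha>'" "y + a2 + a3 = val (\<alpha> + p) 0 \<gamma>'"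
    by (auto simp: add.commute)
  then show ?thesis
  proof cases
    case AA
    obtain s t where s: "\<gamma> = r + 1 + s" and t: "\<alpha> = p + 1 + t"
      using AA(1,3) by (metis add.commute less_imp_add_positive add.assoc less_eqE Suc_eq_plus1 Suc_leI)
    have "t * a1 = s * a3"
      using AA(2,4) rel1 unfolding s t by (simp add: algebra_simps)
    then have "s = 0" using multiples t exp_pos by auto
    then show ?thesis using AA(2) s m_eqs(3) by simp
  next
    case AB
    have "(p + 1) * a1 = (r + 1) * a3"
      using AB(2,4) rel1 by (simp add: algebra_simps)
    then show ?thesis using multiples' AB(1) exp_pos by fastforce
  next
    case BA
    obtain s t where s: "\<gamma>' = r + 1 + s" and t: "\<alpha> = p + 1 + t"
      using BA(1,3) by (metis add.commute less_imp_add_positive add.assoc less_eqE Suc_eq_plus1 Suc_leI)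
    have "(t + \<alpha>') * a1 = (\<gamma> + s) * a3"
      using BA(2,4) rel2 unfolding s t by (simp add: algebra_simps)
    then show ?thesis using multiples t exp_pos by fastforce
  next
    case BB
    obtain s t where s: "\<gamma>' = r + 1 + s" and t: "\<alpha>' = p + 1 + t"
      using BB(1,3) by (metis add.commute less_imp_add_positive add.assoc less_eqE Suc_eq_plus1 Suc_leI)
    have "t * a1 = s * a3"
      using BB(2,4) rel2 unfolding s t by (simp add: algebra_simps)
    then have "s = 0" using multiples t exp_pos by auto
    then show ?thesis using BB(2) s m'_eqs(3) by simp
  qed
qed

lemma gap_below_pseudo_frobenius:
  assumes "y \<notin> H"
  shows "\<exists>h\<in>H. y + h + a1 + a2 + a3 \<in> {m, m'}"
proof -
  obtain c where c: "\<And>n. c \<le> n \<Longrightarrow> n \<in> H" using cofinite by blast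
  show ?thesis
    using assms
  proof (induction "c - y" arbitrary: y rule: less_induct)
    case less
    have "y < c" using c less.prems not_less by blast
    show ?case
    proof (cases "\<exists>a\<in>{a1, a2, a3}. y + a \<notin> H")
      case True
      then obtain a where a: "a \<in> {a1, a2, a3}" "y + a \<notin> H" by blast
      have "a > 0" using a a_pos by auto
      then have "c - (y + a) < c - y" using \<open>y < c\<close> by simp
      then obtain h where "h \<in> H" "y + a + h + a1 + a2 + a3 \<in> {m, m'}"
        using less.hyps[of "y + a"] a(2) by blast
      moreover have "a + h \<in> H"
        using a \<open>h \<in> H\<close> val_in_H[of 1 0 0] val_in_H[of 0 1 0] val_in_H[of 0 0 1] by (auto intro: add_in_H)
      ultimately show ?thesis by (metis add.assoc)
    next
      case False
      then show ?thesis using pseudo_frobenius[OF less.prems] zero_in_H by force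
    qed
  qed
qed

text \<open>Since \<open>b = a2 \<beta>' - a1 \<alpha> = a3 \<gamma>' - a2 \<beta> = a1 \<alpha>' - a3 \<gamma>\<close>, adding \<open>b\<close> turns a factor \<open>X\<^bsup>\<alpha>\<^esup>\<close>, \<open>Y\<^bsup>\<beta>\<^esup>\<close> or
  \<open>Z\<^bsup>\<gamma>\<^esup>\<close> into \<open>Y\<^bsup>\<beta>'\<^esup>\<close>, \<open>Z\<^bsup>\<gamma>'\<^esup>\<close> or \<open>X\<^bsup>\<alpha>'\<^esup>\<close>. Inside the box there is no such factor, and \<open>class_of_box\<close> shows
  that the shifted value is a gap.\<close>

lemma gaps_of_shift:
  assumes "m < m'"
  defines "b \<equiv> m' - m"
  shows "{h\<in>H. h + b \<notin> H} = (\<lambda>(i, j, l). val i j l) ` ({..<\<alpha>} \<times> {..<\<beta>} \<times> {..<\<gamma>})"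
proof -
  have b1: "\<alpha> * a1 + b = \<beta>' * a2" and b2: "\<beta> * a2 + b = \<gamma>' * a3" and b3: "\<gamma> * a3 + b = \<alpha>' * a1"
    using assms(1) m_eqs m'_eqs unfolding b_def by (simp_all add: algebra_simps)
  show ?thesis
  proof (intro equalityI subsetI)
    fix h assume h: "h \<in> {h\<in>H. h + b \<notin> H}"
    then obtain i j l where ijl: "h = val i j l" using H_iff by blast
    have "i < \<alpha>"
    proof (rule ccontr)
      assume "\<not> i < \<alpha>"
      then obtain i' where "i = \<alpha> + i'" by (metis le_Suc_ex not_less)
      then have "h + b = val i' (\<beta>' + j) l" using b1 ijl by (simp add: algebra_simps)
      then show False using h val_in_H by auto
    qed
    moreover have "j < \<beta>"
    proof (rule ccontr)
      assume "\<not> j < \<beta>"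
      then obtain j' where "j = \<beta> + j'" by (metis le_Suc_ex not_less)
      then have "h + b = val i j' (\<gamma>' + l)" using b2 ijl by (simp add: algebra_simps)
      then show False using h val_in_H by auto
    qed
    moreover have "l < \<gamma>"
    proof (rule ccontr)
      assume "\<not> l < \<gamma>"
      then obtain l' where "l = \<gamma> + l'" by (metis le_Suc_ex not_less)
      then have "h + b = val (\<alpha>' + i) j l'" using b3 ijl by (simp add: algebra_simps)
      then show False using h val_in_H by auto
    qed
    ultimately show "h \<in> (\<lambda>(i, j, l). val i j l) ` ({..<\<alpha>} \<times> {..<\<beta>} \<times> {..<\<gamma>})"
      using ijl by (intro image_eqI[of _ _ "(i, j, l)"]) auto
  next
    fix h assume "h \<in> (\<lambda>(i, j, l). val i j l) ` ({..<\<alpha>} \<times> {..<\<beta>} \<times> {..<\<gamma>})"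
    then obtain i j l where ijl: "h = val i j l" "i < \<alpha>" "j < \<beta>" "l < \<gamma>" by auto
    have "h + b \<notin> H"
    proof
      assume "h + b \<in> H"
      then obtain p q r where pqr: "h + b = val p q r" using H_iff by blast
      have "h + b + \<alpha> * a1 = val i (j + \<beta>') l"
        using b1 by (simp add: ijl algebra_simps)
      then have "val i (j + \<beta>') l = val (p + \<alpha>) q r"
        unfolding pqr by (simp add: algebra_simps)
      then show False using class_of_box[OF ijl(2-4)] by fastforce
    qed
    then show "h \<in> {h\<in>H. h + b \<notin> H}" using ijl(1) val_in_H by simp
  qed
qed

lemma card_gaps_of_shift:
  assumes "m < m'"
  defines "b \<equiv> m' - m"
  shows "card {h\<in>H. h + b \<notin> H} = \<alpha> * \<beta> * \<gamma>"
proof -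
  have "inj_on (\<lambda>(i, j, l). val i j l) ({..<\<alpha>} \<times> {..<\<beta>} \<times> {..<\<gamma>})"
  proof (rule inj_onI)
    fix x y
    assume xy: "x \<in> {..<\<alpha>} \<times> {..<\<beta>} \<times> {..<\<gamma>}"
      "(case x of (i, j, l) \<Rightarrow> val i j l) = (case y of (i, j, l) \<Rightarrow> val i j l)"
    obtain i j l p q r where "x = (i, j, l)" "y = (p, q, r)" by (metis prod_cases3)
    then show "x = y" using xy isolated[of i l j p q r] by auto
  qed
  then show ?thesis
    unfolding b_def gaps_of_shift[OF assms(1)] by (simp add: card_image card_cartesian_product mult.assoc)
qed

lemma type_two:
  assumes "m < m'"
  defines "b \<equiv> m' - m"
  shows "b \<notin> H" "\<exists>F. F \<notin> H \<and> F - b \<notin> H \<and> b \<le> F \<and> (\<forall>y. y \<notin> H \<longrightarrow> (\<exists>h\<in>H. y + h = F \<or> y + h + b = F))"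
proof -
  have "0 \<in> (\<lambda>(i, j, l). val i j l) ` ({..<\<alpha>} \<times> {..<\<beta>} \<times> {..<\<gamma>})"
    using exp_pos by (intro image_eqI[of _ _ "(0, 0, 0)"]) auto
  then show b: "b \<notin> H"
    unfolding gaps_of_shift[OF assms(1), symmetric] b_def by auto
  let ?N = "a1 + a2 + a3"
  define F where "F = m' - ?N"
  obtain h where "h \<in> H" "b + h + a1 + a2 + a3 \<in> {m, m'}"
    using gap_below_pseudo_frobenius[OF b] by blast
  then have F: "F + ?N = m'" "b \<le> F" "F - b + ?N = m"
    using assms(1) unfolding F_def b_def by auto
  have "F \<notin> H" "F - b \<notin> H"
    using F m_minus_sum_gap[of F] m_minus_sum_gap[of "F - b"] by (simp_all add: add.assoc)
  moreover have "\<exists>h\<in>H. y + h = F \<or> y + h + b = F" if y: "y \<notin> H" for y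
  proof -
    obtain h where "h \<in> H" "y + h + a1 + a2 + a3 \<in> {m, m'}"
      using gap_below_pseudo_frobenius[OF y] by blast
    then show ?thesis using F by (intro bexI[of _ h]) auto
  qed
  ultimately show "\<exists>F. F \<notin> H \<and> F - b \<notin> H \<and> b \<le> F \<and> (\<forall>y. y \<notin> H \<longrightarrow> (\<exists>h\<in>H. y + h = F \<or> y + h + b = F))"
    using F(2) by blast
qed

end

unbundle fps_syntax

section \<open>Power series with exponents in a numerical semigroup\<close>

definition supported :: "nat set \<Rightarrow> 'k::zero fps set" where
  "supported S = {f. \<forall>n. n \<notin> S \<longrightarrow> f $ n = 0}"

lemma semigroup_ring_eq: "semigroup_ring H = ring_on (supported H)"
  by (simp add: semigroup_ring_def supported_def)

lemma supported_zero [simp]: "0 \<in> supported S"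
  by (simp add: supported_def)

lemma supported_add: "f \<in> supported S \<Longrightarrow> g \<in> supported S \<Longrightarrow> f + g \<in> supported S"
  for f :: "'k::monoid_add fps"
  by (auto simp: supported_def)

lemma supported_mult:
  fixes f g :: "'k::comm_ring_1 fps"
  assumes "f \<in> supported S" "g \<in> supported T" and "\<And>x y. x \<in> S \<Longrightarrow> y \<in> T \<Longrightarrow> x + y \<in> U"
  shows "f * g \<in> supported U"
  unfolding supported_def
proof (clarify)
  fix n assume "n \<notin> U"
  have "f $ i * g $ (n - i) = 0" if "i \<in> {0..n}" for i
    using that assms(1,2) assms(3)[of i "n - i"] \<open>n \<notin> U\<close> unfolding supported_def by fastforce
  then show "(f * g) $ n = 0" unfolding fps_mult_nth by (intro sum.neutral) blast
qed

lemma supported_X_power: "n \<in> S \<Longrightarrow> (fps_X :: 'k::comm_ring_1 fps) ^ n \<in> supported S"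
  by (auto simp: supported_def)

locale numerical_semigroup =
  fixes H :: "nat set"
  assumes zero_in: "0 \<in> H" and add_in: "x \<in> H \<Longrightarrow> y \<in> H \<Longrightarrow> x + y \<in> H"
    and cofinite: "\<exists>c. \<forall>n\<ge>c. n \<in> H"
begin

abbreviation R :: "'k::field fps ring" where "R \<equiv> semigroup_ring H"
abbreviation RH :: "'k::field fps set" where "RH \<equiv> supported H"

lemma R_simps [simp]:
  "carrier R = RH" "x \<otimes>\<^bsub>R\<^esub> y = x * y" "x \<oplus>\<^bsub>R\<^esub> y = x + y" "\<one>\<^bsub>R\<^esub> = 1" "\<zero>\<^bsub>R\<^esub> = 0"
  by (simp_all add: semigroup_ring_eq)

lemma RH_one: "1 \<in> RH" and RH_const: "fps_const c \<in> RH"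
  using zero_in by (auto simp: supported_def)

lemma RH_mult: "f \<in> RH \<Longrightarrow> g \<in> RH \<Longrightarrow> f * g \<in> RH" for f :: "'k::field fps"
  using add_in by (auto intro: supported_mult)

lemma RH_uminus: "f \<in> RH \<Longrightarrow> - f \<in> RH" for f :: "'k::field fps"
  by (auto simp: supported_def)

lemma RH_diff: "f \<in> RH \<Longrightarrow> g \<in> RH \<Longrightarrow> f - g \<in> RH" for f :: "'k::field fps"
  by (auto simp: supported_def)

lemmas RH_closed = RH_one RH_const RH_mult RH_uminus RH_diff supported_add supported_zero

lemma cring_R: "cring R"
  unfolding semigroup_ring_eq by (rule cring_ring_on) (auto intro: RH_closed)

lemma RH_X_power: "h \<in> H \<Longrightarrow> fps_X ^ h \<in> RH"
  by (rule supported_X_power)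

lemma RH_inverse:
  fixes f :: "'k::field fps"
  assumes f: "f \<in> RH" and f0: "f $ 0 \<noteq> 0"
  shows "inverse f \<in> RH"
  unfolding supported_def
proof (clarify)
  fix n assume "n \<notin> H"
  then show "inverse f $ n = 0"
  proof (induction n rule: less_induct)
    case (less n)
    have "n > 0" using less.prems zero_in by (metis gr0I)
    have "inverse f * f = 1" using f0 by (rule inverse_mult_eq_1)
    then have "0 = (\<Sum>i=0..n. inverse f $ i * f $ (n - i))"
      using \<open>n > 0\<close> by (simp flip: fps_mult_nth)
    also have "\<dots> = (\<Sum>i=0..n. if i = n then inverse f $ n * f $ 0 else 0)"
    proof (rule sum.cong)
      fix i assume "i \<in> {0..n}"
      show "inverse f $ i * f $ (n - i) = (if i = n then inverse f $ n * f $ 0 else 0)"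
      proof (cases "i = n")
        case False
        then have "i < n" using \<open>i \<in> {0..n}\<close> by auto
        then have "i \<notin> H \<or> n - i \<notin> H"
          using less.prems add_in[of i "n - i"] by auto
        then show ?thesis using False less.IH \<open>i < n\<close> f by (auto simp: supported_def)
      qed auto
    qed simp
    finally show ?case using f0 by simp
  qed
qed

lemma Units_R: "Units R = {f \<in> RH. f $ 0 \<noteq> (0::'k::field)}"
proof -
  have "f $ 0 \<noteq> 0" if "f * g = 1" for f g :: "'k fps"
    using that by (metis fps_mult_nth_0 fps_one_nth mult_zero_left zero_neq_one)
  moreover have "\<exists>g\<in>RH. g * f = 1 \<and> f * g = 1" if "f \<in> RH" "f $ 0 \<noteq> 0" for f :: "'k fps"
    using RH_inverse[OF that] inverse_mult_eq_1[OF that(2)] by (auto simp: mult.commute)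
  ultimately show ?thesis by (auto simp: Units_def)
qed

text \<open>The \<open>R\<close>-submodules of \<open>k[[t]]\<close>; as \<open>-1 \<in> R\<close>, they are closed under negation.\<close>

definition Rmod :: "'k::field fps set \<Rightarrow> bool" where
  "Rmod J \<longleftrightarrow> 0 \<in> J \<and> (\<forall>x\<in>J. \<forall>y\<in>J. x + y \<in> J) \<and> (\<forall>r\<in>RH. \<forall>x\<in>J. r * x \<in> J)"

lemma Rmod_zero: "Rmod J \<Longrightarrow> 0 \<in> J"
  and Rmod_add: "Rmod J \<Longrightarrow> x \<in> J \<Longrightarrow> y \<in> J \<Longrightarrow> x + y \<in> J"
  and Rmod_mult: "Rmod J \<Longrightarrow> r \<in> RH \<Longrightarrow> x \<in> J \<Longrightarrow> r * x \<in> J"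
  by (auto simp: Rmod_def)

lemma Rmod_uminus: "Rmod J \<Longrightarrow> x \<in> J \<Longrightarrow> - x \<in> J"
  using Rmod_mult[of J "- 1" x] RH_uminus[OF RH_one] by simp

lemma Rmod_diff: "Rmod J \<Longrightarrow> x \<in> J \<Longrightarrow> y \<in> J \<Longrightarrow> x - y \<in> J"
  using Rmod_add[of J x "- y"] Rmod_uminus[of J y] by simp

lemma Rmod_sum: "Rmod J \<Longrightarrow> (\<And>i. i \<in> A \<Longrightarrow> F i \<in> J) \<Longrightarrow> sum F A \<in> J"
  by (induction A rule: infinite_finite_induct) (auto intro: Rmod_zero Rmod_add)

lemma Rmod_RH: "Rmod RH"
  by (auto simp: Rmod_def intro: RH_closed)

lemma Rmod_supported:
  assumes "\<And>h s. h \<in> H \<Longrightarrow> s \<in> S \<Longrightarrow> h + s \<in> S"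
  shows "Rmod (supported S)"
  using assms by (auto simp: Rmod_def intro: supported_add supported_mult)

lemma Rmod_times: "Rmod J \<Longrightarrow> Rmod ((*) q ` J)"
  unfolding Rmod_def
proof (intro conjI ballI)
  assume J: "0 \<in> J \<and> (\<forall>x\<in>J. \<forall>y\<in>J. x + y \<in> J) \<and> (\<forall>r\<in>RH. \<forall>x\<in>J. r * x \<in> J)"
  show "0 \<in> (*) q ` J" using J by force
  show "x + y \<in> (*) q ` J" if "x \<in> (*) q ` J" "y \<in> (*) q ` J" for x y
    using that J by (auto simp flip: distrib_left)
  show "r * x \<in> (*) q ` J" if r: "r \<in> RH" and x: "x \<in> (*) q ` J" for r x
  proof -
    obtain y where y: "y \<in> J" "x = q * y" using x by blast
    then have "r * x = q * (r * y)" by (simp add: mult.left_commute)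
    then show ?thesis using y(1) r J by blast
  qed
qed

lemma ideal_R_iff: "ideal J R \<longleftrightarrow> J \<subseteq> RH \<and> Rmod J"
proof
  assume "ideal J R"
  then interpret ideal J R .
  show "J \<subseteq> RH \<and> Rmod J"
    unfolding Rmod_def using a_subset additive_subgroup.zero_closed[OF is_additive_subgroup]
      additive_subgroup.a_closed[OF is_additive_subgroup] I_l_closed by auto
next
  assume "J \<subseteq> RH \<and> Rmod J"
  then show "ideal J R"
    using cring_R unfolding semigroup_ring_eq
    by (intro ideal_ring_onI) (auto intro: Rmod_zero Rmod_add Rmod_uminus Rmod_mult)
qed

lemma regular_mod_simps [simp]:
  "carrier (regular_mod R) = RH" "x \<oplus>\<^bsub>regular_mod R\<^esub> y = x + y"
  "\<zero>\<^bsub>regular_mod R\<^esub> = 0" "x \<odot>\<^bsub>regular_mod R\<^esub> y = x * y"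
  by (simp_all add: regular_mod_def)

lemma ideal_mod_simps [simp]:
  "carrier (ideal_mod R I) = I" "x \<oplus>\<^bsub>ideal_mod R I\<^esub> y = x + y"
  "\<zero>\<^bsub>ideal_mod R I\<^esub> = 0" "x \<odot>\<^bsub>ideal_mod R I\<^esub> y = x * y"
  by (simp_all add: ideal_mod_def regular_mod_def)

lemma module_ideal_mod:
  assumes "ideal I (R :: 'k::field fps ring)"
  shows "module R (ideal_mod R I)"
proof (rule moduleI)
  show "cring (R :: 'k fps ring)" by (rule cring_R)
  have I: "Rmod I" using assms ideal_R_iff by blast
  have "\<exists>y\<in>I. y + x = 0" if "x \<in> I" for x
    using Rmod_uminus[OF I that] by (intro bexI[of _ "- x"]) auto
  then show "abelian_group (ideal_mod R I)"
    using I by (intro abelian_groupI) (auto intro: Rmod_zero Rmod_add simp: algebra_simps)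
qed (use assms[unfolded ideal_R_iff] in \<open>auto simp: algebra_simps intro: Rmod_mult\<close>)

lemma regular_mod_eq_ideal_mod: "regular_mod R = ideal_mod R RH"
  by (simp add: ideal_mod_def regular_mod_def)

lemma submodule_regular_iff:
  fixes J :: "'k::field fps set"
  shows "submodule J R (regular_mod R) \<longleftrightarrow> J \<subseteq> RH \<and> Rmod J"
proof
  assume "submodule J R (regular_mod R)"
  then interpret submodule J R "regular_mod R" .
  show "J \<subseteq> RH \<and> Rmod J"
    unfolding Rmod_def using subset smult_closed m_closed one_closed by auto
next
  assume J: "J \<subseteq> RH \<and> Rmod J"
  interpret module R "regular_mod R"
    unfolding regular_mod_eq_ideal_mod by (rule module_ideal_mod) (simp add: ideal_R_iff Rmod_RH)
  have "\<ominus>\<^bsub>regular_mod R\<^esub> a = - a" if "a \<in> RH" for a :: "'k fps"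
    using that by (intro M.minus_equality) (auto intro: RH_uminus)
  then have "\<ominus>\<^bsub>regular_mod R\<^esub> a \<in> J" if "a \<in> J" for a
    using that J Rmod_uminus[of J a] by auto
  then show "submodule J R (regular_mod R)"
    using J by (intro submoduleI) (auto intro: Rmod_zero Rmod_add Rmod_mult)
qed

section \<open>Length and value sets\<close>

definition vals :: "'k::field fps set \<Rightarrow> nat set" where
  "vals J = subdegree ` (J - {0})"

lemma valsI: "f \<in> J \<Longrightarrow> f $ d \<noteq> 0 \<Longrightarrow> (\<And>n. n < d \<Longrightarrow> f $ n = 0) \<Longrightarrow> d \<in> vals J"
  unfolding vals_def by (rule image_eqI[of _ _ f]) (auto intro!: subdegreeI[symmetric])

lemma valsE:
  assumes "d \<in> vals J"
  obtains f where "f \<in> J" "f $ d \<noteq> 0" "\<And>n. n < d \<Longrightarrow> f $ n = 0"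
proof -
  from assms obtain f where "f \<in> J" "f \<noteq> 0" "d = subdegree f" unfolding vals_def by blast
  then have "f $ d \<noteq> 0" "n < d \<Longrightarrow> f $ n = 0" for n by auto
  with \<open>f \<in> J\<close> show thesis by (rule that)
qed

lemma vals_mono: "J \<subseteq> J' \<Longrightarrow> vals J \<subseteq> vals J'"
  by (auto simp: vals_def)

definition contains_tail :: "nat \<Rightarrow> 'k::field fps set \<Rightarrow> bool" where
  "contains_tail c L \<longleftrightarrow> (\<forall>f. (\<forall>n<c. f $ n = 0) \<longrightarrow> f \<in> L)"

lemma contains_tailD: "contains_tail c L \<Longrightarrow> (\<And>n. n < c \<Longrightarrow> f $ n = 0) \<Longrightarrow> f \<in> L"
  by (auto simp: contains_tail_def)

lemma contains_tail_mono: "contains_tail c L \<Longrightarrow> L \<subseteq> L' \<Longrightarrow> contains_tail c L'"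
  by (auto simp: contains_tail_def)

text \<open>Leading terms of an element of \<open>N\<close> can be cancelled by elements of \<open>L\<close> until its order is at
  least \<open>c\<close>.\<close>

lemma vals_subset_imp_subset:
  assumes L: "Rmod L" and N: "Rmod N" and "L \<subseteq> N" and "vals N \<subseteq> vals L"
    and c: "contains_tail c L"
  shows "N \<subseteq> L"
proof
  have *: "f \<in> N \<Longrightarrow> (\<And>n. n < d \<Longrightarrow> f $ n = 0) \<Longrightarrow> f \<in> L" if "d \<le> c" for d f
    using that
  proof (induction arbitrary: f rule: inc_induct)
    case base
    then show ?case using contains_tailD[OF c] by blast
  next
    case (step d)
    show ?case
    proof (cases "f $ d = 0")
      case True
      then show ?thesis using step by (metis less_Suc_eq)
    next
      case False
      then have "d \<in> vals N" using step.prems by (intro valsI)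
      then obtain g where g: "g \<in> L" "g $ d \<noteq> 0" "\<And>n. n < d \<Longrightarrow> g $ n = 0"
        using \<open>vals N \<subseteq> vals L\<close> valsE by blast
      let ?g = "fps_const (f $ d / g $ d) * g"
      have gL: "?g \<in> L" using L g(1) RH_const by (intro Rmod_mult)
      then have "f - ?g \<in> N" using N step.prems(1) \<open>L \<subseteq> N\<close> by (intro Rmod_diff) auto
      moreover have "(f - ?g) $ n = 0" if "n < Suc d" for n
        using that step.prems(2) g(2,3) by (cases "n = d") auto
      ultimately have "f - ?g \<in> L" by (rule step.IH)
      then show ?thesis using Rmod_add[OF L _ gL] by fastforce
    qed
  qed
  fix f assume "f \<in> N"
  then show "f \<in> L" by (rule *[OF le0]) simp
qed

lemma finite_vals_diff:
  assumes c: "contains_tail c L"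
  shows "finite (vals N - vals L)"
proof -
  have "n \<in> vals L" if "n \<ge> c" for n
  proof (rule valsI)
    show "fps_X ^ n \<in> L" using that by (intro contains_tailD[OF c]) simp
  qed simp_all
  then have "vals N - vals L \<subseteq> {..<c}" by (auto simp: not_le[symmetric])
  then show ?thesis by (rule finite_subset) simp
qed

text \<open>If \<open>d\<close> is the largest order in \<open>N\<close> that is missing in \<open>L\<close>, then \<open>d\<close> is the one order gained by
  adjoining to \<open>L\<close> all elements of \<open>N\<close> of order at least \<open>d\<close>.\<close>

lemma chain_of_length_vals_diff:
  assumes "Rmod L" and N: "Rmod N" "N \<subseteq> RH" and "L \<subseteq> N"
    and "contains_tail c L"
  shows "\<exists>C :: nat \<Rightarrow> 'k::field fps set. C 0 = L \<and> C (card (vals N - vals L)) = N \<and>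
     (\<forall>i\<le>card (vals N - vals L). submodule (C i) R (regular_mod R)) \<and>
     (\<forall>i<card (vals N - vals L). C i \<subset> C (Suc i))"
  using assms(1,4,5)
proof (induction "card (vals N - vals L)" arbitrary: L)
  case 0
  note c = "0.prems"(3)
  have "vals N \<subseteq> vals L" using "0.hyps" finite_vals_diff[OF c]
    by (metis Diff_eq_empty_iff card_0_eq)
  then have "N \<subseteq> L" using 0 N c by (intro vals_subset_imp_subset[of L N c]) auto
  then show ?case
    using 0 N by (intro exI[of _ "\<lambda>_. L"]) (auto simp: submodule_regular_iff)
next
  case (Suc s)
  note c = "Suc.prems"(3)
  have fin: "finite (vals N - vals L)" using finite_vals_diff[OF c] .
  define d where "d = Max (vals N - vals L)"
  have ne: "vals N - vals L \<noteq> {}" using Suc.hyps(2) by force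
  then have d: "d \<in> vals N" "d \<notin> vals L" using Max_in[OF fin] by (auto simp: d_def)
  have d_max: "n \<le> d" if "n \<in> vals N" "n \<notin> vals L" for n
    using that fin by (auto simp: d_def)
  \<comment> \<open>The order \<open>d\<close> is the largest missing one, so the series adjoined contribute \<open>d\<close> and no other new order.\<close>
  define L' where "L' = {l + f | l f. l \<in> L \<and> f \<in> N \<and> (\<forall>n<d. f $ n = 0)}"
  have "L \<subseteq> L'" using Rmod_zero[OF N(1)] by (force simp: L'_def)
  have "L' \<subseteq> N" using Rmod_add[OF N(1)] \<open>L \<subseteq> N\<close> by (auto simp: L'_def)
  have "Rmod L'"
    unfolding Rmod_def
  proof (intro conjI ballI)
    show "0 \<in> L'" using \<open>L \<subseteq> L'\<close> Rmod_zero[OF Suc.prems(1)] by blast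
    fix x y assume "x \<in> L'" "y \<in> L'"
    then obtain l f l' f' where "x = l + f" "y = l' + f'" "l \<in> L" "l' \<in> L" "f \<in> N" "f' \<in> N"
      "\<forall>n<d. f $ n = 0" "\<forall>n<d. f' $ n = 0"
      unfolding L'_def by blast
    then show "x + y \<in> L'"
      unfolding L'_def using Rmod_add[OF N(1)] Rmod_add[OF Suc.prems(1)]
      by (intro CollectI exI[of _ "l + l'"] exI[of _ "f + f'"]) auto
  next
    fix r x :: "'k fps" assume r: "r \<in> RH" and "x \<in> L'"
    then obtain l f where lf: "x = l + f" "l \<in> L" "f \<in> N" "\<forall>n<d. f $ n = 0"
      unfolding L'_def by blast
    have "(r * f) $ n = 0" if "n < d" for n
      using lf(4) that by (auto simp: fps_mult_nth intro!: sum.neutral)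
    then show "r * x \<in> L'"
      unfolding L'_def using lf r Rmod_mult[OF N(1)] Rmod_mult[OF Suc.prems(1)]
      by (intro CollectI exI[of _ "r * l"] exI[of _ "r * f"]) (auto simp: distrib_left)
  qed
  have vals_L': "vals L' = insert d (vals L)"
  proof (intro equalityI subsetI)
    fix n assume "n \<in> insert d (vals L)"
    moreover have "d \<in> vals L'"
    proof -
      obtain f where f: "f \<in> N" "f $ d \<noteq> 0" "\<And>n. n < d \<Longrightarrow> f $ n = 0" using d(1) valsE by blast
      then have "0 + f \<in> L'" unfolding L'_def using Rmod_zero[OF Suc.prems(1)] by blast
      then show ?thesis using f by (intro valsI[of f]) auto
    qed
    ultimately show "n \<in> vals L'" using vals_mono[OF \<open>L \<subseteq> L'\<close>] by blast
  next
    fix n assume n: "n \<in> vals L'"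
    then obtain g where g: "g \<in> L'" "g $ n \<noteq> 0" "\<And>k. k < n \<Longrightarrow> g $ k = 0" using valsE by blast
    then obtain l f where lf: "g = l + f" "l \<in> L" "\<forall>n<d. f $ n = 0" unfolding L'_def by blast
    show "n \<in> insert d (vals L)"
    proof (cases "n < d")
      case True
      then have "n \<in> vals L" using g lf by (intro valsI[of l]) auto
      then show ?thesis by simp
    next
      case False
      have "n \<in> vals N" using n vals_mono[OF \<open>L' \<subseteq> N\<close>] by blast
      then show ?thesis using False d_max[of n] by auto
    qed
  qed
  have "vals N - vals L' = vals N - vals L - {d}" using vals_L' by blast
  then have card: "card (vals N - vals L') = s"
    using Suc.hyps(2) d fin by simp
  have c': "contains_tail c L'"
    using c \<open>L \<subseteq> L'\<close> by (rule contains_tail_mono)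
  obtain C' where C': "C' 0 = L'" "C' s = N" "\<forall>i\<le>s. submodule (C' i) R (regular_mod R)"
     "\<forall>i<s. C' i \<subset> C' (Suc i)"
    using Suc.hyps(1)[OF card[symmetric] \<open>Rmod L'\<close> \<open>L' \<subseteq> N\<close> c'] unfolding card by blast
  have "L \<subset> L'" using \<open>L \<subseteq> L'\<close> vals_L' d(2) by blast
  define C where "C = (\<lambda>i. case i of 0 \<Rightarrow> L | Suc j \<Rightarrow> C' j)"
  have "submodule L R (regular_mod R)" using Suc.prems N by (auto simp: submodule_regular_iff)
  then have "\<forall>i\<le>Suc s. submodule (C i) R (regular_mod R)"
    using C'(3) unfolding C_def by (simp split: nat.split)
  moreover have "\<forall>i<Suc s. C i \<subset> C (Suc i)"
    using C'(1,4) \<open>L \<subset> L'\<close> unfolding C_def by (simp split: nat.split)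
  moreover have "C 0 = L" "C (Suc s) = N" by (simp_all add: C_def C'(2))
  moreover have "card (vals N - vals L) = Suc s" using Suc.hyps(2) by simp
  ultimately have "C 0 = L \<and> C (card (vals N - vals L)) = N \<and>
     (\<forall>i\<le>card (vals N - vals L). submodule (C i) R (regular_mod R)) \<and>
     (\<forall>i<card (vals N - vals L). C i \<subset> C (Suc i))"
    by simp
  then show ?case by (rule exI[of _ C])
qed

lemma chain_length_le_vals_diff:
  assumes L: "Rmod L"
    and c: "contains_tail c L"
    and C: "C 0 = L" "C s = N" "\<forall>i\<le>s. submodule (C i) R (regular_mod R)" "\<forall>i<s. C i \<subset> C (Suc i)"
  shows "s \<le> card (vals N - vals L)"
proof -
  have "L \<subseteq> C i \<and> i \<le> card (vals (C i) - vals L)" if "i \<le> s" for i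
    using that
  proof (induction i)
    case (Suc i)
    then have IH: "L \<subseteq> C i" "i \<le> card (vals (C i) - vals L)" by auto
    have strict: "C i \<subset> C (Suc i)" using C(4) Suc.prems by simp
    have "\<not> vals (C (Suc i)) \<subseteq> vals (C i)"
    proof
      assume "vals (C (Suc i)) \<subseteq> vals (C i)"
      moreover have "Rmod (C i)" "Rmod (C (Suc i))"
        using C(3) Suc.prems by (simp_all add: submodule_regular_iff)
      moreover have "contains_tail c (C i)"
        using contains_tail_mono[OF c IH(1)] .
      ultimately have "C (Suc i) \<subseteq> C i"
        using vals_subset_imp_subset[OF _ _ psubset_imp_subset[OF strict]] by metis
      then show False using strict by blast
    qed
    then have "vals (C i) - vals L \<subset> vals (C (Suc i)) - vals L"
      using vals_mono[OF psubset_imp_subset[OF strict]] vals_mono[OF IH(1)] by blast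
    then have "card (vals (C i) - vals L) < card (vals (C (Suc i)) - vals L)"
      using finite_vals_diff[OF c] by (intro psubset_card_mono)
    then have "Suc i \<le> card (vals (C (Suc i)) - vals L)" using IH(2) by linarith
    moreover have "L \<subseteq> C (Suc i)" using IH(1) psubset_imp_subset[OF strict] by (rule subset_trans)
    ultimately show ?case by blast
  qed (simp add: C(1))
  from this[of s] show ?thesis using C(2) by simp
qed

text \<open>The rings \<open>R\<close> and \<open>k[[t]]\<close> have the same residue field, so each order contributes \<open>1\<close> to the length.\<close>

theorem quot_length_eq_card_vals:
  fixes L N :: "'k::field fps set"
  assumes "Rmod L" "Rmod N" "N \<subseteq> RH" "L \<subseteq> N"
    and c: "contains_tail c L"
  shows "quot_length R (regular_mod R) N L = enat (card (vals N - vals L))"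
  unfolding quot_length_def
proof (rule antisym)
  show "Sup {enat s |s. \<exists>C. C 0 = L \<and> C s = N \<and> (\<forall>i\<le>s. submodule (C i) R (regular_mod R)) \<and>
      (\<forall>i<s. C i \<subset> C (Suc i))} \<le> enat (card (vals N - vals L))"
  proof (rule Sup_least, clarify)
    fix s and C :: "nat \<Rightarrow> 'k fps set"
    assume "L = C 0" "N = C s" "\<forall>i\<le>s. submodule (C i) R (regular_mod R)" "\<forall>i<s. C i \<subset> C (Suc i)"
    then show "enat s \<le> enat (card (vals (C s) - vals (C 0)))"
      using chain_length_le_vals_diff[OF assms(1) c, of C s N] by simp
  qed
  show "enat (card (vals N - vals L)) \<le>
      Sup {enat s |s. \<exists>C. C 0 = L \<and> C s = N \<and> (\<forall>i\<le>s. submodule (C i) R (regular_mod R)) \<and>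
      (\<forall>i<s. C i \<subset> C (Suc i))}"
    using chain_of_length_vals_diff[OF assms(1-3) \<open>L \<subseteq> N\<close> c] by (intro Sup_upper) blast
qed

end

section \<open>Submodules of a free module over a power series ring in one variable\<close>

definition fps_submodule :: "('i \<Rightarrow> 'k::field fps) set \<Rightarrow> bool" where
  "fps_submodule V \<longleftrightarrow> (\<lambda>_. 0) \<in> V \<and> (\<forall>x\<in>V. \<forall>y\<in>V. (\<lambda>i. x i + y i) \<in> V) \<and>
     (\<forall>a. \<forall>x\<in>V. (\<lambda>i. a * x i) \<in> V)"

lemma fps_submodule_diff:
  assumes "fps_submodule V" "x \<in> V" "y \<in> V"
  shows "(\<lambda>i. x i - a * y i) \<in> V"
proof -
  have "(\<lambda>i. (- a) * y i) \<in> V"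
    using assms unfolding fps_submodule_def by blast
  moreover have "(\<lambda>i. u i + v i) \<in> V" if "u \<in> V" "v \<in> V" for u v
    using assms(1) that unfolding fps_submodule_def by blast
  ultimately have "(\<lambda>i. x i + (- a) * y i) \<in> V" using assms(2) by blast
  then show ?thesis by simp
qed

lemma fps_submodule_zero_coordinate:
  assumes "fps_submodule V"
  shows "fps_submodule {x \<in> V. x j = 0}"
  using assms unfolding fps_submodule_def by auto

text \<open>An element of \<open>V\<close> whose \<open>j\<close>-th coordinate has the least order can be used to clear that coordinate
  in all the others.\<close>

lemma fps_submodule_finitely_generated:
  fixes V :: "('i \<Rightarrow> 'k::field fps) set"
  assumes "finite S" "fps_submodule V" "\<And>x i. x \<in> V \<Longrightarrow> i \<notin> S \<Longrightarrow> x i = 0"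
  shows "\<exists>n g. (\<forall>i<n. g i \<in> V) \<and> (\<forall>x\<in>V. \<exists>a. \<forall>s. x s = (\<Sum>i<(n::nat). a i * g i s))"
  using assms
proof (induction S arbitrary: V rule: finite_induct)
  case empty
  then show ?case by (intro exI[of _ 0]) auto
next
  case (insert j S)
  let ?V' = "{x \<in> V. x j = 0}"
  have "\<exists>n g. (\<forall>i<n. g i \<in> ?V') \<and> (\<forall>x\<in>?V'. \<exists>a. \<forall>s. x s = (\<Sum>i<(n::nat). a i * g i s))"
  proof (rule insert.IH)
    show "fps_submodule ?V'" using insert.prems(1) by (rule fps_submodule_zero_coordinate)
    show "x i = 0" if "x \<in> ?V'" "i \<notin> S" for x i
      using that insert.prems(2)[of x i] by (cases "i = j") auto
  qed
  then obtain n g where g: "\<And>i. i < n \<Longrightarrow> g i \<in> ?V'"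
    and gen: "\<And>x. x \<in> ?V' \<Longrightarrow> \<exists>a. \<forall>s. x s = (\<Sum>i<(n::nat). a i * g i s)"
    by blast
  show ?case
  proof (cases "V \<subseteq> ?V'")
    case True
    then show ?thesis using g gen by (intro exI[of _ n] exI[of _ g]) blast
  next
    case False
    define P where "P = (\<lambda>d. \<exists>x\<in>V. x j \<noteq> 0 \<and> subdegree (x j) = d)"
    have "\<exists>d. P d" using False unfolding P_def by blast
    then have "P (LEAST d. P d)" by (rule LeastI_ex)
    then obtain x where x: "x \<in> V" "x j \<noteq> 0" "subdegree (x j) = (LEAST d. P d)"
      unfolding P_def by blast
    have dvd: "x j dvd y j" if "y \<in> V" for y
    proof (cases "y j = 0")
      case False
      then have "P (subdegree (y j))" using that unfolding P_def by blast
      then have "subdegree (x j) \<le> subdegree (y j)" unfolding x(3) by (rule Least_le)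
      then show ?thesis using x(2) False by (simp add: fps_dvd_iff)
    qed simp
    define g' where "g' = g(n := x)"
    have "\<exists>a. \<forall>s. y s = (\<Sum>i<Suc n. a i * g' i s)" if y: "y \<in> V" for y
    proof -
      obtain q where q: "y j = q * x j" using dvd[OF y] by (metis dvdE mult.commute)
      have "(\<lambda>i. y i - q * x i) \<in> ?V'"
        using fps_submodule_diff[OF insert.prems(1) y x(1)] q by simp
      then obtain a where a: "\<And>s. y s - q * x s = (\<Sum>i<n. a i * g i s)" using gen by blast
      have "y s = (\<Sum>i<Suc n. (a(n := q)) i * g' i s)" for s
      proof -
        have "(\<Sum>i<n. (a(n := q)) i * g' i s) = (\<Sum>i<n. a i * g i s)"
          by (intro sum.cong) (auto simp: g'_def)
        then show ?thesis using a[of s] by (simp add: g'_def algebra_simps)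
      qed
      then show ?thesis by blast
    qed
    moreover have "\<forall>i<Suc n. g' i \<in> V"
      using g x(1) by (auto simp: g'_def less_Suc_eq)
    ultimately show ?thesis by blast
  qed
qed

text \<open>A saturated nonzero submodule contains a vector \<open>z\<close> with a coordinate \<open>z j = 1\<close>: otherwise all
  coordinates of a vector of least order are divisible by the variable. Then \<open>V\<close> is the sum of the multiples
  of \<open>z\<close> and the vectors of \<open>V\<close> with \<open>j\<close>-th coordinate \<open>0\<close>, to which induction applies.\<close>

lemma saturated_extend_functional:
  fixes V :: "('i \<Rightarrow> 'k::field fps) set" and lam :: "('i \<Rightarrow> 'k fps) \<Rightarrow> 'k fps"
  assumes "finite S" "fps_submodule V" "\<And>x i. x \<in> V \<Longrightarrow> i \<notin> S \<Longrightarrow> x i = 0"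
    and "\<And>x. (\<lambda>i. fps_X * x i) \<in> V \<Longrightarrow> x \<in> V"
    and add: "\<And>x y. x \<in> V \<Longrightarrow> y \<in> V \<Longrightarrow> lam (\<lambda>i. x i + y i) = lam x + lam y"
    and mult: "\<And>a x. x \<in> V \<Longrightarrow> lam (\<lambda>i. a * x i) = a * lam x"
  shows "\<exists>c. \<forall>x\<in>V. lam x = (\<Sum>i\<in>S. c i * x i)"
  using assms
proof (induction S arbitrary: V rule: finite_psubset_induct)
  case (psubset S)
  note sub = psubset.prems(1) and supp = psubset.prems(2) and sat = psubset.prems(3)
    and add = psubset.prems(4) and mult = psubset.prems(5)
  show ?case
  proof (cases "\<exists>x\<in>V. \<exists>i. x i \<noteq> 0")
    case False
    have "lam x = 0" if x: "x \<in> V" for x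
    proof -
      have "x = (\<lambda>i. 0 * x i)" using False x by fastforce
      then have "lam x = 0 * lam x" using mult[OF x, of 0] by simp
      then show ?thesis by simp
    qed
    then show ?thesis by (intro exI[of _ "\<lambda>_. 0"]) simp
  next
    case True
    define P where "P = (\<lambda>d. \<exists>x\<in>V. \<exists>i. x i \<noteq> 0 \<and> subdegree (x i) = d)"
    have "\<exists>d. P d" using True unfolding P_def by blast
    then have "P (LEAST d. P d)" by (rule LeastI_ex)
    then obtain x j where x: "x \<in> V" "x j \<noteq> 0" "subdegree (x j) = (LEAST d. P d)"
      unfolding P_def by blast
    have xj0: "x j $ 0 \<noteq> 0"
    proof
      assume "x j $ 0 = 0"
      then have pos: "subdegree (x j) > 0" using x(2) by (metis gr0I nth_subdegree_nonzero)
      have div: "x i = fps_X * fps_shift 1 (x i)" for i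
      proof -
        have "x i $ 0 = 0"
        proof (cases "x i = 0")
          case False
          then have "P (subdegree (x i))" using x(1) unfolding P_def by blast
          then have "subdegree (x j) \<le> subdegree (x i)" unfolding x(3) by (rule Least_le)
          then show ?thesis using pos by (intro nth_less_subdegree_zero) simp
        qed simp
        then show ?thesis by (intro fps_ext) (auto simp: gr0_conv_Suc)
      qed
      have "(\<lambda>i. fps_shift 1 (x i)) \<in> V" 
      proof (rule sat)
        show "(\<lambda>i. fps_X * fps_shift 1 (x i)) \<in> V" using x(1) by (simp only: div[symmetric])
      qed
      moreover have shift: "fps_shift 1 (x j) \<noteq> 0" 
      proof
        assume eq: "fps_shift 1 (x j) = 0"
        have "x j = 0" by (rule trans[OF div[of j]]) (simp only: eq mult_zero_right)
        then show False using x(2) by contradiction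
      qed
      ultimately have "P (subdegree (fps_shift 1 (x j)))"
        unfolding P_def by (intro bexI[of _ "\<lambda>i. fps_shift 1 (x i)"] exI[of _ j] conjI refl)
      then have "subdegree (x j) \<le> subdegree (fps_shift 1 (x j))" unfolding x(3) by (rule Least_le)
      moreover have "subdegree (x j) = subdegree (fps_X * fps_shift 1 (x j))"
        by (rule arg_cong[OF div])
      moreover have "\<dots> = Suc (subdegree (fps_shift 1 (x j)))"
        using subdegree_mult[OF fps_X_neq_zero shift] by simp
      ultimately show False by linarith
    qed
    have "j \<in> S" using supp[OF x(1)] x(2) by blast
    define z where "z = (\<lambda>i. inverse (x j) * x i)"
    have z: "z \<in> V" using sub x(1) unfolding z_def fps_submodule_def by blast
    have zj: "z j = 1" using xj0 by (simp add: z_def inverse_mult_eq_1)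
    let ?V' = "{x \<in> V. x j = 0}"
    have "\<exists>c. \<forall>y\<in>?V'. lam y = (\<Sum>i\<in>S - {j}. c i * y i)"
    proof (rule psubset.IH)
      show "S - {j} \<subset> S" using \<open>j \<in> S\<close> by blast
      show "fps_submodule ?V'" using sub by (rule fps_submodule_zero_coordinate)
      show "y \<in> ?V'" if "(\<lambda>i. fps_X * y i) \<in> ?V'" for y
        using that sat[of y] by auto
    qed (use supp add mult in auto)
    then obtain c where c: "\<And>y. y \<in> ?V' \<Longrightarrow> lam y = (\<Sum>i\<in>S - {j}. c i * y i)" by blast
    define c' where "c' = c(j := lam z - (\<Sum>i\<in>S - {j}. c i * z i))"
    have "lam y = (\<Sum>i\<in>S. c' i * y i)" if y: "y \<in> V" for y
    proof -
      let ?w = "\<lambda>i. y i - y j * z i"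
      have w: "?w \<in> ?V'" using fps_submodule_diff[OF sub y z] zj by simp
      have "lam y = lam (\<lambda>i. ?w i + y j * z i)" by simp
      also have "\<dots> = lam ?w + lam (\<lambda>i. y j * z i)"
        using w z sub unfolding fps_submodule_def by (intro add) auto
      also have "\<dots> = (\<Sum>i\<in>S - {j}. c i * ?w i) + y j * lam z" using c[OF w] mult[OF z] by simp
      also have "\<dots> = (\<Sum>i\<in>S - {j}. c i * y i) + c' j * y j"
        by (simp add: c'_def algebra_simps sum_subtractf sum_distrib_left)
      also have "(\<Sum>i\<in>S - {j}. c i * y i) = (\<Sum>i\<in>S - {j}. c' i * y i)"
        by (intro sum.cong) (auto simp: c'_def)
      also have "\<dots> + c' j * y j = (\<Sum>i\<in>S. c' i * y i)"
        using \<open>j \<in> S\<close> psubset.hyps by (simp add: sum.remove add.commute)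
      finally show ?thesis .
    qed
    then show ?thesis by blast
  qed
qed

lemma mod_homs_iff:
  "f \<in> mod_homs R M N \<longleftrightarrow> f \<in> carrier M \<rightarrow>\<^sub>E carrier N \<and>
     (\<forall>x\<in>carrier M. \<forall>y\<in>carrier M. f (x \<oplus>\<^bsub>M\<^esub> y) = f x \<oplus>\<^bsub>N\<^esub> f y) \<and>
     (\<forall>r\<in>carrier R. \<forall>x\<in>carrier M. f (r \<odot>\<^bsub>M\<^esub> x) = r \<odot>\<^bsub>N\<^esub> f x)"
  by (simp add: mod_homs_def)

context numerical_semigroup
begin

section \<open>Free modules and homomorphisms\<close>

abbreviation Rn :: "nat \<Rightarrow> (nat \<Rightarrow> 'k::field fps) set" where "Rn n \<equiv> carrier (free_mod R n)"

definition vadd :: "nat \<Rightarrow> (nat \<Rightarrow> 'k::field fps) \<Rightarrow> (nat \<Rightarrow> 'k fps) \<Rightarrow> nat \<Rightarrow> 'k fps" where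
  "vadd n x y = (\<lambda>i\<in>{..<n}. x i + y i)"

definition vscale :: "nat \<Rightarrow> 'k::field fps \<Rightarrow> (nat \<Rightarrow> 'k fps) \<Rightarrow> nat \<Rightarrow> 'k fps" where
  "vscale n r x = (\<lambda>i\<in>{..<n}. r * x i)"

definition vzero :: "nat \<Rightarrow> nat \<Rightarrow> 'k::field fps" where
  "vzero n = (\<lambda>i\<in>{..<n}. 0)"

lemma free_mod_simps [simp]:
  "x \<oplus>\<^bsub>free_mod R n\<^esub> y = vadd n x y" "r \<odot>\<^bsub>free_mod R n\<^esub> x = vscale n r x" "\<zero>\<^bsub>free_mod R n\<^esub> = vzero n"
  by (simp_all add: free_mod_def vadd_def vscale_def vzero_def)

lemma carrier_free_mod: "Rn n = {..<n} \<rightarrow>\<^sub>E RH"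
  by (simp add: free_mod_def)

lemma Rn_nth: "x \<in> Rn n \<Longrightarrow> i < n \<Longrightarrow> x i \<in> RH"
  by (auto simp: carrier_free_mod)

lemma Rn_eqI: "x \<in> Rn n \<Longrightarrow> y \<in> Rn n \<Longrightarrow> (\<And>i. i < n \<Longrightarrow> x i = y i) \<Longrightarrow> x = y"
  unfolding carrier_free_mod by (rule PiE_ext) auto

lemma vadd_in: "x \<in> Rn n \<Longrightarrow> y \<in> Rn n \<Longrightarrow> vadd n x y \<in> Rn n"
  by (auto simp: carrier_free_mod vadd_def intro!: supported_add)

lemma vscale_in: "r \<in> RH \<Longrightarrow> x \<in> Rn n \<Longrightarrow> vscale n r x \<in> Rn n"
  by (auto simp: carrier_free_mod vscale_def intro!: RH_mult)

lemma vzero_in: "vzero n \<in> Rn n"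
  by (auto simp: carrier_free_mod vzero_def)

lemma v_nth [simp]:
  "i < n \<Longrightarrow> vadd n x y i = x i + y i" "i < n \<Longrightarrow> vscale n r x i = r * x i" "i < n \<Longrightarrow> vzero n i = 0"
  by (simp_all add: vadd_def vscale_def vzero_def)

lemma vscale_vscale: "vscale n r (vscale n s x) = vscale n (r * s) x"
  by (auto simp: vscale_def mult.assoc)

lemma hom_free_iff:
  "f \<in> mod_homs R (free_mod R n) (free_mod R p) \<longleftrightarrow> f \<in> Rn n \<rightarrow>\<^sub>E Rn p \<and>
     (\<forall>x\<in>Rn n. \<forall>y\<in>Rn n. f (vadd n x y) = vadd p (f x) (f y)) \<and>
     (\<forall>r\<in>RH. \<forall>x\<in>Rn n. f (vscale n r x) = vscale p r (f x))"
  by (simp add: mod_homs_iff)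

lemma hom_ideal_iff:
  "f \<in> mod_homs R (free_mod R n) (ideal_mod R I) \<longleftrightarrow> f \<in> Rn n \<rightarrow>\<^sub>E I \<and>
     (\<forall>x\<in>Rn n. \<forall>y\<in>Rn n. f (vadd n x y) = f x + f y) \<and>
     (\<forall>r\<in>RH. \<forall>x\<in>Rn n. f (vscale n r x) = r * f x)"
  by (simp add: mod_homs_iff)

lemma hom_free_zero: "f \<in> mod_homs R (free_mod R n) (free_mod R p) \<Longrightarrow> f (vzero n) = vzero p"
proof -
  assume f: "f \<in> mod_homs R (free_mod R n) (free_mod R p)"
  have "vzero n = vscale n 0 (vzero n)" by (auto simp: vzero_def vscale_def)
  then have "f (vzero n) = vscale p 0 (f (vzero n))"
    using f vzero_in[of n] unfolding hom_free_iff by (metis supported_zero)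
  then show ?thesis by (auto simp: vzero_def vscale_def)
qed

lemma Hom_mod_simps [simp]:
  "carrier (Hom_mod R M N) = mod_homs R M N"
  "f \<oplus>\<^bsub>Hom_mod R (free_mod R n) (ideal_mod R I)\<^esub> g = (\<lambda>x\<in>Rn n. f x + g x)"
  "r \<odot>\<^bsub>Hom_mod R (free_mod R n) (ideal_mod R I)\<^esub> f = (\<lambda>x\<in>Rn n. r * f x)"
  "\<zero>\<^bsub>Hom_mod R (free_mod R n) (ideal_mod R I)\<^esub> = (\<lambda>x\<in>Rn n. 0)"
  by (simp_all add: Hom_mod_def)

definition Homs :: "nat \<Rightarrow> 'k::field fps set \<Rightarrow> ((nat \<Rightarrow> 'k fps) \<Rightarrow> 'k fps) set" where
  "Homs n I = mod_homs R (free_mod R n) (ideal_mod R I)"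

lemma HomsD:
  assumes "f \<in> Homs n I"
  shows "x \<in> Rn n \<Longrightarrow> f x \<in> I" "x \<in> Rn n \<Longrightarrow> y \<in> Rn n \<Longrightarrow> f (vadd n x y) = f x + f y"
    "r \<in> RH \<Longrightarrow> x \<in> Rn n \<Longrightarrow> f (vscale n r x) = r * f x" "f \<in> extensional (Rn n)"
  using assms unfolding Homs_def hom_ideal_iff by (auto simp: PiE_def)

lemma HomsI:
  assumes "\<And>x. x \<in> Rn n \<Longrightarrow> f x \<in> I" "\<And>x y. x \<in> Rn n \<Longrightarrow> y \<in> Rn n \<Longrightarrow> f (vadd n x y) = f x + f y"
    "\<And>r x. r \<in> RH \<Longrightarrow> x \<in> Rn n \<Longrightarrow> f (vscale n r x) = r * f x"
  shows "restrict f (Rn n) \<in> Homs n I"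
  using assms unfolding Homs_def hom_ideal_iff by (auto simp: vadd_in vscale_in)

lemma Homs_add:
  assumes "Rmod I" "f \<in> Homs n I" "g \<in> Homs n I"
  shows "(\<lambda>x\<in>Rn n. f x + g x) \<in> Homs n I"
  using HomsD[OF assms(2)] HomsD[OF assms(3)]
  by (intro HomsI) (auto intro: Rmod_add[OF assms(1)] simp: algebra_simps)

lemma Homs_scale:
  assumes "Rmod I" "r \<in> RH" "f \<in> Homs n I"
  shows "(\<lambda>x\<in>Rn n. r * f x) \<in> Homs n I"
  using HomsD[OF assms(3)] by (intro HomsI) (auto intro: Rmod_mult[OF assms(1,2)] simp: algebra_simps)

lemma Homs_eq_of_image_eq:
  assumes f: "f \<in> Homs p I" and D: "D \<in> mod_homs R (free_mod R p) (free_mod R n)"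
    and ker: "\<And>x. x \<in> Rn p \<Longrightarrow> D x = vzero n \<Longrightarrow> f x = 0"
    and x: "x \<in> Rn p" and y: "y \<in> Rn p" and eq: "D x = D y"
  shows "f x = f y"
proof -
  have my: "vscale p (- 1) y \<in> Rn p" using RH_uminus[OF RH_one] y by (rule vscale_in)
  have "D (vadd p x (vscale p (- 1) y)) = vadd n (D y) (vscale n (- 1) (D y))"
    using D x y my RH_uminus[OF RH_one] eq unfolding hom_free_iff by metis
  also have "\<dots> = vzero n" by (auto simp: vadd_def vscale_def vzero_def)
  finally have "f (vadd p x (vscale p (- 1) y)) = 0" by (intro ker vadd_in x my)
  then show ?thesis
    using HomsD(2)[OF f x my] HomsD(3)[OF f RH_uminus[OF RH_one] y] by simp
qed

lemma submodule_Hom_iff: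
  fixes I :: "'k::field fps set"
  assumes I: "Rmod I"
  shows "submodule N R (Hom_mod R (free_mod R n) (ideal_mod R I)) \<longleftrightarrow>
    N \<subseteq> Homs n I \<and> (\<lambda>x\<in>Rn n. 0) \<in> N \<and> (\<forall>f\<in>N. \<forall>g\<in>N. (\<lambda>x\<in>Rn n. f x + g x) \<in> N) \<and>
    (\<forall>r\<in>RH. \<forall>f\<in>N. (\<lambda>x\<in>Rn n. r * f x) \<in> N)" (is "submodule N R ?M \<longleftrightarrow> ?rhs")
proof
  assume "submodule N R ?M"
  then interpret submodule N R ?M .
  show ?rhs
    using subset smult_closed m_closed one_closed by (auto simp: Homs_def)
next
  assume N: ?rhs
  have inv: "inv\<^bsub>add_monoid ?M\<^esub> f = (\<lambda>x\<in>Rn n. - 1 * f x)" if f: "f \<in> N" for f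
    unfolding m_inv_def
  proof (rule the_equality)
    have fH: "f \<in> Homs n I" using N f by blast
    have "(\<lambda>x\<in>Rn n. - 1 * f x) \<in> Homs n I"
      using Homs_scale[OF I _ fH, of "- 1"] RH_uminus[OF RH_one] by blast
    then show "(\<lambda>x\<in>Rn n. - 1 * f x) \<in> carrier (add_monoid ?M) \<and>
        f \<otimes>\<^bsub>add_monoid ?M\<^esub> (\<lambda>x\<in>Rn n. - 1 * f x) = \<one>\<^bsub>add_monoid ?M\<^esub> \<and>
        (\<lambda>x\<in>Rn n. - 1 * f x) \<otimes>\<^bsub>add_monoid ?M\<^esub> f = \<one>\<^bsub>add_monoid ?M\<^esub>"
      by (auto simp: Homs_def intro!: restrict_ext)
    fix g assume "g \<in> carrier (add_monoid ?M) \<and> f \<otimes>\<^bsub>add_monoid ?M\<^esub> g = \<one>\<^bsub>add_monoid ?M\<^esub> \<and>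
        g \<otimes>\<^bsub>add_monoid ?M\<^esub> f = \<one>\<^bsub>add_monoid ?M\<^esub>"
    then have g: "g \<in> Homs n I" "(\<lambda>x\<in>Rn n. f x + g x) = (\<lambda>x\<in>Rn n. 0)" by (auto simp: Homs_def)
    have "g x = - 1 * f x" if "x \<in> Rn n" for x
      using fun_cong[OF g(2), of x] that by (simp add: add_eq_0_iff)
    then show "g = (\<lambda>x\<in>Rn n. - 1 * f x)"
      using HomsD(4)[OF g(1)] by (intro extensionalityI) auto
  qed
  have inv_in: "inv\<^bsub>add_monoid ?M\<^esub> f \<in> N" if "f \<in> N" for f
  proof -
    have "(\<lambda>x\<in>Rn n. - 1 * f x) \<in> N" using N that RH_uminus[OF RH_one] by blast
    then show ?thesis unfolding inv[OF that] .
  qed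
  show "submodule N R ?M"
  proof (intro submodule.intro subgroup.intro submodule_axioms.intro)
    show "N \<subseteq> carrier (add_monoid ?M)" using N by (simp add: Homs_def)
    show "f \<otimes>\<^bsub>add_monoid ?M\<^esub> g \<in> N" if "f \<in> N" "g \<in> N" for f g using N that by simp
    show "\<one>\<^bsub>add_monoid ?M\<^esub> \<in> N" using N by simp
    show "inv\<^bsub>add_monoid ?M\<^esub> f \<in> N" if "f \<in> N" for f using that by (rule inv_in)
    show "r \<odot>\<^bsub>?M\<^esub> f \<in> N" if "r \<in> carrier R" "f \<in> N" for r f using N that by simp
  qed
qed

lemma hom_freeD:
  assumes "f \<in> mod_homs R (free_mod R n) (free_mod R p)"
  shows "x \<in> Rn n \<Longrightarrow> f x \<in> Rn p"
    "x \<in> Rn n \<Longrightarrow> y \<in> Rn n \<Longrightarrow> f (vadd n x y) = vadd p (f x) (f y)"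
    "r \<in> RH \<Longrightarrow> x \<in> Rn n \<Longrightarrow> f (vscale n r x) = vscale p r (f x)"
  using assms unfolding hom_free_iff by blast+

lemma Ext_cocycles_iff:
  "f \<in> Ext_cocycles R b d (ideal_mod R I) i \<longleftrightarrow>
    f \<in> Homs (b i) I \<and> (\<forall>x\<in>Rn (b (Suc i)). f (d i x) = 0)"
  by (simp add: Ext_cocycles_def Homs_def)

lemma Ext_coboundaries_eq:
  "Ext_coboundaries R b d (ideal_mod R I) (Suc j) =
    (\<lambda>g. \<lambda>x\<in>Rn (b (Suc j)). g (d j x)) ` Homs (b j) I"
  by (simp add: Ext_coboundaries_def Homs_def)

lemma free_resolutionD:
  fixes d :: "nat \<Rightarrow> (nat \<Rightarrow> 'k::field fps) \<Rightarrow> nat \<Rightarrow> 'k fps"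
  assumes "free_resolution R b d"
  shows "d i \<in> mod_homs R (free_mod R (b (Suc i))) (free_mod R (b i))"
    "{x \<in> Rn (b (Suc i)). d i x = vzero (b i)} = d (Suc i) ` Rn (b (Suc (Suc i)))"
  using assms unfolding free_resolution_def by simp_all

lemma coboundaries_subset_cocycles:
  fixes d :: "nat \<Rightarrow> (nat \<Rightarrow> 'k::field fps) \<Rightarrow> nat \<Rightarrow> 'k fps"
  assumes res: "free_resolution R b d"
  shows "Ext_coboundaries R b d (ideal_mod R I) (Suc j) \<subseteq> Ext_cocycles R b d (ideal_mod R I) (Suc j)"
proof
  note D = hom_freeD[OF free_resolutionD(1)[OF res, of j]]
  fix f assume "f \<in> Ext_coboundaries R b d (ideal_mod R I) (Suc j)"
  then obtain g where g: "g \<in> Homs (b j) I" "f = (\<lambda>x\<in>Rn (b (Suc j)). g (d j x))"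
    unfolding Ext_coboundaries_eq by blast
  note gD = HomsD[OF g(1)]
  have "f \<in> Homs (b (Suc j)) I"
    unfolding g(2) using gD D by (intro HomsI) simp_all
  moreover have "f (d (Suc j) x) = 0" if "x \<in> Rn (b (Suc (Suc j)))" for x
  proof -
    have dx: "d (Suc j) x \<in> {x \<in> Rn (b (Suc j)). d j x = vzero (b j)}"
      unfolding free_resolutionD(2)[OF res] using that by blast
    have "g (vzero (b j)) = g (vscale (b j) 0 (vzero (b j)))"
      by (rule arg_cong[of _ _ g]) (auto simp: vzero_def vscale_def)
    also have "\<dots> = 0" using gD(3)[OF supported_zero vzero_in] by simp
    finally show ?thesis using dx by (simp add: g(2))
  qed
  ultimately show "f \<in> Ext_cocycles R b d (ideal_mod R I) (Suc j)" unfolding Ext_cocycles_iff by blast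
qed

section \<open>The residue field\<close>

definition mH :: "'k::field fps set" where "mH = {f \<in> RH. f $ 0 = 0}"

lemma nonunits_R: "carrier R - Units R = mH"
  by (auto simp: Units_R mH_def)

lemma residue_field_mod_R: "residue_field_mod R = quot_mod R mH"
  by (simp only: residue_field_mod_def nonunits_R)

lemma Rmod_mH: "Rmod mH"
  by (auto simp: Rmod_def mH_def intro: supported_add RH_mult)

lemma ideal_mH: "ideal mH R"
  using Rmod_mH by (auto simp: ideal_R_iff mH_def)

lemma coset_eq_iff:
  assumes "r \<in> RH" "s \<in> RH"
  shows "mH +>\<^bsub>R\<^esub> r = mH +>\<^bsub>R\<^esub> s \<longleftrightarrow> r - s \<in> (mH :: 'k::field fps set)"
proof
  have coset: "mH +>\<^bsub>R\<^esub> t = {h + t | h. h \<in> mH}" for t :: "'k fps"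
    by (auto simp: a_r_coset_def')
  show "r - s \<in> mH" if eq: "mH +>\<^bsub>R\<^esub> r = mH +>\<^bsub>R\<^esub> s"
  proof -
    have "0 + r \<in> mH +>\<^bsub>R\<^esub> r" unfolding coset using Rmod_zero[OF Rmod_mH] by blast
    then have "0 + r \<in> mH +>\<^bsub>R\<^esub> s" unfolding eq .
    then obtain h where "h \<in> mH" "r = h + s" unfolding coset by auto
    then show ?thesis by simp
  qed
  show "mH +>\<^bsub>R\<^esub> r = mH +>\<^bsub>R\<^esub> s" if d: "r - s \<in> mH"
  proof -
    have "\<exists>h'\<in>mH. h + r = h' + s" if "h \<in> mH" for h
      using Rmod_add[OF Rmod_mH that d] by (intro bexI[of _ "h + (r - s)"]) auto
    moreover have "\<exists>h'\<in>mH. h + s = h' + r" if "h \<in> mH" for h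
      using Rmod_diff[OF Rmod_mH that d] by (intro bexI[of _ "h - (r - s)"]) auto
    ultimately show ?thesis unfolding coset by blast
  qed
qed

lemma residue_field_carrier: "carrier (residue_field_mod R) = {mH +>\<^bsub>R\<^esub> r | r. r \<in> RH}"
  by (auto simp: residue_field_mod_R quot_mod_def FactRing_def A_RCOSETS_def')

lemma residue_field_zero: "\<zero>\<^bsub>residue_field_mod R\<^esub> = mH"
  by (simp add: residue_field_mod_R quot_mod_def FactRing_def)

lemma residue_field_add:
  fixes r s :: "'k::field fps"
  assumes "r \<in> RH" "s \<in> RH"
  shows "(mH +>\<^bsub>R\<^esub> r) \<oplus>\<^bsub>residue_field_mod R\<^esub> (mH +>\<^bsub>R\<^esub> s) = mH +>\<^bsub>R\<^esub> (r + s)"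
proof -
  interpret ideal mH "R :: 'k fps ring" by (rule ideal_mH)
  show ?thesis
    using a_rcos_sum[of r s] assms by (simp add: residue_field_mod_R quot_mod_def FactRing_def)
qed

lemma residue_field_smult:
  assumes "r \<in> RH" "s \<in> RH"
  shows "r \<odot>\<^bsub>residue_field_mod R\<^esub> (mH +>\<^bsub>R\<^esub> s) = mH +>\<^bsub>R\<^esub> (r * s)"
  using ideal.rcoset_mult_add[OF ideal_mH, of r s] assms
  by (simp add: residue_field_mod_R quot_mod_def FactRing_def)

lemma coset_zero: "r \<in> RH \<Longrightarrow> mH +>\<^bsub>R\<^esub> r = mH \<longleftrightarrow> r \<in> (mH :: 'k::field fps set)"
proof -
  assume r: "r \<in> RH"
  have "mH +>\<^bsub>R\<^esub> 0 = (mH :: 'k fps set)"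
    by (auto simp: a_r_coset_def')
  then show ?thesis using coset_eq_iff[OF r, of 0] by simp
qed

text \<open>What is used of an augmentation \<open>R\<^bsup>b 0\<^esup> \<rightarrow> k\<close> with kernel \<open>U\<close>, the image of \<open>d 0\<close>, is a preimage \<open>u\<close> of
  \<open>1\<close>: the free module is \<open>R u + U\<close>, and \<open>r u \<in> U\<close> iff \<open>r\<close> lies in the maximal ideal.\<close>

lemma residue_augmentation:
  fixes d :: "nat \<Rightarrow> (nat \<Rightarrow> 'k::field fps) \<Rightarrow> nat \<Rightarrow> 'k fps"
  assumes "free_resolution_of R (residue_field_mod R) b d"
  obtains u where "u \<in> Rn (b 0)"
    "\<And>r. r \<in> RH \<Longrightarrow> vscale (b 0) r u \<in> d 0 ` Rn (b 1) \<longleftrightarrow> r \<in> mH"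
    "\<And>x. x \<in> Rn (b 0) \<Longrightarrow> \<exists>r\<in>RH. vadd (b 0) x (vscale (b 0) (- r) u) \<in> d 0 ` Rn (b 1)"
proof -
  let ?k = "residue_field_mod (R :: 'k fps ring)"
  note k_carrier = residue_field_carrier and k_zero = residue_field_zero
    and k_add = residue_field_add and k_smult = residue_field_smult
  have coset0: "mH +>\<^bsub>R\<^esub> 0 = (mH :: 'k fps set)"
    using coset_zero[OF supported_zero] Rmod_zero[OF Rmod_mH] by blast
  obtain e where e: "e \<in> mod_homs R (free_mod R (b 0)) ?k" "e ` Rn (b 0) = carrier ?k"
    and ker: "{x \<in> Rn (b 0). e x = \<zero>\<^bsub>?k\<^esub>} = d 0 ` Rn (b 1)"
    using assms unfolding free_resolution_of_def by blast
  have e_add: "e (vadd (b 0) x y) = e x \<oplus>\<^bsub>?k\<^esub> e y" if "x \<in> Rn (b 0)" "y \<in> Rn (b 0)" for x y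
    using e(1) that by (simp add: mod_homs_iff)
  have e_smult: "e (vscale (b 0) r x) = r \<odot>\<^bsub>?k\<^esub> e x" if "r \<in> RH" "x \<in> Rn (b 0)" for r x
    using e(1) that by (simp add: mod_homs_iff)
  have "mH +>\<^bsub>R\<^esub> 1 \<in> e ` Rn (b 0)" unfolding e(2) k_carrier using RH_one by blast
  then obtain u where u: "u \<in> Rn (b 0)" "e u = mH +>\<^bsub>R\<^esub> 1" by auto
  have eru: "e (vscale (b 0) r u) = mH +>\<^bsub>R\<^esub> r" if "r \<in> RH" for r
    using e_smult[OF that u(1)] k_smult[OF that RH_one] u(2) by simp
  show thesis
  proof (rule that[OF u(1)])
    show "vscale (b 0) r u \<in> d 0 ` Rn (b 1) \<longleftrightarrow> r \<in> mH" if "r \<in> RH" for r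
      unfolding ker[symmetric] using that u(1) by (simp add: eru k_zero coset_zero vscale_in)
    fix x :: "nat \<Rightarrow> 'k fps" assume x: "x \<in> Rn (b 0)"
    then have "e x \<in> carrier ?k" using e(2) by blast
    then obtain r where r: "r \<in> RH" "e x = mH +>\<^bsub>R\<^esub> r" unfolding k_carrier by blast
    have mr: "- r \<in> RH" using r(1) by (rule RH_uminus)
    have "e (vadd (b 0) x (vscale (b 0) (- r) u)) = mH +>\<^bsub>R\<^esub> (r + - r)"
      using e_add[OF x vscale_in[OF mr u(1)]] eru[OF mr] r(2) k_add[OF r(1) mr] by simp
    then have "vadd (b 0) x (vscale (b 0) (- r) u) \<in> d 0 ` Rn (b 1)"
      unfolding ker[symmetric] using x mr u(1) coset0 by (simp add: k_zero vadd_in vscale_in)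
    then show "\<exists>r\<in>RH. vadd (b 0) x (vscale (b 0) (- r) u) \<in> d 0 ` Rn (b 1)" using r(1) by blast
  qed
qed

end

context numerical_semigroup
begin

section \<open>\<open>Ext\<^sup>1\<close> of the residue field\<close>

text \<open>The multiplicity of \<open>R\<close>.\<close>

definition e :: nat where "e = (LEAST h. h \<in> H \<and> 0 < h)"

lemma e_in: "e \<in> H" and e_pos: "0 < e"
proof -
  obtain c where "\<And>n. n \<ge> c \<Longrightarrow> n \<in> H" using cofinite by blast
  then have "Suc c \<in> H \<and> 0 < Suc c" by simp
  then have "e \<in> H \<and> 0 < e" unfolding e_def by (rule LeastI)
  then show "e \<in> H" "0 < e" by auto
qed

lemma e_le: "h \<in> H \<Longrightarrow> 0 < h \<Longrightarrow> e \<le> h"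
  unfolding e_def by (rule Least_le) simp

lemma X_power_e: "fps_X ^ e \<in> mH"
  using RH_X_power[OF e_in] e_pos by (simp add: mH_def)

lemma mH_nth: "f \<in> mH \<Longrightarrow> n < e \<Longrightarrow> f $ n = 0"
  using e_le[of n] by (cases "n = 0") (auto simp: mH_def supported_def)

lemma mH_divide: "f \<in> mH \<Longrightarrow> fps_X ^ e * fps_shift e f = f"
  using mH_nth[of f] by (intro fps_ext) (auto simp: fps_X_power_mult_nth)

lemma X_e_cancel: "fps_X ^ e * x = fps_X ^ e * (y :: 'k::field fps) \<Longrightarrow> x = y"
  by (simp add: mult_left_cancel)

text \<open>The ideal quotient \<open>I : m\<close> by the maximal ideal, formed in \<open>k[[t]]\<close>. For an ideal \<open>I\<close> contained in
  \<open>m\<close> it is the quotient in the fraction field, because \<open>I : m \<subseteq> m : m \<subseteq> k[[t]]\<close>.\<close>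

definition colon :: "'k::field fps set \<Rightarrow> 'k fps set" where
  "colon I = {p. \<forall>x\<in>mH. x * p \<in> I}"

text \<open>A cocycle \<open>f\<close> is a homomorphism to \<open>I\<close> from \<open>U\<close>, the image of \<open>d 0\<close>. As \<open>t\<^sup>e R\<^bsup>b 0\<^esup> \<subseteq> U\<close>, it extends
  uniquely to \<open>R\<^bsup>b 0\<^esup>\<close> if denominators \<open>t\<^sup>e\<close> are admitted, and \<open>\<Phi> f\<close> is the value of this extension at the
  preimage \<open>u\<close> of \<open>1 \<in> k\<close>. The values lie in \<open>I : m\<close>, and \<open>f\<close> is a coboundary iff the extension maps to
  \<open>I\<close>, that is, iff \<open>\<Phi> f \<in> I\<close>. So \<open>\<Phi>\<close> induces an isomorphism of \<open>Ext\<^sup>1(k, I)\<close> with \<open>(I : m)/I\<close>.\<close>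

lemma type_transfer:
  fixes d :: "nat \<Rightarrow> (nat \<Rightarrow> 'k::field fps) \<Rightarrow> nat \<Rightarrow> 'k fps" and I :: "'k fps set"
  assumes res: "free_resolution_of R (residue_field_mod R) b d"
    and I: "Rmod I" "I \<subseteq> mH"
    and Z: "Z = Ext_cocycles R b d (ideal_mod R I) 1"
    and B: "B = Ext_coboundaries R b d (ideal_mod R I) 1"
  obtains \<Phi> where
    "submodule Z R (Hom_mod R (free_mod R (b 1)) (ideal_mod R I))" "B \<subseteq> Z"
    "\<And>f g. f \<in> Z \<Longrightarrow> g \<in> Z \<Longrightarrow> \<Phi> (\<lambda>x\<in>Rn (b 1). f x + g x) = \<Phi> f + \<Phi> g"
    "\<And>r f. r \<in> RH \<Longrightarrow> f \<in> Z \<Longrightarrow> \<Phi> (\<lambda>x\<in>Rn (b 1). r * f x) = r * \<Phi> f"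
    "\<And>f. f \<in> Z \<Longrightarrow> \<Phi> f \<in> colon I"
    "\<And>f. f \<in> Z \<Longrightarrow> f \<in> B \<longleftrightarrow> \<Phi> f \<in> I"
    "\<And>q. q \<in> colon I \<Longrightarrow> \<exists>f\<in>Z. \<Phi> f - q \<in> I"
proof -
  let ?X = "fps_X ^ e :: 'k fps"
  have X: "?X \<in> RH" using X_power_e by (auto simp: mH_def)
  have res': "free_resolution R b d" using res unfolding free_resolution_of_def by blast
  note d_hom = free_resolutionD(1)[OF res']
  note d_in = hom_freeD(1)[OF d_hom] and d_add = hom_freeD(2)[OF d_hom]
    and d_scale = hom_freeD(3)[OF d_hom]
  have exact: "{x \<in> Rn (b 1). d 0 x = vzero (b 0)} = d 1 ` Rn (b 2)"
    using free_resolutionD(2)[OF res', of 0] by (simp add: numeral_2_eq_2)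
  have Z_iff: "f \<in> Z \<longleftrightarrow> f \<in> Homs (b 1) I \<and> (\<forall>x\<in>Rn (b 2). f (d 1 x) = 0)" for f
    unfolding Z Ext_cocycles_iff by (simp add: numeral_2_eq_2)
  have B_eq: "B = (\<lambda>g. \<lambda>x\<in>Rn (b 1). g (d 0 x)) ` Homs (b 0) I"
    unfolding B by (simp add: Ext_coboundaries_eq)
  let ?U = "d 0 ` Rn (b 1)"
  have U_add: "vadd (b 0) x y \<in> ?U" if xy: "x \<in> ?U" "y \<in> ?U" for x y
  proof -
    obtain x' y' where *: "x' \<in> Rn (b 1)" "y' \<in> Rn (b 1)" "x = d 0 x'" "y = d 0 y'" using xy by blast
    then have "vadd (b 0) x y = d 0 (vadd (b 1) x' y')" using d_add[of x' 0 y'] by simp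
    then show ?thesis using vadd_in[OF *(1,2)] by blast
  qed
  have U_scale: "vscale (b 0) r x \<in> ?U" if r: "r \<in> RH" and x: "x \<in> ?U" for r x
  proof -
    obtain x' where *: "x' \<in> Rn (b 1)" "x = d 0 x'" using x by blast
    then have "vscale (b 0) r x = d 0 (vscale (b 1) r x')" using d_scale[of r x' 0] r by simp
    then show ?thesis using vscale_in[OF r *(1)] by blast
  qed
  have neg1: "- 1 \<in> (RH :: 'k fps set)" using RH_uminus[OF RH_one] .
  have ker: "f x = f y" if f: "f \<in> Z" and x: "x \<in> Rn (b 1)" and y: "y \<in> Rn (b 1)"
    and eq: "d 0 x = d 0 y" for f x y
  proof (rule Homs_eq_of_image_eq[OF _ _ _ x y eq])
    show "f \<in> Homs (b 1) I" using f Z_iff by blast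
    show "d 0 \<in> mod_homs R (free_mod R (b 1)) (free_mod R (b 0))" using d_hom[of 0] by simp
    show "f x = 0" if "x \<in> Rn (b 1)" "d 0 x = vzero (b 0)" for x
    proof -
      have "x \<in> d 1 ` Rn (b 2)" using that unfolding exact[symmetric] by simp
      then show ?thesis using f unfolding Z_iff by auto
    qed
  qed
  obtain u where u: "u \<in> Rn (b 0)"
    and u_mem: "\<And>r. r \<in> RH \<Longrightarrow> vscale (b 0) r u \<in> ?U \<longleftrightarrow> r \<in> mH"
    and u_gen: "\<And>x. x \<in> Rn (b 0) \<Longrightarrow> \<exists>r\<in>RH. vadd (b 0) x (vscale (b 0) (- r) u) \<in> ?U"
    using residue_augmentation[OF res] by blast
  \<comment> \<open>As \<open>t\<^sup>e u \<in> U\<close>, the extension of \<open>f\<close> has the value \<open>f c / t\<^sup>e\<close> at \<open>u\<close>.\<close>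
  obtain c where c: "c \<in> Rn (b 1)" "d 0 c = vscale (b 0) ?X u"
    using u_mem[OF X] X_power_e by (metis (no_types, lifting) imageE)
  define \<Phi> where "\<Phi> = (\<lambda>f :: (nat \<Rightarrow> 'k fps) \<Rightarrow> 'k fps. fps_shift e (f c))"
  have Phi: "?X * \<Phi> f = f c" if "f \<in> Z" for f
    unfolding \<Phi>_def using that c I(2) HomsD(1)[of f "b 1" I c] by (intro mH_divide) (auto simp: Z_iff)
  have Phi_eqI: "\<Phi> f = y" if "f c = ?X * y" for f y
    unfolding \<Phi>_def that by (intro fps_ext) (simp add: fps_X_power_mult_nth)
  show thesis
  proof (rule that)
    show "submodule Z R (Hom_mod R (free_mod R (b 1)) (ideal_mod R I))"
      unfolding submodule_Hom_iff[OF I(1)]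
    proof (intro conjI ballI)
      show "Z \<subseteq> Homs (b 1) I" using Z_iff by blast
      have d1: "d 1 x \<in> Rn (b 1)" if "x \<in> Rn (b 2)" for x
        using d_in[of x 1] that by (simp add: numeral_2_eq_2)
      have "(\<lambda>x\<in>Rn (b 1). 0) \<in> Homs (b 1) I"
        using Rmod_zero[OF I(1)] by (intro HomsI) auto
      then show "(\<lambda>x\<in>Rn (b 1). 0) \<in> Z" using d1 by (simp add: Z_iff)
      show "(\<lambda>x\<in>Rn (b 1). f x + g x) \<in> Z" if "f \<in> Z" "g \<in> Z" for f g
        using that d1 Homs_add[OF I(1), of f "b 1" g] by (simp add: Z_iff)
      show "(\<lambda>x\<in>Rn (b 1). r * f x) \<in> Z" if "r \<in> RH" "f \<in> Z" for r f
        using that d1 Homs_scale[OF I(1), of r f "b 1"] by (simp add: Z_iff)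
    qed
    show "B \<subseteq> Z"
      unfolding B Z using coboundaries_subset_cocycles[OF res', of I 0] by simp
    show "\<Phi> (\<lambda>x\<in>Rn (b 1). f x + g x) = \<Phi> f + \<Phi> g" if "f \<in> Z" "g \<in> Z" for f g
      using Phi[OF that(1)] Phi[OF that(2)] c(1) by (intro Phi_eqI) (simp add: distrib_left)
    show "\<Phi> (\<lambda>x\<in>Rn (b 1). r * f x) = r * \<Phi> f" if "r \<in> RH" "f \<in> Z" for r f
      using Phi[OF that(2)] c(1) by (intro Phi_eqI) (simp add: mult.left_commute)
    show "\<Phi> f \<in> colon I" if f: "f \<in> Z" for f
      unfolding colon_def
    proof (intro CollectI ballI)
      fix x assume x: "x \<in> (mH :: 'k fps set)"
      then have xR: "x \<in> RH" by (simp add: mH_def)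
      obtain c' where c': "c' \<in> Rn (b 1)" "d 0 c' = vscale (b 0) x u"
        using u_mem[OF xR] x by (metis (no_types, lifting) imageE)
      have fH: "f \<in> Homs (b 1) I" using f Z_iff by blast
      have "d 0 (vscale (b 1) ?X c') = d 0 (vscale (b 1) x c)"
        using d_scale[of ?X c' 0] d_scale[of x c 0] X xR c c' by (simp add: vscale_vscale mult.commute)
      then have "f (vscale (b 1) ?X c') = f (vscale (b 1) x c)"
        using ker[OF f] vscale_in X xR c(1) c'(1) by blast
      then have "?X * f c' = ?X * (x * \<Phi> f)"
        using HomsD(3)[OF fH] X xR c(1) c'(1) Phi[OF f] by (simp add: mult.left_commute)
      then have "f c' = x * \<Phi> f" by (rule X_e_cancel)
      then show "x * \<Phi> f \<in> I" using HomsD(1)[OF fH c'(1)] by simp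
    qed
    show "f \<in> B \<longleftrightarrow> \<Phi> f \<in> I" if f: "f \<in> Z" for f
    proof
      assume "f \<in> B"
      then obtain g where g: "g \<in> Homs (b 0) I" "f = (\<lambda>x\<in>Rn (b 1). g (d 0 x))"
        unfolding B_eq by blast
      have "f c = ?X * g u" using g c HomsD(3)[OF g(1) X u] by simp
      then have "\<Phi> f = g u" by (rule Phi_eqI)
      then show "\<Phi> f \<in> I" using HomsD(1)[OF g(1) u] by simp
    next
      assume Phi_I: "\<Phi> f \<in> I"
      have fH: "f \<in> Homs (b 1) I" using f Z_iff by blast
      \<comment> \<open>The extension \<open>G\<close> of \<open>f\<close> takes the value \<open>f c1 + r \<Phi> f\<close> at \<open>x = r u + d 0 c1\<close>.\<close>
      have "\<exists>y. y \<in> I \<and> (\<exists>c'\<in>Rn (b 1). d 0 c' = vscale (b 0) ?X x \<and> f c' = ?X * y)"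
        if x: "x \<in> Rn (b 0)" for x
      proof -
        obtain r c1 where r: "r \<in> RH" and c1: "c1 \<in> Rn (b 1)" "vadd (b 0) x (vscale (b 0) (- r) u) = d 0 c1"
          using u_gen[OF x] by (metis (no_types, lifting) imageE)
        let ?c = "vadd (b 1) (vscale (b 1) ?X c1) (vscale (b 1) r c)"
        have in1: "vscale (b 1) ?X c1 \<in> Rn (b 1)" "vscale (b 1) r c \<in> Rn (b 1)"
          using X r c c1 by (auto intro: vscale_in)
        have "d 0 ?c = vadd (b 0) (vscale (b 0) ?X (d 0 c1)) (vscale (b 0) r (d 0 c))"
          using d_add[of "vscale (b 1) ?X c1" 0] in1 d_scale[of _ _ 0] X r c(1) c1(1) by simp
        also have "\<dots> = vscale (b 0) ?X x"
          unfolding c1(2)[symmetric] c(2)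
          by (rule ext) (simp add: vadd_def vscale_def algebra_simps)
        finally have "d 0 ?c = vscale (b 0) ?X x" .
        moreover have "f ?c = ?X * (f c1 + r * \<Phi> f)"
          using HomsD(2)[OF fH in1] HomsD(3)[OF fH X c1(1)] HomsD(3)[OF fH r c(1)] Phi[OF f]
          by (simp add: algebra_simps)
        moreover have "f c1 + r * \<Phi> f \<in> I"
          using HomsD(1)[OF fH c1(1)] Phi_I r I(1) by (intro Rmod_add Rmod_mult)
        ultimately show ?thesis using vadd_in[OF in1] by blast
      qed
      then have "\<forall>x\<in>Rn (b 0). \<exists>y. y \<in> I \<and> (\<exists>c'\<in>Rn (b 1). d 0 c' = vscale (b 0) ?X x \<and> f c' = ?X * y)"
        by blast
      from bchoice[OF this] obtain G where G: "\<And>x. x \<in> Rn (b 0) \<Longrightarrow> G x \<in> I"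
        and G': "\<And>x. x \<in> Rn (b 0) \<Longrightarrow> \<exists>c'\<in>Rn (b 1). d 0 c' = vscale (b 0) ?X x \<and> f c' = ?X * G x"
        by blast
      have G_eqI: "G x = y" if x: "x \<in> Rn (b 0)" and c': "c' \<in> Rn (b 1)" "d 0 c' = vscale (b 0) ?X x"
        and fc': "f c' = ?X * y" for x y c'
      proof -
        obtain c'' where c'': "c'' \<in> Rn (b 1)" "d 0 c'' = vscale (b 0) ?X x" "f c'' = ?X * G x"
          using G'[OF x] by blast
        have "f c'' = f c'" using ker[OF f c''(1) c'(1)] c''(2) c'(2) by simp
        then show ?thesis using c''(3) fc' X_e_cancel by metis
      qed
      have "restrict G (Rn (b 0)) \<in> Homs (b 0) I"
      proof (rule HomsI)
        fix x y :: "nat \<Rightarrow> 'k fps" assume x: "x \<in> Rn (b 0)" and y: "y \<in> Rn (b 0)"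
        obtain cx where cx: "cx \<in> Rn (b 1)" "d 0 cx = vscale (b 0) ?X x" "f cx = ?X * G x"
          using G'[OF x] by blast
        obtain cy where cy: "cy \<in> Rn (b 1)" "d 0 cy = vscale (b 0) ?X y" "f cy = ?X * G y"
          using G'[OF y] by blast
        show "G (vadd (b 0) x y) = G x + G y"
        proof (rule G_eqI)
          show "vadd (b 0) x y \<in> Rn (b 0)" using x y by (rule vadd_in)
          show "vadd (b 1) cx cy \<in> Rn (b 1)" using cx(1) cy(1) by (rule vadd_in)
          show "d 0 (vadd (b 1) cx cy) = vscale (b 0) ?X (vadd (b 0) x y)"
            using d_add[of cx 0 cy] cx cy by (auto simp: vadd_def vscale_def algebra_simps)
          show "f (vadd (b 1) cx cy) = ?X * (G x + G y)"
            using HomsD(2)[OF fH cx(1) cy(1)] cx cy by (simp add: distrib_left)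
        qed
      next
        fix r :: "'k fps" and x :: "nat \<Rightarrow> 'k fps" assume r: "r \<in> RH" and x: "x \<in> Rn (b 0)"
        obtain cx where cx: "cx \<in> Rn (b 1)" "d 0 cx = vscale (b 0) ?X x" "f cx = ?X * G x"
          using G'[OF x] by blast
        show "G (vscale (b 0) r x) = r * G x"
        proof (rule G_eqI)
          show "vscale (b 0) r x \<in> Rn (b 0)" using r x by (rule vscale_in)
          show "vscale (b 1) r cx \<in> Rn (b 1)" using r cx(1) by (rule vscale_in)
          show "d 0 (vscale (b 1) r cx) = vscale (b 0) ?X (vscale (b 0) r x)"
            using d_scale[of r cx 0] r cx by (simp add: vscale_vscale mult.commute)
          show "f (vscale (b 1) r cx) = ?X * (r * G x)"
            using HomsD(3)[OF fH r cx(1)] cx by (simp add: mult.left_commute)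
        qed
      qed (rule G)
      moreover have "f = (\<lambda>x\<in>Rn (b 1). restrict G (Rn (b 0)) (d 0 x))"
      proof (rule extensionalityI)
        show "f \<in> extensional (Rn (b 1))" using HomsD(4)[OF fH] .
        fix x :: "nat \<Rightarrow> 'k fps" assume x: "x \<in> Rn (b 1)"
        have dx: "d 0 x \<in> Rn (b 0)" using d_in[of x 0] x by simp
        have "G (d 0 x) = f x"
        proof (rule G_eqI[OF dx])
          show "vscale (b 1) ?X x \<in> Rn (b 1)" using X x by (rule vscale_in)
          show "d 0 (vscale (b 1) ?X x) = vscale (b 0) ?X (d 0 x)" using d_scale[of ?X x 0] X x by simp
          show "f (vscale (b 1) ?X x) = ?X * f x" using HomsD(3)[OF fH X x] .
        qed
        then show "f x = (\<lambda>x\<in>Rn (b 1). restrict G (Rn (b 0)) (d 0 x)) x" using x dx by simp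
      qed simp
      ultimately show "f \<in> B" unfolding B_eq by blast
    qed
    show "\<exists>f\<in>Z. \<Phi> f - q \<in> I" if q: "q \<in> colon I" for q
    proof -
      \<comment> \<open>With \<open>r i\<close> chosen for the unit vectors \<open>\<epsilon> i\<close>, the linear form \<open>s\<close> satisfies \<open>x - s x u \<in> U\<close>, and
        \<open>x \<mapsto> s x q\<close> is the extension of the required cocycle.\<close>
      define \<epsilon> where "\<epsilon> = (\<lambda>i. \<lambda>j\<in>{..<b 0}. if j = i then 1 else (0 :: 'k fps))"
      have eps: "\<epsilon> i \<in> Rn (b 0)" for i
        by (auto simp: \<epsilon>_def carrier_free_mod RH_one)
      have "\<exists>r. \<forall>i. r i \<in> RH \<and> vadd (b 0) (\<epsilon> i) (vscale (b 0) (- r i) u) \<in> ?U"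
        using u_gen[OF eps] by (intro choice) blast
      then obtain r where r: "\<And>i. r i \<in> RH" and rU: "\<And>i. vadd (b 0) (\<epsilon> i) (vscale (b 0) (- r i) u) \<in> ?U"
        by blast
      define s where "s = (\<lambda>x :: nat \<Rightarrow> 'k fps. \<Sum>i<b 0. x i * r i)"
      have s_in: "s x \<in> RH" if "x \<in> Rn (b 0)" for x
        unfolding s_def using that r by (intro Rmod_sum[OF Rmod_RH] RH_mult) (auto intro: Rn_nth)
      have s_add: "s (vadd (b 0) x y) = s x + s y" for x y
        by (simp add: s_def sum.distrib distrib_right)
      have s_scale: "s (vscale (b 0) t x) = t * s x" for t x
        by (simp add: s_def sum_distrib_left mult.assoc)
      have sU: "vadd (b 0) x (vscale (b 0) (- s x) u) \<in> ?U" if x: "x \<in> Rn (b 0)" for x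
      proof -
        have "(\<lambda>j\<in>{..<b 0}. \<Sum>i<n. x i * (\<epsilon> i j - r i * u j)) \<in> ?U" if "n \<le> b 0" for n
          using that
        proof (induction n)
          case 0
          have "vscale (b 0) 0 (d 0 c) \<in> ?U" using c(1) by (intro U_scale) auto
          moreover have "vscale (b 0) 0 (d 0 c) = (\<lambda>j\<in>{..<b 0}. \<Sum>i<0. x i * (\<epsilon> i j - r i * u j))"
            by (auto simp: vscale_def)
          ultimately show ?case by (simp only:)
        next
          case (Suc n)
          have "vscale (b 0) (x n) (vadd (b 0) (\<epsilon> n) (vscale (b 0) (- r n) u)) \<in> ?U"
            using rU x Suc.prems by (intro U_scale) (auto intro: Rn_nth)
          moreover have "(\<lambda>j\<in>{..<b 0}. \<Sum>i<n. x i * (\<epsilon> i j - r i * u j)) \<in> ?U"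
            using Suc.prems by (intro Suc.IH) simp
          ultimately have "vadd (b 0) (\<lambda>j\<in>{..<b 0}. \<Sum>i<n. x i * (\<epsilon> i j - r i * u j))
              (vscale (b 0) (x n) (vadd (b 0) (\<epsilon> n) (vscale (b 0) (- r n) u))) \<in> ?U"
            by (intro U_add)
          also have "vadd (b 0) (\<lambda>j\<in>{..<b 0}. \<Sum>i<n. x i * (\<epsilon> i j - r i * u j))
              (vscale (b 0) (x n) (vadd (b 0) (\<epsilon> n) (vscale (b 0) (- r n) u))) =
              (\<lambda>j\<in>{..<b 0}. \<Sum>i<Suc n. x i * (\<epsilon> i j - r i * u j))"
            by (auto simp: vadd_def vscale_def)
          finally show ?case .
        qed
        from this[of "b 0"] have "(\<lambda>j\<in>{..<b 0}. \<Sum>i<b 0. x i * (\<epsilon> i j - r i * u j)) \<in> ?U" by simp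
        also have "(\<lambda>j\<in>{..<b 0}. \<Sum>i<b 0. x i * (\<epsilon> i j - r i * u j)) = vadd (b 0) x (vscale (b 0) (- s x) u)"
        proof (rule ext)
          fix j
          have "(\<Sum>i<b 0. x i * \<epsilon> i j) = x j" if "j < b 0"
          proof -
            have "(\<Sum>i<b 0. x i * \<epsilon> i j) = (\<Sum>i<b 0. if i = j then x j else 0)"
              using that by (intro sum.cong) (auto simp: \<epsilon>_def)
            then show ?thesis using that by simp
          qed
          then show "(\<lambda>j\<in>{..<b 0}. \<Sum>i<b 0. x i * (\<epsilon> i j - r i * u j)) j = vadd (b 0) x (vscale (b 0) (- s x) u) j"
            by (simp add: vadd_def vscale_def s_def right_diff_distrib sum_subtractf sum_distrib_right mult.assoc)
        qed
        finally show ?thesis .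
      qed
      have s_mH: "s w \<in> mH" if w: "w \<in> ?U" for w
      proof -
        have wR: "w \<in> Rn (b 0)" using w d_in[of _ 0] by auto
        have "vadd (b 0) w (vscale (b 0) (- 1) (vadd (b 0) w (vscale (b 0) (- s w) u))) \<in> ?U"
          by (rule U_add[OF w U_scale[OF neg1 sU[OF wR]]])
        also have "vadd (b 0) w (vscale (b 0) (- 1) (vadd (b 0) w (vscale (b 0) (- s w) u))) = vscale (b 0) (s w) u"
          by (auto simp: vadd_def vscale_def)
        finally show ?thesis using u_mem[OF s_in[OF wR]] by simp
      qed
      define f where "f = (\<lambda>x\<in>Rn (b 1). s (d 0 x) * q)"
      have "f \<in> Homs (b 1) I"
        unfolding f_def
      proof (rule HomsI)
        show "s (d 0 x) * q \<in> I" if "x \<in> Rn (b 1)" for x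
          using s_mH[of "d 0 x"] that q by (auto simp: colon_def)
        show "s (d 0 (vadd (b 1) x y)) * q = s (d 0 x) * q + s (d 0 y) * q"
          if "x \<in> Rn (b 1)" "y \<in> Rn (b 1)" for x y
          using d_add[of x 0 y] that by (simp add: s_add distrib_right)
        show "s (d 0 (vscale (b 1) t x)) * q = t * (s (d 0 x) * q)"
          if "t \<in> RH" "x \<in> Rn (b 1)" for t x
          using d_scale[of t x 0] that by (simp add: s_scale mult.assoc)
      qed
      moreover have "f (d 1 x) = 0" if "x \<in> Rn (b 2)" for x
      proof -
        have "d 1 x \<in> {x \<in> Rn (b 1). d 0 x = vzero (b 0)}" unfolding exact using that by blast
        then show ?thesis by (simp add: f_def s_def)
      qed
      ultimately have "f \<in> Z" unfolding Z_iff by blast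
      moreover have "\<Phi> f - q \<in> I"
      proof -
        have "f c = ?X * (s u * q)" using c by (simp add: f_def s_scale mult.assoc)
        then have "\<Phi> f = s u * q" by (rule Phi_eqI)
        then have eq: "\<Phi> f - q = - 1 * ((1 - s u) * q)" by (simp add: algebra_simps)
        have "vadd (b 0) u (vscale (b 0) (- s u) u) = vscale (b 0) (1 - s u) u"
          by (auto simp: vadd_def vscale_def algebra_simps)
        then have "1 - s u \<in> mH"
          using sU[OF u] u_mem[OF RH_diff[OF RH_one s_in[OF u]]] by simp
        then have "(1 - s u) * q \<in> I" using q by (simp add: colon_def)
        then show ?thesis unfolding eq by (rule Rmod_mult[OF I(1) neg1])
      qed
      ultimately show ?thesis by blast
    qed
  qed
qed

end

context numerical_semigroup
begin

text \<open>For \<open>p \<in> I : m\<close> the \<open>R\<close>-module generated by \<open>I\<close> and \<open>p\<close> is already \<open>I + k p\<close>.\<close>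

abbreviation adjoin :: "'k::field fps set \<Rightarrow> 'k fps \<Rightarrow> 'k fps set" where
  "adjoin I p \<equiv> {i + fps_const c * p | i c. i \<in> I}"

lemma Rmod_adjoin:
  fixes I :: "'k::field fps set"
  assumes "Rmod I" "p \<in> colon I"
  shows "Rmod (adjoin I p)"
  unfolding Rmod_def
proof (intro conjI ballI)
  have "0 = 0 + fps_const 0 * p" by simp
  then show "0 \<in> adjoin I p" using Rmod_zero[OF assms(1)] by blast
  fix x y assume "x \<in> adjoin I p" "y \<in> adjoin I p"
  then obtain i c j c' where ic: "x = i + fps_const c * p" "y = j + fps_const c' * p" "i \<in> I" "j \<in> I"
    by blast
  have "x + y = (i + j) + fps_const (c + c') * p"
    unfolding ic by (simp add: algebra_simps flip: fps_const_add)
  then show "x + y \<in> adjoin I p" using Rmod_add[OF assms(1) ic(3,4)] by blast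
next
  fix r x :: "'k fps" assume r: "r \<in> RH" and "x \<in> adjoin I p"
  then obtain i c where ic: "x = i + fps_const c * p" "i \<in> I" by blast
  define m where "m = r - fps_const (r $ 0)"
  have "m \<in> mH" unfolding m_def mH_def using RH_diff[OF r RH_const] by simp
  then have "m * p \<in> I" using assms(2) by (simp add: colon_def)
  then have "fps_const c * (m * p) \<in> I" by (rule Rmod_mult[OF assms(1) RH_const])
  then have "r * i + fps_const c * (m * p) \<in> I" using Rmod_mult[OF assms(1) r ic(2)] Rmod_add[OF assms(1)] by blast
  moreover have "r * x = (r * i + fps_const c * (m * p)) + fps_const (r $ 0 * c) * p"
    unfolding ic m_def by (simp add: algebra_simps flip: fps_const_mult)
  ultimately show "r * x \<in> adjoin I p" by blast
qed

lemma submodule_preimage: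
  fixes I L :: "'k::field fps set"
  assumes I: "Rmod I" and Z: "submodule Z R (Hom_mod R (free_mod R n) (ideal_mod R I))"
    and add: "\<And>f g. f \<in> Z \<Longrightarrow> g \<in> Z \<Longrightarrow> \<Phi> (\<lambda>x\<in>Rn n. f x + g x) = \<Phi> f + \<Phi> g"
    and scale: "\<And>r f. r \<in> RH \<Longrightarrow> f \<in> Z \<Longrightarrow> \<Phi> (\<lambda>x\<in>Rn n. r * f x) = r * \<Phi> f"
    and L: "Rmod L"
  shows "submodule {f \<in> Z. \<Phi> f \<in> L} R (Hom_mod R (free_mod R n) (ideal_mod R I))"
proof -
  have zero: "(\<lambda>x\<in>Rn n. 0) \<in> Z" using Z unfolding submodule_Hom_iff[OF I] by blast
  have "(\<lambda>x\<in>Rn n. 0) = (\<lambda>x\<in>Rn n. 0 * (\<lambda>x\<in>Rn n. 0 :: 'k fps) x)" by auto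
  then have "\<Phi> (\<lambda>x\<in>Rn n. 0) = 0" using scale[OF supported_zero zero] by simp
  then show ?thesis
    using Z zero Rmod_zero[OF L] Rmod_add[OF L] Rmod_mult[OF L]
    unfolding submodule_Hom_iff[OF I] by (auto simp: add scale)
qed

text \<open>If \<open>I + k p\<close> were strictly between \<open>I\<close> and \<open>I : m\<close>, its preimage under \<open>\<Phi>\<close> would be strictly between the
  coboundaries and the cocycles.\<close>

lemma CM_type_one_imp_colon:
  fixes I :: "'k::field fps set"
  assumes "CM_type_one R (ideal_mod R I)" and I: "Rmod I" "I \<subseteq> mH"
  shows "colon I - I \<noteq> {}"
    and "p \<in> colon I - I \<Longrightarrow> colon I \<subseteq> adjoin I p"
proof -
  obtain b d where res: "free_resolution_of R (residue_field_mod (R :: 'k fps ring)) b d"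
    and len: "quot_length R (Hom_mod R (free_mod R (b 1)) (ideal_mod R I))
       (Ext_cocycles R b d (ideal_mod R I) 1) (Ext_coboundaries R b d (ideal_mod R I) 1) = 1"
    using assms(1) unfolding CM_type_one_def by blast
  define Z where "Z = Ext_cocycles R b d (ideal_mod R I) 1"
  define B where "B = Ext_coboundaries R b d (ideal_mod R I) 1"
  let ?M = "Hom_mod R (free_mod R (b 1)) (ideal_mod R I)"
  let ?chain = "\<lambda>s C. C 0 = B \<and> C s = Z \<and> (\<forall>i\<le>s. submodule (C i) R ?M) \<and> (\<forall>i<s. C i \<subset> C (Suc i))"
  have sup: "Sup {enat s | s. \<exists>C. ?chain s C} = 1"
    using len unfolding Z_def B_def quot_length_def .
  obtain \<Phi> where sub: "submodule Z R ?M" and BZ: "B \<subseteq> Z"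
    and add: "\<And>f g. f \<in> Z \<Longrightarrow> g \<in> Z \<Longrightarrow> \<Phi> (\<lambda>x\<in>Rn (b 1). f x + g x) = \<Phi> f + \<Phi> g"
    and scale: "\<And>r f. r \<in> RH \<Longrightarrow> f \<in> Z \<Longrightarrow> \<Phi> (\<lambda>x\<in>Rn (b 1). r * f x) = r * \<Phi> f"
    and col: "\<And>f. f \<in> Z \<Longrightarrow> \<Phi> f \<in> colon I"
    and B_iff: "\<And>f. f \<in> Z \<Longrightarrow> f \<in> B \<longleftrightarrow> \<Phi> f \<in> I"
    and surj: "\<And>q. q \<in> colon I \<Longrightarrow> \<exists>f\<in>Z. \<Phi> f - q \<in> I"
    using type_transfer[OF res I Z_def B_def] by blast
  have pre: "submodule {f \<in> Z. \<Phi> f \<in> L} R ?M" if "Rmod L" for L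
    by (rule submodule_preimage[OF I(1) sub add scale that])
  have B_eq: "B = {f \<in> Z. \<Phi> f \<in> I}" using BZ B_iff by blast
  have le1: "s \<le> 1" if "?chain s C" for s C
  proof -
    have "enat s \<le> Sup {enat s | s. \<exists>C. ?chain s C}" using that by (intro Sup_upper) blast
    then show ?thesis unfolding sup by (simp add: one_enat_def)
  qed
  have "\<exists>s C. s > 0 \<and> ?chain s C"
  proof (rule ccontr)
    assume "\<not> ?thesis"
    then have "\<And>s C. ?chain s C \<Longrightarrow> s = 0" by (metis gr0I)
    then have "Sup {enat s | s. \<exists>C. ?chain s C} \<le> 0"
      by (intro Sup_least) (auto simp: zero_enat_def)
    then show False unfolding sup by simp
  qed
  then obtain s C where sC: "s > 0" "?chain s C" by blast
  have "s = 1" using le1[OF sC(2)] sC(1) by simp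
  then have "B \<subset> Z" using sC(2) by auto
  then obtain f where "f \<in> Z" "f \<notin> B" by blast
  then have "\<Phi> f \<in> colon I - I" using col B_iff by blast
  then show "colon I - I \<noteq> {}" by blast
  assume p: "p \<in> colon I - I"
  let ?L = "adjoin I p"
  have L: "Rmod ?L" using p by (intro Rmod_adjoin I) auto
  have IL: "I \<subseteq> ?L"
  proof
    fix i assume "i \<in> I"
    moreover have "i = i + fps_const 0 * p" by simp
    ultimately show "i \<in> ?L" by blast
  qed
  let ?N = "{f \<in> Z. \<Phi> f \<in> ?L}"
  show "colon I \<subseteq> ?L"
  proof (rule ccontr)
    assume "\<not> colon I \<subseteq> ?L"
    then obtain q where q: "q \<in> colon I" "q \<notin> ?L" by blast
    obtain g where g: "g \<in> Z" "\<Phi> g - q \<in> I" using surj[OF q(1)] by blast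
    have "\<Phi> g \<notin> ?L"
    proof
      assume "\<Phi> g \<in> ?L"
      moreover have "\<Phi> g - q \<in> ?L" using g(2) IL by blast
      ultimately have "\<Phi> g - (\<Phi> g - q) \<in> ?L" by (rule Rmod_diff[OF L])
      then show False using q(2) by simp
    qed
    then have NZ: "?N \<subset> Z" using g(1) by blast
    obtain h where h: "h \<in> Z" "\<Phi> h - p \<in> I" using surj[of p] p by blast
    have "\<Phi> h = (\<Phi> h - p) + fps_const 1 * p" by simp
    then have "\<Phi> h \<in> ?L" using h(2) by blast
    moreover have "\<Phi> h \<notin> I"
    proof
      assume "\<Phi> h \<in> I"
      then have "\<Phi> h - (\<Phi> h - p) \<in> I" using h(2) by (rule Rmod_diff[OF I(1)])
      then show False using p by simp
    qed
    ultimately have BN: "B \<subset> ?N" unfolding B_eq using h(1) IL by blast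
    have subB: "submodule B R ?M" unfolding B_eq by (rule pre[OF I(1)])
    have "?chain 2 (\<lambda>i. if i = 0 then B else if i = 1 then ?N else Z)"
      using subB sub pre[OF L] BN NZ by (simp add: less_2_cases_iff)
    then have "(2::nat) \<le> 1" by (rule le1)
    then show False by simp
  qed
qed

lemma CM_type_one_if_colon:
  fixes I :: "'k::field fps set"
  assumes res: "free_resolution_of R (residue_field_mod (R :: 'k fps ring)) b d"
    and I: "Rmod I" "I \<subseteq> mH"
    and p: "p \<in> colon I" "p \<notin> I" "colon I \<subseteq> adjoin I p"
  shows "CM_type_one R (ideal_mod R I)"
proof -
  define Z where "Z = Ext_cocycles R b d (ideal_mod R I) 1"
  define B where "B = Ext_coboundaries R b d (ideal_mod R I) 1"
  let ?M = "Hom_mod R (free_mod R (b 1)) (ideal_mod R I)"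
  let ?chain = "\<lambda>s C. C 0 = B \<and> C s = Z \<and> (\<forall>i\<le>s. submodule (C i) R ?M) \<and> (\<forall>i<s. C i \<subset> C (Suc i))"
  obtain \<Phi> where sub: "submodule Z R ?M" and BZ: "B \<subseteq> Z"
    and add: "\<And>f g. f \<in> Z \<Longrightarrow> g \<in> Z \<Longrightarrow> \<Phi> (\<lambda>x\<in>Rn (b 1). f x + g x) = \<Phi> f + \<Phi> g"
    and scale: "\<And>r f. r \<in> RH \<Longrightarrow> f \<in> Z \<Longrightarrow> \<Phi> (\<lambda>x\<in>Rn (b 1). r * f x) = r * \<Phi> f"
    and col: "\<And>f. f \<in> Z \<Longrightarrow> \<Phi> f \<in> colon I"
    and B_iff: "\<And>f. f \<in> Z \<Longrightarrow> f \<in> B \<longleftrightarrow> \<Phi> f \<in> I"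
    and surj: "\<And>q. q \<in> colon I \<Longrightarrow> \<exists>f\<in>Z. \<Phi> f - q \<in> I"
    using type_transfer[OF res I Z_def B_def] by blast
  have Zadd: "(\<lambda>x\<in>Rn (b 1). f x + g x) \<in> Z" if "f \<in> Z" "g \<in> Z" for f g
    using sub that unfolding submodule_Hom_iff[OF I(1)] by blast
  have Zscale: "(\<lambda>x\<in>Rn (b 1). r * f x) \<in> Z" if "f \<in> Z" "r \<in> RH" for f r
    using sub that unfolding submodule_Hom_iff[OF I(1)] by blast
  have B_eq: "B = {f \<in> Z. \<Phi> f \<in> I}" using BZ B_iff by blast
  have subB: "submodule B R ?M"
    unfolding B_eq by (rule submodule_preimage[OF I(1) sub add scale I(1)])
  obtain h where h: "h \<in> Z" "\<Phi> h - p \<in> I" using surj[of p] p by blast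
  have "\<Phi> h \<notin> I"
  proof
    assume "\<Phi> h \<in> I"
    then have "\<Phi> h - (\<Phi> h - p) \<in> I" using h(2) by (rule Rmod_diff[OF I(1)])
    then show False using p by simp
  qed
  then have "B \<subset> Z" unfolding B_eq using h(1) by blast
  then have "?chain 1 (\<lambda>i. if i = 0 then B else Z)" using sub subB by simp
  then have ge: "\<exists>C. ?chain 1 C" by (rule exI[of "?chain 1" "\<lambda>i. if i = 0 then B else Z"])
  have le1: "s \<le> 1" if C: "?chain s C" for s C
  proof (rule ccontr)
    assume "\<not> s \<le> 1"
    then have s: "1 < s" by simp
    have mono: "C i \<subseteq> Z" if "i \<le> s" for i
      using that
    proof (induction rule: inc_induct)
      case (step n)
      then have "C n \<subset> C (Suc n)" using C by blast
      then show ?case using step.IH by blast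
    qed (use C in simp)
    have s2: "Suc 0 < s" "0 < s" using s by simp_all
    have strict: "C 1 \<subset> C 2" "B \<subset> C 1"
      using C s2 unfolding One_nat_def numeral_2_eq_2 by blast+
    have C1Z: "C 1 \<subseteq> Z" using mono s by simp
    obtain f where f: "f \<in> C 1" "f \<notin> B" using strict(2) by blast
    have fZ: "f \<in> Z" using f(1) C1Z by blast
    then obtain i c where ic: "\<Phi> f = i + fps_const c * p" "i \<in> I" using col[OF fZ] p(3) by blast
    have "c \<noteq> 0" using ic f(2) B_iff[OF fZ] by auto
    have sub1: "submodule (C 1) R ?M" using C s by simp
    have "Z \<subseteq> C 1"
    proof
      fix g assume g: "g \<in> Z"
      then obtain j c' where jc: "\<Phi> g = j + fps_const c' * p" "j \<in> I" using col[OF g] p(3) by blast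
      let ?r = "fps_const (- c' / c)"
      let ?f = "\<lambda>x\<in>Rn (b 1). ?r * f x"
      let ?g = "\<lambda>x\<in>Rn (b 1). g x + ?f x"
      let ?h = "\<lambda>x\<in>Rn (b 1). fps_const (c' / c) * f x"
      have gZ: "?g \<in> Z" by (rule Zadd[OF g Zscale[OF fZ RH_const]])
      have "\<Phi> ?g = \<Phi> g + ?r * \<Phi> f"
        unfolding add[OF g Zscale[OF fZ RH_const]] scale[OF RH_const fZ] ..
      also have "\<dots> = j + ?r * i + (fps_const c' + ?r * fps_const c) * p"
        unfolding jc ic by (simp only: algebra_simps)
      also have "fps_const c' + ?r * fps_const c = 0" using \<open>c \<noteq> 0\<close> by simp
      also have "j + ?r * i + 0 * p = j + ?r * i" by simp
      finally have "\<Phi> ?g = j + ?r * i" .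
      then have "\<Phi> ?g \<in> I"
        using Rmod_add[OF I(1) jc(2) Rmod_mult[OF I(1) RH_const ic(2)]] by (simp only:)
      then have g1: "?g \<in> C 1" using B_iff[OF gZ] strict(2) by blast
      have h1: "?h \<in> C 1"
        using sub1 f(1) RH_const unfolding submodule_Hom_iff[OF I(1)] by blast
      have "(\<lambda>x\<in>Rn (b 1). ?g x + ?h x) \<in> C 1"
        using sub1 g1 h1 unfolding submodule_Hom_iff[OF I(1)] by blast
      also have "(\<lambda>x\<in>Rn (b 1). ?g x + ?h x) = g"
      proof (rule extensionalityI)
        have "g \<in> Homs (b 1) I" using sub g unfolding submodule_Hom_iff[OF I(1)] by blast
        then show "g \<in> extensional (Rn (b 1))" by (rule HomsD(4))
        have zero: "fps_const (- c' / c) + fps_const (c' / c) = 0" by simp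
        show "(\<lambda>x\<in>Rn (b 1). ?g x + ?h x) x = g x" if x: "x \<in> Rn (b 1)" for x
        proof -
          have "(\<lambda>x\<in>Rn (b 1). ?g x + ?h x) x = g x + (fps_const (- c' / c) + fps_const (c' / c)) * f x"
            using x by (simp only: restrict_apply' algebra_simps)
          then show ?thesis unfolding zero by simp
        qed
      qed simp
      finally show "g \<in> C 1" .
    qed
    moreover have "C 2 \<subseteq> Z" using mono s by simp
    ultimately show False using strict(1) by blast
  qed
  have "Sup {enat s | s. \<exists>C. ?chain s C} = 1"
  proof (rule antisym)
    show "Sup {enat s | s. \<exists>C. ?chain s C} \<le> 1"
    proof (rule Sup_least)
      fix x assume "x \<in> {enat s | s. \<exists>C. ?chain s C}"
      then obtain s C where x: "x = enat s" and C: "?chain s C" by blast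
      have "s \<le> 1" by (rule le1[OF C])
      then show "x \<le> 1" by (simp add: x one_enat_def)
    qed
    show "1 \<le> Sup {enat s | s. \<exists>C. ?chain s C}"
      unfolding one_enat_def using ge by (intro Sup_upper) blast
  qed
  then have "quot_length R ?M Z B = 1" unfolding quot_length_def .
  then show ?thesis unfolding CM_type_one_def Z_def B_def using res by blast
qed

end

context numerical_semigroup
begin

section \<open>The semigroup ring as a free module over a power series ring\<close>

text \<open>The isomorphism of \<open>k[[t]]\<close> onto \<open>A = k[[t\<^sup>e]]\<close>, which turns every \<open>R\<close>-module into a module over a
  power series ring in one variable.\<close>

definition emb :: "'k::field fps \<Rightarrow> 'k fps" where
  "emb a = Abs_fps (\<lambda>n. if e dvd n then a $ (n div e) else 0)"

text \<open>The component of \<open>f\<close> along \<open>t\<^sup>s\<close> over \<open>A\<close>. It is \<open>A\<close>-linear on series without exponents below \<open>s\<close> in the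
  residue class of \<open>s\<close> modulo \<open>e\<close> (\<open>slice_emb\<close>).\<close>

definition slice :: "nat \<Rightarrow> 'k::field fps \<Rightarrow> 'k fps" where
  "slice s f = Abs_fps (\<lambda>k. f $ (s + e * k))"

lemma slice_nth [simp]: "slice s f $ k = f $ (s + e * k)"
  by (simp add: slice_def)

lemma slice_add: "slice s (f + g) = slice s f + slice s g"
  by (intro fps_ext) simp

lemma slice_0: "slice s 0 = 0"
  by (intro fps_ext) simp

lemma slice_sum: "slice s (\<Sum>i\<in>A. F i) = (\<Sum>i\<in>A. slice s (F i))"
  by (induction A rule: infinite_finite_induct) (auto simp: slice_0 slice_add)

lemma mult_e_in: "e * k \<in> H"
  by (induction k) (auto intro: zero_in add_in e_in)

lemma emb_in: "emb a \<in> RH"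
  using mult_e_in by (auto simp: emb_def supported_def)

lemma emb_mult_nth: "(emb a * f) $ n = (\<Sum>j\<le>n div e. a $ j * f $ (n - e * j))"
proof -
  have inj: "inj_on ((*) e) {..n div e}" using e_pos by (auto simp: inj_on_def)
  have img: "(*) e ` {..n div e} \<subseteq> {0..n}"
    using e_pos by (auto simp: less_eq_div_iff_mult_less_eq mult.commute)
  have "(emb a * f) $ n = (\<Sum>i\<in>{0..n}. emb a $ i * f $ (n - i))"
    by (simp add: fps_mult_nth)
  also have "\<dots> = (\<Sum>i\<in>(*) e ` {..n div e}. emb a $ i * f $ (n - i))"
  proof (rule sum.mono_neutral_right)
    show "\<forall>i\<in>{0..n} - (*) e ` {..n div e}. emb a $ i * f $ (n - i) = 0"
    proof
      fix i assume i: "i \<in> {0..n} - (*) e ` {..n div e}"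
      have "\<not> e dvd i"
      proof
        assume "e dvd i"
        then obtain j where j: "i = e * j" by blast
        then have "j \<le> n div e" using i e_pos by (auto simp: less_eq_div_iff_mult_less_eq mult.commute)
        then show False using i j by auto
      qed
      then show "emb a $ i * f $ (n - i) = 0" by (simp add: emb_def)
    qed
  qed (use img in auto)
  also have "\<dots> = (\<Sum>j\<le>n div e. a $ j * f $ (n - e * j))"
    using e_pos by (simp add: sum.reindex[OF inj] emb_def)
  finally show ?thesis .
qed

lemma slice_emb:
  assumes "\<And>j. 0 < j \<Longrightarrow> e * j \<le> s \<Longrightarrow> f $ (s - e * j) = 0"
  shows "slice s (emb a * f) = a * slice s f"
proof (rule fps_ext)
  fix k
  have "slice s (emb a * f) $ k = (\<Sum>j\<le>(s + e * k) div e. a $ j * f $ (s + e * k - e * j))"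
    by (simp add: emb_mult_nth)
  also have "\<dots> = (\<Sum>j\<le>k. a $ j * f $ (s + e * k - e * j))"
  proof (rule sum.mono_neutral_right)
    show "{..k} \<subseteq> {..(s + e * k) div e}" using e_pos by auto
    show "\<forall>j\<in>{..(s + e * k) div e} - {..k}. a $ j * f $ (s + e * k - e * j) = 0"
    proof
      fix j assume j: "j \<in> {..(s + e * k) div e} - {..k}"
      then have "j \<le> (s + e * k) div e" by (simp only: Diff_iff atMost_iff)
      then have "e * j \<le> s + e * k"
        using less_eq_div_iff_mult_less_eq[OF e_pos, of j "s + e * k"] by (simp only: mult.commute)
      moreover obtain i where i: "j = k + i" "0 < i" using j by (metis DiffE atMost_iff less_imp_add_positive not_le)
      ultimately have "e * i \<le> s" "s + e * k - e * j = s - e * i" by (auto simp: algebra_simps)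
      then show "a $ j * f $ (s + e * k - e * j) = 0" using assms[of i] i by simp
    qed
  qed simp
  also have "\<dots> = (\<Sum>j\<le>k. a $ j * f $ (s + e * (k - j)))"
    by (intro sum.cong) (auto simp: diff_mult_distrib2)
  also have "\<dots> = (a * slice s f) $ k"
    by (simp add: fps_mult_nth atLeast0AtMost)
  finally show "slice s (emb a * f) $ k = (a * slice s f) $ k" .
qed

text \<open>The Apery set of \<open>H\<close> with respect to \<open>e\<close>; the corresponding powers of \<open>t\<close> form a basis of \<open>R\<close> over
  \<open>A\<close>.\<close>

definition apery :: "nat \<Rightarrow> nat" where "apery r = (LEAST h. h \<in> H \<and> h mod e = r)"

lemma apery: "r < e \<Longrightarrow> apery r \<in> H \<and> apery r mod e = r"
proof -
  assume "r < e"
  obtain c where c: "\<And>n. n \<ge> c \<Longrightarrow> n \<in> H" using cofinite by blast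
  have "c \<le> e * c + r" using e_pos by (simp add: trans_le_add1)
  then have "e * c + r \<in> H \<and> (e * c + r) mod e = r" using c \<open>r < e\<close> by simp
  then show ?thesis unfolding apery_def by (rule LeastI)
qed

lemma apery_le: "h \<in> H \<Longrightarrow> apery (h mod e) \<le> h"
  unfolding apery_def by (rule Least_le) simp

lemma apery_minus_multiple:
  assumes "r < e" "0 < j" "e * j \<le> apery r"
  shows "apery r - e * j \<notin> H"
proof
  assume *: "apery r - e * j \<in> H"
  have "(apery r - e * j) mod e = (apery r - e * j + e * j) mod e" by simp
  also have "\<dots> = r" using assms apery by simp
  finally have "apery r \<le> apery r - e * j" using apery_le[OF *] by simp
  moreover have "0 < e * j" using e_pos assms(2) by simp
  ultimately show False using assms(3) by linarith
qed

lemma slice_apery_emb: "r < e \<Longrightarrow> f \<in> RH \<Longrightarrow> slice (apery r) (emb a * f) = a * slice (apery r) f"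
  by (rule slice_emb) (use apery_minus_multiple in \<open>auto simp: supported_def\<close>)

lemma H_apery_decomp:
  assumes "h \<in> H"
  obtains k where "h = apery (h mod e) + e * k"
proof -
  have "apery (h mod e) mod e = h mod e" using apery[of "h mod e"] e_pos by simp
  then obtain k where "h = apery (h mod e) + e * k"
    using apery_le[OF assms] by (metis mod_eq_nat2E)
  then show thesis by (rule that)
qed

lemma RH_eqI_slices:
  assumes "f \<in> RH" "g \<in> RH" "\<And>r. r < e \<Longrightarrow> slice (apery r) f = slice (apery r) g"
  shows "f = g"
proof (rule fps_ext)
  fix n show "f $ n = g $ n"
  proof (cases "n \<in> H")
    case True
    then obtain k where k: "n = apery (n mod e) + e * k" by (rule H_apery_decomp)
    have "slice (apery (n mod e)) f $ k = slice (apery (n mod e)) g $ k"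
      using assms(3) e_pos by simp
    then show ?thesis using k by simp
  qed (use assms in \<open>auto simp: supported_def\<close>)
qed

text \<open>Coordinates of \<open>R\<^sup>n\<close> over \<open>A\<close>.\<close>

definition coords :: "nat \<Rightarrow> (nat \<Rightarrow> 'k::field fps) \<Rightarrow> nat \<times> nat \<Rightarrow> 'k fps" where
  "coords n x = (\<lambda>(i, r). if i < n \<and> r < e then slice (apery r) (x i) else 0)"

lemma coords_inj: "x \<in> Rn n \<Longrightarrow> y \<in> Rn n \<Longrightarrow> coords n x = coords n y \<Longrightarrow> x = y"
proof -
  assume x: "x \<in> Rn n" and y: "y \<in> Rn n" and eq: "coords n x = coords n y"
  show "x = y"
  proof (rule Rn_eqI[OF x y])
    fix i assume i: "i < n"
    show "x i = y i"
    proof (rule RH_eqI_slices)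
      show "slice (apery r) (x i) = slice (apery r) (y i)" if "r < e" for r
        using fun_cong[OF eq, of "(i, r)"] i that by (simp add: coords_def)
    qed (use x y i in \<open>auto intro: Rn_nth\<close>)
  qed
qed

lemma coords_vadd: "coords n (vadd n x y) = (\<lambda>p. coords n x p + coords n y p)"
  by (auto simp: coords_def slice_add)

lemma coords_vscale: "x \<in> Rn n \<Longrightarrow> coords n (vscale n (emb a) x) = (\<lambda>p. a * coords n x p)"
  by (auto simp: coords_def slice_apery_emb Rn_nth)

lemma coords_vzero: "coords n (vzero n) = (\<lambda>_. 0)"
  by (auto simp: coords_def slice_0)

definition Rn_submodule :: "nat \<Rightarrow> (nat \<Rightarrow> 'k::field fps) set \<Rightarrow> bool" where
  "Rn_submodule n M \<longleftrightarrow> M \<subseteq> Rn n \<and> vzero n \<in> M \<and> (\<forall>x\<in>M. \<forall>y\<in>M. vadd n x y \<in> M) \<and>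
     (\<forall>r\<in>RH. \<forall>x\<in>M. vscale n r x \<in> M)"

lemma Rn_submoduleD:
  assumes "Rn_submodule n M"
  shows "x \<in> M \<Longrightarrow> x \<in> Rn n" "vzero n \<in> M" "x \<in> M \<Longrightarrow> y \<in> M \<Longrightarrow> vadd n x y \<in> M"
    "r \<in> RH \<Longrightarrow> x \<in> M \<Longrightarrow> vscale n r x \<in> M"
  using assms unfolding Rn_submodule_def by auto

lemma fps_submodule_coords:
  assumes M: "Rn_submodule n M"
  shows "fps_submodule (coords n ` M)"
  unfolding fps_submodule_def
proof (intro conjI ballI allI)
  show "(\<lambda>_. 0) \<in> coords n ` M"
    using Rn_submoduleD(2)[OF M] by (intro image_eqI[of _ _ "vzero n"]) (simp_all add: coords_vzero)
  fix v assume "v \<in> coords n ` M"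
  then obtain x where x: "x \<in> M" "v = coords n x" by blast
  show "(\<lambda>p. v p + w p) \<in> coords n ` M" if "w \<in> coords n ` M" for w
  proof -
    obtain y where y: "y \<in> M" "w = coords n y" using \<open>w \<in> coords n ` M\<close> by blast
    show ?thesis
      using Rn_submoduleD(3)[OF M x(1) y(1)] by (intro image_eqI[of _ _ "vadd n x y"]) (simp_all add: coords_vadd x y)
  qed
  show "(\<lambda>p. a * v p) \<in> coords n ` M" for a
    using Rn_submoduleD(4)[OF M emb_in x(1)] Rn_submoduleD(1)[OF M x(1)]
    by (intro image_eqI[of _ _ "vscale n (emb a) x"]) (simp_all add: coords_vscale x)
qed

lemma coords_outside: "p \<notin> {..<n} \<times> {..<e} \<Longrightarrow> coords n x p = 0"
  by (auto simp: coords_def split: prod.splits)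

section \<open>Free resolutions exist\<close>

text \<open>Over \<open>A\<close> the submodule is finitely generated, a fortiori over \<open>R\<close>.\<close>

lemma submodule_is_image:
  fixes M :: "(nat \<Rightarrow> 'k::field fps) set"
  assumes M: "Rn_submodule n M"
  shows "\<exists>p G. G \<in> mod_homs R (free_mod R p) (free_mod R n) \<and> G ` Rn p = M"
proof -
  have "\<exists>p g. (\<forall>i<p. g i \<in> coords n ` M) \<and>
      (\<forall>v\<in>coords n ` M. \<exists>a. \<forall>s. v s = (\<Sum>i<(p::nat). a i * g i s))"
    by (rule fps_submodule_finitely_generated[of "{..<n} \<times> {..<e}"])
      (use fps_submodule_coords[OF M] coords_outside in auto)
  then obtain p g where g: "\<And>i. i < p \<Longrightarrow> g i \<in> coords n ` M"
    and gen: "\<And>v. v \<in> coords n ` M \<Longrightarrow> \<exists>a. \<forall>s. v s = (\<Sum>i<(p::nat). a i * g i s)" by blast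
  have "\<forall>i\<in>{..<p}. \<exists>x. x \<in> M \<and> g i = coords n x" using g by blast
  from bchoice[OF this] obtain x where x: "\<And>i. i < p \<Longrightarrow> x i \<in> M" "\<And>i. i < p \<Longrightarrow> g i = coords n (x i)"
    by auto
  define G where "G = (\<lambda>a\<in>Rn p. \<lambda>j\<in>{..<n}. \<Sum>i<p. a i * x i j)"
  have in_M: "(\<lambda>j\<in>{..<n}. \<Sum>i<q. a i * x i j) \<in> M" if "a \<in> Rn p" "q \<le> p" for a q
    using that(2)
  proof (induction q)
    case 0
    have "(\<lambda>j\<in>{..<n}. \<Sum>i<0. a i * x i j) = vzero n" by (auto simp: vzero_def)
    then show ?case using Rn_submoduleD(2)[OF M] by (simp only:)
  next
    case (Suc q)
    have "vscale n (a q) (x q) \<in> M"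
      using Suc.prems that(1) x(1) by (intro Rn_submoduleD(4)[OF M]) (auto intro: Rn_nth)
    moreover have "(\<lambda>j\<in>{..<n}. \<Sum>i<q. a i * x i j) \<in> M"
      by (rule Suc.IH) (use Suc.prems in simp)
    ultimately have "vadd n (\<lambda>j\<in>{..<n}. \<Sum>i<q. a i * x i j) (vscale n (a q) (x q)) \<in> M"
      by (intro Rn_submoduleD(3)[OF M])
    also have "vadd n (\<lambda>j\<in>{..<n}. \<Sum>i<q. a i * x i j) (vscale n (a q) (x q)) =
        (\<lambda>j\<in>{..<n}. \<Sum>i<Suc q. a i * x i j)"
      by (auto simp: vadd_def vscale_def)
    finally show ?case .
  qed
  have G_in: "G a \<in> M" if "a \<in> Rn p" for a
    using in_M[OF that order_refl] that by (simp add: G_def)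
  have "G \<in> mod_homs R (free_mod R p) (free_mod R n)"
    unfolding hom_free_iff
  proof (intro conjI ballI)
    show "G \<in> Rn p \<rightarrow>\<^sub>E Rn n"
      using G_in Rn_submoduleD(1)[OF M] by (auto simp: G_def)
    show "G (vadd p a b) = vadd n (G a) (G b)" if "a \<in> Rn p" "b \<in> Rn p" for a b
      using that vadd_in[OF that] by (auto simp: G_def vadd_def sum.distrib distrib_right)
    show "G (vscale p r a) = vscale n r (G a)" if "r \<in> RH" "a \<in> Rn p" for r a
      using that vscale_in[OF that] by (auto simp: G_def vscale_def sum_distrib_left mult.assoc)
  qed
  moreover have "M \<subseteq> G ` Rn p"
  proof
    fix y assume y: "y \<in> M"
    then obtain a where a: "\<And>s. coords n y s = (\<Sum>i<p. a i * g i s)" using gen by blast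
    define c where "c = (\<lambda>i\<in>{..<p}. emb (a i))"
    have c: "c \<in> Rn p" by (auto simp: c_def carrier_free_mod emb_in)
    have "coords n (G c) = coords n y"
    proof (rule ext, clarify)
      fix j r
      show "coords n (G c) (j, r) = coords n y (j, r)"
      proof (cases "j < n \<and> r < e")
        case True
        have "coords n (G c) (j, r) = slice (apery r) (\<Sum>i<p. emb (a i) * x i j)"
          using True c by (simp add: coords_def G_def c_def)
        also have "\<dots> = (\<Sum>i<p. a i * slice (apery r) (x i j))"
          unfolding slice_sum
          using True x(1) Rn_submoduleD(1)[OF M] by (intro sum.cong slice_apery_emb) (auto intro: Rn_nth)
        also have "\<dots> = (\<Sum>i<p. a i * g i (j, r))"
          using True x(2) by (intro sum.cong) (auto simp: coords_def)
        finally show ?thesis using a by simp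
      qed (auto simp: coords_def)
    qed
    then have "G c = y"
      using coords_inj Rn_submoduleD(1)[OF M] G_in[OF c] y by blast
    then show "y \<in> G ` Rn p" using c by blast
  qed
  ultimately show ?thesis using G_in by blast
qed

lemma kernel_submodule:
  fixes f :: "(nat \<Rightarrow> 'k::field fps) \<Rightarrow> nat \<Rightarrow> 'k fps"
  assumes f: "f \<in> mod_homs R (free_mod R q) (free_mod R p)"
  shows "Rn_submodule q {x \<in> Rn q. f x = vzero p}"
  unfolding Rn_submodule_def
proof (intro conjI ballI)
  have f': "f (vadd q x y) = vadd p (f x) (f y)" "r \<in> RH \<Longrightarrow> f (vscale q r x) = vscale p r (f x)"
    if "x \<in> Rn q" "y \<in> Rn q" for x y r
    using f that unfolding hom_free_iff by blast+
  show "vzero q \<in> {x \<in> Rn q. f x = vzero p}"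
    using hom_free_zero[OF f] by (simp add: vzero_in)
  have "vadd p (vzero p) (vzero p) = (vzero p :: nat \<Rightarrow> 'k fps)" by (auto simp: vadd_def vzero_def)
  then show "vadd q x y \<in> {x \<in> Rn q. f x = vzero p}"
    if "x \<in> {x \<in> Rn q. f x = vzero p}" "y \<in> {x \<in> Rn q. f x = vzero p}" for x y
    using that f'[of x y] by (simp add: vadd_in)
  have "vscale p r (vzero p) = (vzero p :: nat \<Rightarrow> 'k fps)" for r by (auto simp: vscale_def vzero_def)
  then show "vscale q r x \<in> {x \<in> Rn q. f x = vzero p}"
    if "r \<in> RH" "x \<in> {x \<in> Rn q. f x = vzero p}" for r x
    using that f'(2)[of x x r] by (simp add: vscale_in)
qed auto

text \<open>Cover the kernel of the last map by a free module, again and again, starting with \<open>R \<rightarrow> k\<close>.\<close>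

lemma residue_resolution_exists:
  "\<exists>b d. free_resolution_of R (residue_field_mod (R :: 'k::field fps ring)) b d"
proof -
  let ?k = "residue_field_mod (R :: 'k fps ring)"
  let ?K = "{x \<in> Rn 1. x 0 \<in> mH} :: (nat \<Rightarrow> 'k fps) set"
  have "Rn_submodule 1 ?K"
    unfolding Rn_submodule_def
    using Rmod_zero[OF Rmod_mH] Rmod_add[OF Rmod_mH] Rmod_mult[OF Rmod_mH]
    by (auto simp: vzero_in vadd_in vscale_in)
  then obtain q0 f0 where f0: "f0 \<in> mod_homs R (free_mod R q0) (free_mod R 1)" "f0 ` Rn q0 = ?K"
    using submodule_is_image by blast
  \<comment> \<open>A state \<open>(p, q, f)\<close> stands for a map \<open>f\<close> from \<open>R\<^sup>q\<close> to \<open>R\<^sup>p\<close>; \<open>Q\<close> says that two maps are composable and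
    exact.\<close>
  define P :: "nat \<Rightarrow> nat \<times> nat \<times> ((nat \<Rightarrow> 'k fps) \<Rightarrow> nat \<Rightarrow> 'k fps) \<Rightarrow> bool" where
    "P = (\<lambda>i (p, q, f). f \<in> mod_homs R (free_mod R q) (free_mod R p) \<and> (i = 0 \<longrightarrow> p = 1 \<and> f ` Rn q = ?K))"
  define Q :: "nat \<Rightarrow> nat \<times> nat \<times> ((nat \<Rightarrow> 'k fps) \<Rightarrow> nat \<Rightarrow> 'k fps) \<Rightarrow>
      nat \<times> nat \<times> ((nat \<Rightarrow> 'k fps) \<Rightarrow> nat \<Rightarrow> 'k fps) \<Rightarrow> bool" where
    "Q = (\<lambda>i (p, q, f) (p', q', f'). p' = q \<and> {x \<in> Rn q. f x = vzero p} = f' ` Rn q')"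
  have "\<exists>S. \<forall>i. P i (S i) \<and> Q i (S i) (S (Suc i))"
  proof (rule dependent_nat_choice)
    show "\<exists>s. P 0 s" using f0 by (intro exI[of _ "(1, q0, f0)"]) (simp add: P_def)
    fix s i assume s: "P i s"
    obtain p q f where s_eq: "s = (p, q, f)" by (cases s)
    have "f \<in> mod_homs R (free_mod R q) (free_mod R p)" using s by (simp add: P_def s_eq)
    then obtain q' f' where "f' \<in> mod_homs R (free_mod R q') (free_mod R q)"
      "f' ` Rn q' = {x \<in> Rn q. f x = vzero p}"
      using submodule_is_image[OF kernel_submodule] by blast
    then show "\<exists>s'. P (Suc i) s' \<and> Q i s s'"
      by (intro exI[of _ "(q, q', f')"]) (simp add: P_def Q_def s_eq)
  qed
  then obtain S where S: "\<And>i. P i (S i)" "\<And>i. Q i (S i) (S (Suc i))" by blast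
  define b where "b = (\<lambda>i. fst (S i))"
  define d where "d = (\<lambda>i. snd (snd (S i)))"
  have S_eq: "S i = (b i, b (Suc i), d i)" for i
    using S(2)[of i] unfolding Q_def b_def d_def by (auto split: prod.splits)
  have "free_resolution R b d"
    unfolding free_resolution_def using S unfolding S_eq by (auto simp: P_def Q_def)
  moreover have b0: "b 0 = 1" "d 0 ` Rn (b 1) = ?K"
    using S(1)[of 0] unfolding S_eq by (simp_all add: P_def)
  have x0: "x 0 \<in> RH" if "x \<in> Rn (b 0)" for x :: "nat \<Rightarrow> 'k fps"
    using Rn_nth[of x 1 0] that b0(1) by simp
  define \<epsilon> where "\<epsilon> = (\<lambda>x\<in>Rn (b 0). mH +>\<^bsub>R\<^esub> (x 0) :: 'k fps set)"
  have "\<epsilon> \<in> mod_homs R (free_mod R (b 0)) ?k"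
    unfolding mod_homs_iff
  proof (intro conjI ballI)
    show "\<epsilon> \<in> Rn (b 0) \<rightarrow>\<^sub>E carrier ?k"
      using x0 by (auto simp: \<epsilon>_def residue_field_carrier)
  next
    fix x y :: "nat \<Rightarrow> 'k fps" assume "x \<in> Rn (b 0)" "y \<in> Rn (b 0)"
    then show "\<epsilon> (x \<oplus>\<^bsub>free_mod R (b 0)\<^esub> y) = \<epsilon> x \<oplus>\<^bsub>?k\<^esub> \<epsilon> y"
      using b0(1) x0 by (simp add: \<epsilon>_def vadd_in residue_field_add)
  next
    fix r :: "'k fps" and x :: "nat \<Rightarrow> 'k fps" assume "r \<in> carrier R" "x \<in> Rn (b 0)"
    then show "\<epsilon> (r \<odot>\<^bsub>free_mod R (b 0)\<^esub> x) = r \<odot>\<^bsub>?k\<^esub> \<epsilon> x"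
      using b0(1) x0 by (simp add: \<epsilon>_def vscale_in residue_field_smult)
  qed
  moreover have "\<epsilon> ` Rn (b 0) = carrier ?k"
  proof (intro equalityI subsetI)
    fix X assume "X \<in> carrier ?k"
    then obtain r where r: "r \<in> RH" "X = mH +>\<^bsub>R\<^esub> r" unfolding residue_field_carrier by blast
    have "(\<lambda>i\<in>{..<1::nat}. r) \<in> Rn (b 0)" using r(1) by (auto simp: carrier_free_mod b0(1))
    then show "X \<in> \<epsilon> ` Rn (b 0)"
      using r(2) by (intro image_eqI[of _ _ "\<lambda>i\<in>{..<1}. r"]) (simp_all add: \<epsilon>_def)
  next
    fix X assume "X \<in> \<epsilon> ` Rn (b 0)"
    then show "X \<in> carrier ?k"
      using x0 by (auto simp: \<epsilon>_def residue_field_carrier)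
  qed
  moreover have "{x \<in> Rn (b 0). \<epsilon> x = \<zero>\<^bsub>?k\<^esub>} = d 0 ` Rn (b 1)"
    unfolding b0(2) using b0(1) x0 by (auto simp: \<epsilon>_def residue_field_zero coset_zero)
  ultimately show ?thesis unfolding free_resolution_of_def by blast
qed

end

context numerical_semigroup
begin

section \<open>Finite injective dimension of the canonical module\<close>

text \<open>The annihilator of \<open>R\<close> under the pairing \<open>(f, g) \<mapsto> [t\<^sup>N] (f g)\<close> on \<open>k[[t]]\<close>. For \<open>N\<close> at least the
  Frobenius number \<open>F\<close>, this is \<open>t\<^bsup>N - F\<^esup> K\<close>; for large \<open>N\<close> it is an ideal of \<open>R\<close>.\<close>

definition canon :: "nat \<Rightarrow> 'k::field fps set" where
  "canon N = {f. \<forall>h\<in>H. h \<le> N \<longrightarrow> f $ (N - h) = 0}"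

lemma slice_canon_emb:
  assumes "f \<in> canon N"
  shows "slice (N + e) (emb a * f) = a * slice (N + e) f"
proof (rule slice_emb)
  fix j assume "0 < j" "e * j \<le> N + e"
  then obtain i where "j = Suc i" by (cases j) auto
  then have "N + e - e * j = N - e * i" "e * i \<le> N" using \<open>e * j \<le> N + e\<close> by auto
  then show "f $ (N + e - e * j) = 0" using assms mult_e_in[of i] by (simp add: canon_def)
qed

lemma canon_eq_supported: "canon N = supported {n. \<not> (\<exists>h\<in>H. n + h = N)}"
proof -
  have "(\<forall>h\<in>H. h \<le> N \<longrightarrow> f $ (N - h) = 0) \<longleftrightarrow> (\<forall>n. (\<exists>h\<in>H. n + h = N) \<longrightarrow> f $ n = 0)" for f :: "'k::field fps"
    by (metis add_diff_cancel_right' le_add2 le_add_diff_inverse2)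
  then show ?thesis by (auto simp: canon_def supported_def)
qed

lemma Rmod_canon: "Rmod (canon N)"
  unfolding canon_eq_supported
proof (rule Rmod_supported, clarify)
  fix h s g
  assume h: "h \<in> H" and s: "\<not> (\<exists>h'\<in>H. s + h' = h + s + g)" and g: "g \<in> H"
  have "s + (h + g) = h + s + g" by simp
  then show False using s add_in[OF h g] by blast
qed

lemma X_power_canon:
  assumes "r < e" "apery r \<le> N + e"
  shows "fps_X ^ (N + e - apery r) \<in> canon N"
  unfolding canon_eq_supported
proof (rule supported_X_power, clarify)
  fix h assume h: "h \<in> H" "N + e - apery r + h = N"
  then have "apery r = h + e" using assms(2) by linarith
  then show False using apery_minus_multiple[OF assms(1), of 1] h(1) by simp
qed

lemma slice_X_power:
  assumes "a \<le> s"
  shows "slice s (fps_X ^ (s - a) * z) = slice a z"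
proof (rule fps_ext)
  fix k
  have "\<not> s + e * k < s - a" "s + e * k - (s - a) = a + e * k" using assms by linarith+
  then show "slice s (fps_X ^ (s - a) * z) $ k = slice a z $ k" by (simp add: fps_X_power_mult_nth)
qed

text \<open>Any exponent \<open>n\<close> of \<open>u\<close> is moved by some \<open>g \<in> H\<close> to a number \<open>n + g \<ge> N + e\<close> congruent to \<open>N\<close>
  modulo \<open>e\<close>.\<close>

lemma slices_nondegenerate:
  assumes "\<And>z. z \<in> RH \<Longrightarrow> slice (N + e) (z * u) = 0"
  shows "u = 0"
proof (rule fps_ext)
  fix n
  obtain c where c: "\<And>n. n \<ge> c \<Longrightarrow> n \<in> H" using cofinite by blast
  define g where "g = N + e + e * (n + c) - n"
  have le: "n + c \<le> e * (n + c)" using e_pos by simp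
  have "c \<le> g" "g + n = N + e + e * (n + c)"
    using le unfolding g_def by linarith+
  have "slice (N + e) (fps_X ^ g * u) = 0"
    using c[OF \<open>c \<le> g\<close>] by (intro assms RH_X_power)
  then have "(fps_X ^ g * u) $ (N + e + e * (n + c)) = 0" by (metis slice_nth fps_zero_nth)
  then show "u $ n = 0 $ n"
    unfolding \<open>g + n = N + e + e * (n + c)\<close>[symmetric] by (simp add: fps_X_power_mult_nth)
qed

lemma shift_e_in:
  assumes "f \<in> RH" "\<And>r. r < e \<Longrightarrow> f $ apery r = 0"
  shows "fps_shift e f \<in> RH" "fps_X ^ e * fps_shift e f = f"
proof -
  have "apery 0 = 0" using apery_le[OF zero_in] by simp
  then have "f $ 0 = 0" using assms(2)[of 0] e_pos by simp
  then show "fps_X ^ e * fps_shift e f = f" using assms(1) by (intro mH_divide) (simp add: mH_def)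
  show "fps_shift e f \<in> RH"
    unfolding supported_def
  proof clarify
    fix n assume "n \<notin> H"
    show "fps_shift e f $ n = 0"
    proof (cases "n + e \<in> H")
      case True
      then obtain k where k: "n + e = apery ((n + e) mod e) + e * k" by (rule H_apery_decomp)
      have r: "(n + e) mod e < e" using e_pos by simp
      have "k = 0"
      proof (rule ccontr)
        assume "k \<noteq> 0"
        then obtain k' where "k = Suc k'" by (cases k) auto
        then have "n = apery ((n + e) mod e) + e * k'" using k by simp
        then show False using \<open>n \<notin> H\<close> add_in[OF _ mult_e_in] apery[OF r] by metis
      qed
      then have "n + e = apery ((n + e) mod e)" using k by (simp only: mult_0_right add_0_right)
      then show ?thesis using assms(2)[OF r] by (metis fps_shift_nth)
    qed (use assms(1) in \<open>simp add: supported_def\<close>)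
  qed
qed

text \<open>A vector of \<open>R\<^sup>n\<close> whose coordinates over \<open>A\<close> are all divisible by the variable is divisible by
  \<open>t\<^sup>e\<close>.\<close>

lemma saturated_coords:
  assumes M: "Rn_submodule n M" and sat: "\<And>x. x \<in> Rn n \<Longrightarrow> vscale n (fps_X ^ e) x \<in> M \<Longrightarrow> x \<in> M"
    and v: "(\<lambda>p. fps_X * v p) \<in> coords n ` M"
  shows "v \<in> coords n ` M"
proof -
  obtain y where y: "y \<in> M" "(\<lambda>p. fps_X * v p) = coords n y" using v by blast
  have yR: "y \<in> Rn n" using Rn_submoduleD(1)[OF M y(1)] .
  have y0: "y i $ apery r = 0" if "i < n" "r < e" for i r
  proof -
    have "coords n y (i, r) $ 0 = 0" unfolding y(2)[symmetric] by simp
    then show ?thesis using that by (simp add: coords_def)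
  qed
  define x where "x = (\<lambda>i\<in>{..<n}. fps_shift e (y i))"
  have x: "x \<in> Rn n" "y = vscale n (fps_X ^ e) x"
  proof -
    show xR: "x \<in> Rn n"
      using shift_e_in(1)[OF Rn_nth[OF yR]] y0 by (auto simp: x_def carrier_free_mod)
    show "y = vscale n (fps_X ^ e) x"
    proof (rule Rn_eqI[OF yR vscale_in[OF RH_X_power[OF e_in] xR]])
      show "y i = vscale n (fps_X ^ e) x i" if "i < n" for i
        using shift_e_in(2)[OF Rn_nth[OF yR that]] y0 that by (simp add: x_def)
    qed
  qed
  have "x \<in> M" using sat[OF x(1)] x(2) y(1) by simp
  moreover have "v = coords n x"
  proof (rule ext, clarify, rule fps_ext)
    fix i r k
    have "v (i, r) $ k = (fps_X * v (i, r)) $ Suc k" by simp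
    also have "\<dots> = coords n y (i, r) $ Suc k" using fun_cong[OF y(2), of "(i, r)"] by simp
    also have "\<dots> = coords n x (i, r) $ k"
      by (simp add: coords_def x_def add.commute add.left_commute)
    finally show "v (i, r) $ k = coords n x (i, r) $ k" .
  qed
  ultimately show ?thesis by blast
qed

text \<open>The functional \<open>\<tau> = slice (N + e)\<close> on \<open>canon N\<close> is \<open>A\<close>-linear, and \<open>\<tau> (t\<^bsup>N + e - w\<^esup> z)\<close> is the
  coordinate of \<open>z\<close> at the Apery element \<open>w\<close>. The functional \<open>\<tau> \<circ> F\<close> on \<open>M\<close> extends to \<open>R\<^sup>n\<close>, with some
  coefficients \<open>c\<close> with respect to the coordinates; the combinations \<open>\<kappa> j\<close> of the \<open>t\<^bsup>N + e - w\<^esup>\<close> with these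
  coefficients define an \<open>R\<close>-linear map \<open>g\<close> with \<open>\<tau> \<circ> g = \<tau> \<circ> F\<close> on \<open>M\<close>, and \<open>g = F\<close> there because \<open>\<tau>\<close> is
  nondegenerate.\<close>

lemma extend_hom_to_canon:
  fixes M :: "(nat \<Rightarrow> 'k::field fps) set"
  assumes N: "\<And>r. r < e \<Longrightarrow> apery r \<le> N + e"
    and M: "Rn_submodule n M" and sat: "\<And>x. x \<in> Rn n \<Longrightarrow> vscale n (fps_X ^ e) x \<in> M \<Longrightarrow> x \<in> M"
    and F_in: "\<And>x. x \<in> M \<Longrightarrow> F x \<in> canon N"
    and F_add: "\<And>x y. x \<in> M \<Longrightarrow> y \<in> M \<Longrightarrow> F (vadd n x y) = F x + F y"
    and F_scale: "\<And>r x. r \<in> RH \<Longrightarrow> x \<in> M \<Longrightarrow> F (vscale n r x) = r * F x"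
  shows "\<exists>g\<in>Homs n (canon N). \<forall>x\<in>M. g x = F x"
proof -
  have MR: "x \<in> Rn n" if "x \<in> M" for x using Rn_submoduleD(1)[OF M that] .
  define lam where "lam = (\<lambda>v. slice (N + e) (F (the_inv_into M (coords n) v)))"
  have inj: "inj_on (coords n) M" using coords_inj MR by (auto intro!: inj_onI)
  have lam: "lam (coords n x) = slice (N + e) (F x)" if "x \<in> M" for x
    using the_inv_into_f_f[OF inj that] by (simp add: lam_def)
  have "\<exists>c. \<forall>v\<in>coords n ` M. lam v = (\<Sum>p\<in>{..<n} \<times> {..<e}. c p * v p)"
  proof (rule saturated_extend_functional)
    show "fps_submodule (coords n ` M)" by (rule fps_submodule_coords[OF M])
    show "v p = 0" if "v \<in> coords n ` M" "p \<notin> {..<n} \<times> {..<e}" for v p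
      using that coords_outside by blast
    show "v \<in> coords n ` M" if "(\<lambda>p. fps_X * v p) \<in> coords n ` M" for v
      using saturated_coords[OF M sat that] .
    fix v assume "v \<in> coords n ` M"
    then obtain x where x: "x \<in> M" "v = coords n x" by blast
    show "lam (\<lambda>p. a * v p) = a * lam v" for a
    proof -
      have "(\<lambda>p. a * v p) = coords n (vscale n (emb a) x)"
        using x MR by (simp add: coords_vscale)
      then show ?thesis
        using lam[OF x(1)] lam[OF Rn_submoduleD(4)[OF M emb_in x(1)]] F_scale[OF emb_in x(1)]
          slice_canon_emb[OF F_in[OF x(1)]] x(2) by simp
    qed
    show "lam (\<lambda>p. v p + w p) = lam v + lam w" if "w \<in> coords n ` M" for w
    proof -
      obtain y where y: "y \<in> M" "w = coords n y" using \<open>w \<in> coords n ` M\<close> by blast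
      have "(\<lambda>p. v p + w p) = coords n (vadd n x y)" using x y by (simp add: coords_vadd)
      then show ?thesis
        using lam[OF x(1)] lam[OF y(1)] lam[OF Rn_submoduleD(3)[OF M x(1) y(1)]] F_add[OF x(1) y(1)]
          slice_add x(2) y(2) by simp
    qed
  qed simp
  then obtain c where c: "\<And>v. v \<in> coords n ` M \<Longrightarrow> lam v = (\<Sum>p\<in>{..<n} \<times> {..<e}. c p * v p)" by blast
  define \<kappa> where "\<kappa> = (\<lambda>j. \<Sum>r<e. emb (c (j, r)) * fps_X ^ (N + e - apery r))"
  have \<kappa>: "\<kappa> j \<in> canon N" for j
    unfolding \<kappa>_def using X_power_canon N by (intro Rmod_sum[OF Rmod_canon] Rmod_mult[OF Rmod_canon] emb_in) auto
  have slice_\<kappa>: "slice (N + e) (z * \<kappa> j) = (\<Sum>r<e. c (j, r) * slice (apery r) z)"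
    if z: "z \<in> RH" for z j
  proof -
    have "slice (N + e) (emb (c (j, r)) * (z * fps_X ^ (N + e - apery r))) = c (j, r) * slice (apery r) z"
      if "r < e" for r
      using slice_canon_emb[OF Rmod_mult[OF Rmod_canon z X_power_canon[OF that N[OF that]]]]
        slice_X_power[OF N[OF that], of z] by (simp add: mult.commute)
    then show ?thesis
      by (simp add: \<kappa>_def sum_distrib_left slice_sum mult.left_commute)
  qed
  define g where "g = (\<lambda>x. \<Sum>j<n. x j * \<kappa> j)"
  have g: "restrict g (Rn n) \<in> Homs n (canon N)"
  proof (rule HomsI)
    show "g x \<in> canon N" if "x \<in> Rn n" for x
      unfolding g_def using \<kappa> that by (intro Rmod_sum[OF Rmod_canon] Rmod_mult[OF Rmod_canon]) (auto intro: Rn_nth)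
    show "g (vadd n x y) = g x + g y" for x y
      by (simp add: g_def distrib_right sum.distrib)
    show "g (vscale n r x) = r * g x" for r x
      by (simp add: g_def sum_distrib_left mult.assoc)
  qed
  have slice_g: "slice (N + e) (g x) = slice (N + e) (F x)" if x: "x \<in> M" for x
  proof -
    have "slice (N + e) (g x) = (\<Sum>j<n. \<Sum>r<e. c (j, r) * slice (apery r) (x j))"
      unfolding g_def slice_sum using MR[OF x] by (intro sum.cong slice_\<kappa>) (auto intro: Rn_nth)
    also have "\<dots> = (\<Sum>j<n. \<Sum>r<e. c (j, r) * coords n x (j, r))"
      by (intro sum.cong) (auto simp: coords_def)
    also have "\<dots> = (\<Sum>p\<in>{..<n} \<times> {..<e}. c p * coords n x p)"
      by (simp add: sum.cartesian_product)
    also have "\<dots> = slice (N + e) (F x)" using c lam x by auto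
    finally show ?thesis .
  qed
  have "g x = F x" if x: "x \<in> M" for x
  proof -
    have "slice (N + e) (z * (g x - F x)) = 0" if z: "z \<in> RH" for z
    proof -
      have zx: "vscale n z x \<in> M" using Rn_submoduleD(4)[OF M z x] .
      have "z * g x = g (vscale n z x)" by (simp add: g_def sum_distrib_left mult.assoc)
      then have "slice (N + e) (z * g x) = slice (N + e) (z * F x)"
        using slice_g[OF zx] F_scale[OF z x] by simp
      moreover have "z * (g x - F x) + z * F x = z * g x" by (simp add: algebra_simps)
      ultimately show ?thesis using slice_add[of "N + e" "z * (g x - F x)" "z * F x"] by simp
    qed
    then have "g x - F x = 0" by (rule slices_nondegenerate)
    then show ?thesis by simp
  qed
  then have "\<forall>x\<in>M. restrict g (Rn n) x = F x" using MR by simp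
  then show ?thesis using g by (rule bexI)
qed

text \<open>For \<open>i \<ge> 2\<close> a cocycle is a homomorphism on the image of \<open>d (i - 1)\<close>. This image is the kernel of
  \<open>d (i - 2)\<close>, hence saturated, so the homomorphism extends to the whole free module.\<close>

theorem finite_injective_dimension_canon:
  assumes N: "\<And>r. r < e \<Longrightarrow> apery r \<le> N + e"
  shows "finite_injective_dimension R (ideal_mod R (canon N :: 'k::field fps set))"
  unfolding finite_injective_dimension_def
proof (intro exI[of _ 1] allI impI)
  fix b i and d :: "nat \<Rightarrow> (nat \<Rightarrow> 'k fps) \<Rightarrow> nat \<Rightarrow> 'k fps"
  assume res: "free_resolution R b d" and "1 < (i :: nat)"
  then obtain j where i: "i = Suc (Suc j)" by (metis One_nat_def less_imp_Suc_add plus_nat.simps(2) add_Suc_right)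
  let ?I = "canon N :: 'k fps set"
  let ?p = "b (Suc (Suc j))" and ?n = "b (Suc j)" and ?D = "d (Suc j)"
  note d_hom = free_resolutionD(1)[OF res] and exact = free_resolutionD(2)[OF res]
  note D_hom = d_hom[of "Suc j"]
  note D = hom_freeD[OF D_hom]
  define M where "M = ?D ` Rn ?p"
  have M_eq: "M = {x \<in> Rn ?n. d j x = vzero (b j)}" unfolding M_def exact[symmetric] ..
  have M: "Rn_submodule ?n M" unfolding M_eq by (rule kernel_submodule[OF d_hom])
  have sat: "x \<in> M" if x: "x \<in> Rn ?n" and "vscale ?n (fps_X ^ e) x \<in> M" for x
  proof -
    have "d j (vscale ?n (fps_X ^ e) x) = vscale (b j) (fps_X ^ e) (d j x)"
      using d_hom[of j] x RH_X_power[OF e_in] unfolding hom_free_iff by blast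
    then have "vscale (b j) (fps_X ^ e) (d j x) = vzero (b j)" using that(2) unfolding M_eq by simp
    then have "d j x l = vzero (b j) l" if "l < b j" for l
      using that by (metis v_nth(2,3) mult_eq_0_iff power_eq_0_iff fps_X_neq_zero)
    moreover have "d j x \<in> Rn (b j)" using d_hom[of j] x unfolding hom_free_iff by blast
    ultimately have "d j x = vzero (b j)" using Rn_eqI[OF _ vzero_in] by blast
    then show ?thesis using x unfolding M_eq by simp
  qed
  have cob: "Ext_coboundaries R b d (ideal_mod R ?I) i = (\<lambda>g. \<lambda>x\<in>Rn ?p. g (?D x)) ` Homs ?n ?I"
    unfolding i Ext_coboundaries_eq ..
  have exact_D: "{x \<in> Rn ?p. ?D x = vzero ?n} = d i ` Rn (b (Suc i))"
    using exact[of "Suc j"] i by simp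
  show "Ext_cocycles R b d (ideal_mod R ?I) i = Ext_coboundaries R b d (ideal_mod R ?I) i"
  proof
    show "Ext_coboundaries R b d (ideal_mod R ?I) i \<subseteq> Ext_cocycles R b d (ideal_mod R ?I) i"
      unfolding i by (rule coboundaries_subset_cocycles[OF res])
    show "Ext_cocycles R b d (ideal_mod R ?I) i \<subseteq> Ext_coboundaries R b d (ideal_mod R ?I) i"
    proof
      fix f assume "f \<in> Ext_cocycles R b d (ideal_mod R ?I) i"
      then have f: "f \<in> Homs ?p ?I" and f0: "\<And>x. x \<in> Rn (b (Suc i)) \<Longrightarrow> f (d i x) = 0"
        unfolding Ext_cocycles_iff i by simp_all
      have ker: "f x = f y" if "x \<in> Rn ?p" "y \<in> Rn ?p" "?D x = ?D y" for x y
      proof (rule Homs_eq_of_image_eq[OF f D_hom _ that])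
        fix z assume "z \<in> Rn ?p" "?D z = vzero ?n"
        then have "z \<in> d i ` Rn (b (Suc i))" unfolding exact_D[symmetric] by simp
        then show "f z = 0" using f0 by blast
      qed
      have "\<forall>y\<in>M. \<exists>w. \<forall>x\<in>Rn ?p. ?D x = y \<longrightarrow> f x = w"
        unfolding M_def using ker by blast
      from bchoice[OF this] obtain F where "\<forall>y\<in>M. \<forall>x\<in>Rn ?p. ?D x = y \<longrightarrow> f x = F y" by blast
      then have F: "F (?D x) = f x" if "x \<in> Rn ?p" for x
        using that unfolding M_def by simp
      have "\<exists>g\<in>Homs ?n ?I. \<forall>x\<in>M. g x = F x"
      proof (rule extend_hom_to_canon[OF N M sat])
        show "F x \<in> ?I" if "x \<in> M" for x
          using that F HomsD(1)[OF f] unfolding M_def by auto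
        show "F (vadd ?n x y) = F x + F y" if "x \<in> M" "y \<in> M" for x y
        proof -
          obtain x' y' where *: "x' \<in> Rn ?p" "y' \<in> Rn ?p" "x = ?D x'" "y = ?D y'"
            using \<open>x \<in> M\<close> \<open>y \<in> M\<close> unfolding M_def by blast
          show ?thesis
            using F[OF vadd_in[OF *(1,2)]] F[OF *(1)] F[OF *(2)] HomsD(2)[OF f *(1,2)] D(2)[OF *(1,2)] *(3,4)
            by simp
        qed
        show "F (vscale ?n r x) = r * F x" if "r \<in> RH" "x \<in> M" for r x
        proof -
          obtain x' where *: "x' \<in> Rn ?p" "x = ?D x'"
            using \<open>x \<in> M\<close> unfolding M_def by blast
          show ?thesis
            using F[OF vscale_in[OF that(1) *(1)]] F[OF *(1)] HomsD(3)[OF f that(1) *(1)]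
              D(3)[OF that(1) *(1)] *(2) by simp
        qed
      qed
      then obtain g where g: "g \<in> Homs ?n ?I" "\<And>x. x \<in> M \<Longrightarrow> g x = F x" by blast
      have "f = (\<lambda>x\<in>Rn ?p. g (?D x))"
      proof (rule extensionalityI)
        show "f \<in> extensional (Rn ?p)" by (rule HomsD(4)[OF f])
        show "f x = (\<lambda>x\<in>Rn ?p. g (?D x)) x" if "x \<in> Rn ?p" for x
          using that F[OF that] g(2)[of "?D x"] by (simp add: M_def)
      qed simp
      then show "f \<in> Ext_coboundaries R b d (ideal_mod R ?I) i" unfolding cob using g(1) by blast
    qed
  qed
qed

end

section \<open>Canonical ideals are multiples of the canonical module\<close>

lemma supported_shift:
  fixes S :: "nat set"
  shows "supported ((+) s ` S) = (*) (fps_X ^ s) ` (supported S :: 'k::field fps set)"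
proof (intro equalityI subsetI)
  fix f :: "'k fps" assume f: "f \<in> supported ((+) s ` S)"
  have "f = fps_X ^ s * fps_shift s f"
  proof (rule fps_ext)
    fix n
    have "f $ n = 0" if "n < s" using f that by (force simp: supported_def)
    then show "f $ n = (fps_X ^ s * fps_shift s f) $ n" by (simp add: fps_X_power_mult_nth)
  qed
  moreover have "fps_shift s f \<in> supported S"
    using f by (auto simp: supported_def image_iff) (metis add.commute add_left_cancel)
  ultimately show "f \<in> (*) (fps_X ^ s) ` supported S" by blast
next
  fix f :: "'k fps" assume "f \<in> (*) (fps_X ^ s) ` supported S"
  then obtain g where "g \<in> supported S" "f = fps_X ^ s * g" by blast
  then show "f \<in> supported ((+) s ` S)"
    by (auto simp: supported_def fps_X_power_mult_nth image_iff) (metis le_add_diff_inverse not_less)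
qed

lemma fps_truncation_nth:
  fixes f :: "'k::field fps"
  assumes "n < c"
  shows "(\<Sum>i<c. fps_const (f $ i) * fps_X ^ i) $ n = f $ n"
proof -
  have "(\<Sum>i<c. fps_const (f $ i) * fps_X ^ i) $ n = (\<Sum>i<c. if i = n then f $ n else 0)"
    unfolding fps_sum_nth by (intro sum.cong) auto
  then show ?thesis using assms by simp
qed

lemma supported_union_decomp:
  fixes f :: "'k::field fps"
  assumes "f \<in> supported (S \<union> T)"
  obtains g h where "f = g + h" "g \<in> supported S" "h \<in> supported (T :: nat set)"
proof -
  define g where "g = Abs_fps (\<lambda>n. if n \<in> S then f $ n else 0)"
  show thesis
  proof (rule that[of g "f - g"])
    show "g \<in> supported S" "f - g \<in> supported T"
      using assms by (auto simp: g_def supported_def)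
  qed simp
qed

lemma supported_mono: "S \<subseteq> T \<Longrightarrow> supported S \<subseteq> supported T"
  by (auto simp: supported_def)

lemma times_image_image: "(*) a ` (*) c ` J = (*) (a * c) ` (J :: 'k::field fps set)"
  by (auto simp: image_image mult.assoc)

lemma times_image_cancel:
  assumes "(*) q ` J = (*) q ` (J' :: 'k::field fps set)" "q \<noteq> 0"
  shows "J = J'"
  using assms inj_image_eq_iff[of "(*) q" J J'] by (simp add: inj_on_def)

lemma vals_times:
  fixes g :: "'k::field fps"
  assumes "g \<noteq> 0"
  shows "subdegree ` ((*) g ` J - {0}) = (+) (subdegree g) ` (subdegree ` (J - {0}))"
proof -
  have "(*) g ` J - {0} = (*) g ` (J - {0})" using assms by auto
  then show ?thesis using assms by (auto simp: image_image intro!: image_eqI)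
qed

context numerical_semigroup
begin

lemma vals_supported: "vals (supported S :: 'k::field fps set) = S"
proof (intro equalityI subsetI)
  fix n assume "n \<in> vals (supported S :: 'k fps set)"
  then obtain f :: "'k fps" where "f \<in> supported S" "f $ n \<noteq> 0" by (rule valsE)
  then show "n \<in> S" by (auto simp: supported_def)
next
  fix n assume "n \<in> S"
  then show "n \<in> vals (supported S :: 'k fps set)"
    by (intro valsI[of "fps_X ^ n"] supported_X_power) auto
qed

lemma contains_tail_times:
  fixes g :: "'k::field fps"
  assumes g: "g \<noteq> 0" and J: "contains_tail c J"
  shows "contains_tail (c + subdegree g) ((*) g ` J)"
  unfolding contains_tail_def
proof (intro allI impI)
  fix f :: "'k fps" assume f: "\<forall>n<c + subdegree g. f $ n = 0"
  show "f \<in> (*) g ` J"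
  proof (cases "f = 0")
    case True
    have "0 \<in> J" by (rule contains_tailD[OF J]) simp
    then show ?thesis using True by force
  next
    case False
    then have le: "c + subdegree g \<le> subdegree f" using f by (intro subdegree_geI) auto
    then have "g dvd f" unfolding fps_dvd_iff[OF g False] by (rule add_leD2)
    then obtain k where k: "f = g * k" by blast
    then have "k \<noteq> 0" using False by auto
    then have "c \<le> subdegree k" using le k g by simp
    then have "k \<in> J" by (intro contains_tailD[OF J] nth_less_subdegree_zero) simp
    then show ?thesis using k by blast
  qed
qed

text \<open>A linear functional on \<open>k[[t]]\<close> that vanishes on all series of order greater than \<open>N\<close> is
  \<open>f \<mapsto> [t\<^sup>N] (f g)\<close>, where the coefficients of \<open>g\<close> are its values at \<open>1, t, \<dots>, t\<^sup>N\<close>.\<close>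

lemma separating_coefficient:
  fixes I :: "'k::field fps set"
  assumes I: "Rmod I" and tail: "contains_tail (Suc N) I" and p: "p \<notin> I"
  obtains g where "\<And>f. f \<in> I \<Longrightarrow> (f * g) $ N = 0" "(p * g) $ N \<noteq> 0"
proof -
  interpret A: vector_space "\<lambda>c (f :: 'k fps). fps_const c * f"
    by unfold_locales (auto simp: algebra_simps simp flip: fps_const_add fps_const_mult)
  interpret K: vector_space "(*) :: 'k \<Rightarrow> 'k \<Rightarrow> 'k"
    by unfold_locales (auto simp: algebra_simps)
  interpret AK: vector_space_pair "\<lambda>c (f :: 'k fps). fps_const c * f" "(*) :: 'k \<Rightarrow> 'k \<Rightarrow> 'k" ..
  have sub: "A.subspace I"
    unfolding A.subspace_def using Rmod_zero[OF I] Rmod_add[OF I] Rmod_mult[OF I RH_const] by blast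
  obtain B where B: "B \<subseteq> I" "A.independent B" "I \<subseteq> A.span B"
    using A.maximal_independent_subset by blast
  have span: "A.span B = I" using A.span_minimal[OF B(1) sub] B(3) by blast
  have ind: "A.independent (insert p B)"
    using B(2) p span by (intro A.independent_insertI) auto
  obtain \<phi> where lin: "Vector_Spaces.linear (\<lambda>c f. fps_const c * f) (*) \<phi>"
    and \<phi>: "\<forall>x\<in>insert p B. \<phi> x = (if x = p then 1 else 0)"
    using AK.linear_independent_extend[OF ind, of "\<lambda>x. if x = p then 1 else 0"] by blast
  have \<phi>_add: "\<phi> (x + y) = \<phi> x + \<phi> y" and \<phi>_scale: "\<phi> (fps_const c * x) = c * \<phi> x" for x y c
    using AK.linear_add[OF lin] AK.linear_scale[OF lin] by blast+
  have \<phi>_I: "\<phi> x = 0" if "x \<in> I" for x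
  proof (rule AK.linear_eq_0_on_span[OF lin])
    show "x \<in> A.span B" using that span by simp
    show "\<phi> y = 0" if "y \<in> B" for y using \<phi> that B(1) p by auto
  qed
  have \<phi>_sum: "\<phi> (\<Sum>i\<in>A. F i) = (\<Sum>i\<in>A. \<phi> (F i))" for A :: "nat set" and F
    by (induction A rule: infinite_finite_induct) (use \<phi>_add \<phi>_I Rmod_zero[OF I] in auto)
  define g where "g = Abs_fps (\<lambda>j. \<phi> (fps_X ^ (N - j)))"
  have \<phi>_eq: "\<phi> f = (f * g) $ N" for f
  proof -
    let ?t = "\<Sum>i<Suc N. fps_const (f $ i) * fps_X ^ i"
    have "f - ?t \<in> I"
      by (rule contains_tailD[OF tail]) (simp only: fps_sub_nth fps_truncation_nth diff_self)
    then have "\<phi> (f - ?t) = 0" by (rule \<phi>_I)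
    then have "\<phi> f = \<phi> ?t" using \<phi>_add[of "f - ?t" ?t] by simp
    also have "\<dots> = (\<Sum>i=0..N. f $ i * g $ (N - i))"
      unfolding \<phi>_sum \<phi>_scale by (intro sum.cong) (auto simp: g_def)
    also have "\<dots> = (f * g) $ N" by (simp add: fps_mult_nth)
    finally show ?thesis .
  qed
  show thesis
  proof (rule that)
    show "(f * g) $ N = 0" if "f \<in> I" for f using \<phi>_I[OF that] \<phi>_eq by simp
    show "(p * g) $ N \<noteq> 0" using \<phi> \<phi>_eq[of p] by simp
  qed
qed

lemma colonI:
  fixes I :: "'k::field fps set"
  assumes I: "Rmod I" and tail: "contains_tail c I" and p: "\<And>h. h \<in> H \<Longrightarrow> 0 < h \<Longrightarrow> fps_X ^ h * p \<in> I"
  shows "p \<in> colon I"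
  unfolding colon_def
proof (intro CollectI ballI)
  fix x :: "'k fps" assume x: "x \<in> mH"
  let ?t = "\<Sum>i<c. fps_const (x $ i) * fps_X ^ i"
  have "((x - ?t) * p) $ n = 0" if "n < c" for n
    unfolding fps_mult_nth
  proof (rule sum.neutral, clarify)
    fix i assume "i \<in> {0..n}"
    then have "i < c" using that by simp
    then show "(x - ?t) $ i * p $ (n - i) = 0" by (simp only: fps_sub_nth fps_truncation_nth) simp
  qed
  then have "(x - ?t) * p \<in> I" by (intro contains_tailD[OF tail])
  moreover have "?t * p \<in> I"
    unfolding sum_distrib_right
  proof (rule Rmod_sum[OF I])
    fix i
    show "fps_const (x $ i) * fps_X ^ i * p \<in> I"
    proof (cases "x $ i = 0")
      case True
      then show ?thesis using Rmod_zero[OF I] by simp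
    next
      case False
      then have "i \<in> H" "0 < i" using x by (auto simp: mH_def supported_def intro: gr0I)
      then show ?thesis using Rmod_mult[OF I RH_const p] by (simp add: mult.assoc)
    qed
  qed
  ultimately have "(x - ?t) * p + ?t * p \<in> I" by (rule Rmod_add[OF I])
  then show "x * p \<in> I" by (simp flip: distrib_right)
qed

text \<open>Choose \<open>g\<close> such that \<open>[t\<^sup>N] (f g)\<close> vanishes for \<open>f \<in> I\<close> but not for some \<open>p0 \<in> I : m\<close>, and let
  \<open>J = {f. f g \<in> canon N}\<close>. This is an \<open>R\<close>-module that contains \<open>I\<close> but not \<open>p0\<close>. If it were larger than
  \<open>I\<close>, multiplying an element outside \<open>I\<close> by the largest possible power of \<open>t\<close> would give some
  \<open>p \<in> J\<close> in \<open>I : m\<close> and outside \<open>I\<close>; but then \<open>p0 \<in> I : m = I + k p \<subseteq> J\<close>.\<close>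

lemma type_one_is_canon_multiple:
  fixes I :: "'k::field fps set"
  assumes type: "CM_type_one R (ideal_mod R I)" and I: "Rmod I" "I \<subseteq> mH"
    and tail: "contains_tail (Suc N) I"
  obtains g where "I = {f. f * g \<in> canon N}" "g \<noteq> 0"
proof -
  obtain p0 where p0: "p0 \<in> colon I" "p0 \<notin> I" using CM_type_one_imp_colon(1)[OF type I] by blast
  obtain g where g: "\<And>f. f \<in> I \<Longrightarrow> (f * g) $ N = 0" "(p0 * g) $ N \<noteq> 0"
    using separating_coefficient[OF I(1) tail p0(2)] by blast
  define J where "J = {f. f * g \<in> canon N}"
  have J: "Rmod J"
    unfolding Rmod_def J_def
    using Rmod_zero[OF Rmod_canon] Rmod_add[OF Rmod_canon] Rmod_mult[OF Rmod_canon]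
    by (auto simp: distrib_right mult.assoc)
  have IJ: "I \<subseteq> J"
  proof
    fix f assume f: "f \<in> I"
    have "(f * g) $ (N - h) = 0" if "h \<in> H" "h \<le> N" for h
    proof -
      have "(fps_X ^ h * f * g) $ N = 0" using Rmod_mult[OF I(1) RH_X_power[OF that(1)] f] by (rule g(1))
      then show ?thesis using that(2) by (simp add: mult.assoc fps_X_power_mult_nth)
    qed
    then show "f \<in> J" by (simp add: J_def canon_def)
  qed
  have "J \<subseteq> I"
  proof (rule ccontr)
    assume "\<not> J \<subseteq> I"
    then obtain f where f: "f \<in> J" "f \<notin> I" by blast
    define D where "D = {h \<in> H. fps_X ^ h * f \<notin> I}"
    have "D \<subseteq> {..N}"
    proof
      fix h assume "h \<in> D"
      then have "fps_X ^ h * f \<notin> I" by (simp add: D_def)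
      then have "\<not> Suc N \<le> h"
        using contains_tailD[OF tail, of "fps_X ^ h * f"] by (auto simp: fps_X_power_mult_nth)
      then show "h \<in> {..N}" by simp
    qed
    then have "finite D" by (rule finite_subset) simp
    moreover have "0 \<in> D" using zero_in f(2) by (simp add: D_def)
    ultimately have Max: "Max D \<in> D" "\<And>h. h \<in> D \<Longrightarrow> h \<le> Max D" using Max_in by auto
    define p where "p = fps_X ^ Max D * f"
    have p: "p \<notin> I" "p \<in> J" using Max(1) Rmod_mult[OF J RH_X_power f(1)] by (auto simp: p_def D_def)
    have "p \<in> colon I"
    proof (rule colonI[OF I(1) tail])
      fix h assume h: "h \<in> H" "0 < h"
      have "h + Max D \<in> H" using h Max(1) add_in by (simp add: D_def)
      moreover have "h + Max D \<notin> D" using Max(2)[of "h + Max D"] h(2) by auto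
      ultimately have "fps_X ^ (h + Max D) * f \<in> I" by (simp add: D_def)
      then show "fps_X ^ h * p \<in> I" by (simp add: p_def power_add mult.assoc)
    qed
    then have "colon I \<subseteq> adjoin I p"
      using CM_type_one_imp_colon(2)[OF type I] p(1) by blast
    then obtain i c where "p0 = i + fps_const c * p" "i \<in> I" using p0(1) by blast
    then have "p0 \<in> J" using Rmod_add[OF J _ Rmod_mult[OF J RH_const p(2)]] IJ by blast
    then have "(p0 * g) $ (N - 0) = 0" using zero_in unfolding J_def canon_def by blast
    then show False using g(2) by simp
  qed
  then have "I = {f. f * g \<in> canon N}" using IJ unfolding J_def by blast
  moreover have "g \<noteq> 0" using g(2) by auto
  ultimately show thesis by (rule that)
qed

lemma colon_canon: "colon (canon N) \<subseteq> adjoin (canon N) (fps_X ^ N :: 'k::field fps)"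
  and X_power_colon_canon: "(fps_X :: 'k fps) ^ N \<in> colon (canon N)"
  and X_power_not_canon: "(fps_X :: 'k fps) ^ N \<notin> canon N"
proof -
  show "(fps_X :: 'k fps) ^ N \<notin> canon N" using zero_in by (auto simp: canon_def)
  show "(fps_X :: 'k fps) ^ N \<in> colon (canon N)"
    unfolding colon_def canon_def
  proof clarify
    fix x :: "'k fps" and h assume "x \<in> mH" "h \<le> N"
    then show "(x * fps_X ^ N) $ (N - h) = 0"
      by (cases "h = 0") (auto simp: fps_X_power_mult_right_nth mH_def)
  qed
  show "colon (canon N) \<subseteq> adjoin (canon N) (fps_X ^ N :: 'k fps)"
  proof
    fix q :: "'k fps" assume q: "q \<in> colon (canon N)"
    let ?i = "q - fps_const (q $ N) * fps_X ^ N"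
    have "?i $ (N - h) = 0" if h: "h \<in> H" "h \<le> N" for h
    proof (cases "h = 0")
      case False
      then have "fps_X ^ h \<in> (mH :: 'k fps set)" using RH_X_power[OF h(1)] by (simp add: mH_def)
      then have "fps_X ^ h * q \<in> canon N" using q by (simp add: colon_def)
      then have "(fps_X ^ h * q) $ (N - 0) = 0" using zero_in unfolding canon_def by blast
      then show ?thesis using h(2) False by (simp add: fps_X_power_mult_nth)
    qed simp
    then have "?i \<in> canon N" by (simp add: canon_def)
    moreover have "q = ?i + fps_const (q $ N) * fps_X ^ N" by simp
    ultimately show "q \<in> adjoin (canon N) (fps_X ^ N)"
      by (intro CollectI exI conjI)
  qed
qed

lemma ideal_prod_principal:
  fixes J :: "'k::field fps set"
  assumes J: "Rmod J"
  shows "(PIdl\<^bsub>R\<^esub> a) \<cdot>\<^bsub>R\<^esub> J = (*) a ` J"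
proof (intro equalityI subsetI)
  fix x assume "x \<in> (PIdl\<^bsub>R\<^esub> a) \<cdot>\<^bsub>R\<^esub> J"
  then show "x \<in> (*) a ` J"
  proof induction
    case (prod i j)
    then obtain r where r: "r \<in> RH" "i = r * a" by (auto simp: cgenideal_def)
    then have "i * j = a * (r * j)" by (simp add: ac_simps)
    then show ?case using Rmod_mult[OF J r(1) prod(2)] by auto
  next
    case (sum x y)
    then show ?case using Rmod_add[OF Rmod_times[OF J]] by simp
  qed
next
  fix x assume "x \<in> (*) a ` J"
  then obtain j where j: "j \<in> J" "x = a * j" by blast
  have "1 * a \<in> PIdl\<^bsub>R\<^esub> a" using RH_one by (auto simp: cgenideal_def)
  then have "(1 * a) \<otimes>\<^bsub>R\<^esub> j \<in> (PIdl\<^bsub>R\<^esub> a) \<cdot>\<^bsub>R\<^esub> J" using j(1) by (intro ideal_prod.prod)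
  then show "x \<in> (PIdl\<^bsub>R\<^esub> a) \<cdot>\<^bsub>R\<^esub> J" using j(2) by simp
qed

end

section \<open>Semigroups of type two\<close>

text \<open>The pseudo-Frobenius numbers are \<open>F\<close> and \<open>F - b\<close>.\<close>

locale type_two_semigroup = numerical_semigroup +
  fixes F b :: nat
  assumes F_gap: "F \<notin> H" and b_gap: "b \<notin> H" and F_minus_b_gap: "F - b \<notin> H" and b_le_F: "b \<le> F"
    and below_pseudo_frobenius: "y \<notin> H \<Longrightarrow> \<exists>h\<in>H. y + h = F \<or> y + h + b = F"
begin

lemma above_F: "F < n \<Longrightarrow> n \<in> H"
  using below_pseudo_frobenius[of n] by fastforce

text \<open>The exponents of the canonical module.\<close>

definition K :: "nat set" where "K = H \<union> (+) b ` H"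

text \<open>The exponents of \<open>K M\<close>, where \<open>T\<close> is the set of exponents of a monomial \<open>R\<close>-module \<open>M\<close>.\<close>

abbreviation shift_join :: "nat set \<Rightarrow> nat set" where "shift_join T \<equiv> T \<union> (+) b ` T"

lemma F_notin_add: "h \<in> H \<Longrightarrow> k \<in> K \<Longrightarrow> k + h \<noteq> F"
proof
  assume h: "h \<in> H" and k: "k \<in> K" and eq: "k + h = F"
  show False
  proof (cases "k \<in> H")
    case True
    then show False using add_in[OF True h] eq F_gap by simp
  next
    case False
    then obtain g where g: "g \<in> H" "k = b + g" using k by (auto simp: K_def)
    then have "g + h = F - b" using eq by simp
    then show False using add_in[OF g(1) h] F_minus_b_gap by simp
  qed
qed

text \<open>A gap \<open>N - n\<close> of \<open>H\<close> lies below \<open>F\<close> or \<open>F - b\<close>, which writes \<open>n - (N - F)\<close> as \<open>h\<close> or \<open>b + h\<close>.\<close>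

lemma canon_exponents:
  assumes "F \<le> N"
  shows "{n. \<not> (\<exists>h\<in>H. n + h = N)} = (+) (N - F) ` K"
proof (intro equalityI subsetI)
  fix n assume n: "n \<in> {n. \<not> (\<exists>h\<in>H. n + h = N)}"
  show "n \<in> (+) (N - F) ` K"
  proof (cases "n \<le> N")
    case False
    then have "n - (N - F) \<in> H" using assms by (intro above_F) linarith
    moreover have "n = (N - F) + (n - (N - F))" using False assms by linarith
    ultimately show ?thesis unfolding K_def by blast
  next
    case True
    then have "N - n \<notin> H" using n by auto
    then obtain h where h: "h \<in> H" "N - n + h = F \<or> N - n + h + b = F"
      using below_pseudo_frobenius by blast
    have "b + h \<in> K" "h \<in> K" using h(1) by (auto simp: K_def)
    moreover have "n = (N - F) + h \<or> n = (N - F) + (b + h)" using h(2) True assms by linarith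
    ultimately show ?thesis by blast
  qed
next
  fix n assume "n \<in> (+) (N - F) ` K"
  then obtain k where k: "k \<in> K" "n = (N - F) + k" by blast
  have "n + h \<noteq> N" if "h \<in> H" for h
    using F_notin_add[OF that k(1)] k(2) assms by linarith
  then show "n \<in> {n. \<not> (\<exists>h\<in>H. n + h = N)}" by blast
qed

lemma canon_eq_times: "F \<le> N \<Longrightarrow> canon N = (*) (fps_X ^ (N - F)) ` supported K"
  unfolding canon_eq_supported by (simp only: canon_exponents supported_shift)

lemma apery_le_canon: "F \<le> N \<Longrightarrow> r < e \<Longrightarrow> apery r \<le> N + e"
proof (rule ccontr)
  assume "F \<le> N" "r < e" "\<not> apery r \<le> N + e"
  then show False using apery_minus_multiple[of r 1] above_F[of "apery r - e"] by simp
qed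

definition H_stable :: "nat set \<Rightarrow> bool" where
  "H_stable T \<longleftrightarrow> (\<forall>h\<in>H. \<forall>t\<in>T. h + t \<in> T)"

lemma Rmod_H_stable: "H_stable T \<Longrightarrow> Rmod (supported T)"
  unfolding H_stable_def by (intro Rmod_supported) blast

lemma H_stable_K: "H_stable K"
  unfolding K_def H_stable_def using add_in by (auto simp: image_iff)

lemma H_stable_shift_join: "H_stable T \<Longrightarrow> H_stable (shift_join T)"
  unfolding H_stable_def by (auto simp: image_iff)

text \<open>An instance of \<open>K : K = R\<close>: both \<open>h + b\<close> and \<open>h + 2b\<close> in \<open>K\<close> would make \<open>t\<^bsup>h + b\<^esup>\<close> an element of \<open>R\<close>.\<close>

lemma b_plus_notin_H:
  assumes "h \<in> H" "h + b \<notin> H"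
  shows "2 * b + h \<notin> K"
proof
  assume k: "2 * b + h \<in> K"
  obtain g where g: "g \<in> H" "h + b + g = F \<or> h + b + g + b = F"
    using below_pseudo_frobenius[OF assms(2)] by blast
  from g(2) show False
  proof
    assume "h + b + g = F"
    then have "F - b = h + g" by simp
    then show False using F_minus_b_gap add_in[OF assms(1) g(1)] by simp
  next
    assume "h + b + g + b = F"
    then show False using F_notin_add[OF g(1) k] by simp
  qed
qed

lemma shift_join_minus_K: "shift_join K - K = (+) (2 * b) ` {h \<in> H. h + b \<notin> H}"
proof (intro equalityI subsetI)
  fix x assume x: "x \<in> shift_join K - K"
  then obtain k where k: "k \<in> K" "x = b + k" by blast
  have "k \<notin> H" using x k(2) by (auto simp: K_def)
  then obtain h where h: "h \<in> H" "k = b + h" using k(1) by (auto simp: K_def)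
  have "h + b \<notin> H"
  proof
    assume "h + b \<in> H"
    then have "k \<in> H" using h(2) by (simp add: add.commute)
    then show False using \<open>k \<notin> H\<close> by contradiction
  qed
  then show "x \<in> (+) (2 * b) ` {h \<in> H. h + b \<notin> H}"
    using h k(2) by (intro image_eqI[of _ _ h]) auto
next
  fix x assume "x \<in> (+) (2 * b) ` {h \<in> H. h + b \<notin> H}"
  then obtain h where h: "h \<in> H" "h + b \<notin> H" "x = 2 * b + h" by blast
  have "b + h \<in> K" using h(1) by (auto simp: K_def)
  moreover have "x = b + (b + h)" using h(3) by simp
  ultimately have "x \<in> shift_join K" by blast
  then show "x \<in> shift_join K - K" using b_plus_notin_H[OF h(1,2)] unfolding h(3) by (rule DiffI)
qed

lemma card_shift_join: "card (shift_join K - K) = card {h \<in> H. h + b \<notin> H}"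
  unfolding shift_join_minus_K by (intro card_image) (simp add: inj_on_def)

lemma three_b_iff: "3 * b \<in> shift_join K \<longleftrightarrow> 3 * b \<in> H"
proof
  have "0 + b \<notin> H" using b_gap by simp
  then have two: "2 * b + 0 \<notin> K" using b_plus_notin_H[OF zero_in] by blast
  assume "3 * b \<in> shift_join K"
  then consider "3 * b \<in> H" | h where "h \<in> H" "3 * b = b + h"
    | h where "h \<in> H" "3 * b = b + (b + h)"
    by (auto simp: K_def)
  then show "3 * b \<in> H"
  proof cases
    case 2
    then have "2 * b \<in> H" by (metis add_left_cancel numeral_3_eq_3 mult_Suc numeral_2_eq_2)
    then show ?thesis using two by (simp add: K_def)
  next
    case 3
    then have "h = b" by simp
    then show ?thesis using 3(1) b_gap by simp
  qed
qed (simp add: K_def)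

lemma shift_join_stable:
  assumes "3 * b \<in> H"
  shows "shift_join (shift_join K) = shift_join K"
proof -
  have "b + (b + k) \<in> shift_join K" if k: "k \<in> K" for k
  proof (cases "k \<in> H")
    case True
    then have "b + k \<in> K" by (auto simp: K_def)
    then show ?thesis by blast
  next
    case False
    then obtain h where h: "h \<in> H" "k = b + h" using k by (auto simp: K_def)
    have eq: "b + (b + k) = 3 * b + h" using h(2) by simp
    have "b + (b + k) \<in> H" unfolding eq by (rule add_in[OF assms h(1)])
    then show ?thesis unfolding K_def by blast
  qed
  then show ?thesis by blast
qed

lemma K_add_stable:
  assumes T: "H_stable T" and x: "x \<in> K" and y: "y \<in> T"
  shows "x + y \<in> shift_join T"
proof -
  from x consider "x \<in> H" | h where "h \<in> H" "x = b + h" by (auto simp: K_def)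
  then show ?thesis
  proof cases
    case 1
    then show ?thesis using T y by (auto simp: H_stable_def)
  next
    case 2
    have "h + y \<in> T" using T y 2(1) by (auto simp: H_stable_def)
    then show ?thesis using 2(2) by (auto simp: add.assoc)
  qed
qed

lemma ideal_prod_supported:
  fixes q q' :: "'k::field fps"
  assumes T: "H_stable T"
  shows "((*) q ` supported K) \<cdot>\<^bsub>R\<^esub> ((*) q' ` supported T) = (*) (q * q') ` supported (shift_join T)"
proof (intro equalityI subsetI)
  have RT: "Rmod (supported (shift_join T) :: 'k fps set)"
    by (intro Rmod_H_stable H_stable_shift_join T)
  fix x assume "x \<in> ((*) q ` supported K) \<cdot>\<^bsub>R\<^esub> ((*) q' ` supported T)"
  then show "x \<in> (*) (q * q') ` supported (shift_join T)"
  proof induction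
    case (prod i j)
    then obtain f g where fg: "f \<in> supported K" "g \<in> supported T" "i = q * f" "j = q' * g" by blast
    have "f * g \<in> supported (shift_join T)"
      using fg(1,2)
      by (rule supported_mult) (rule K_add_stable[OF T])
    moreover have "i * j = (q * q') * (f * g)" using fg by (simp add: ac_simps)
    ultimately show ?case by auto
  next
    case (sum x y)
    then show ?case using Rmod_add[OF Rmod_times[OF RT]] by simp
  qed
next
  fix x assume "x \<in> (*) (q * q') ` supported (shift_join T)"
  then obtain f where f: "f \<in> supported (shift_join T)" "x = q * q' * f" by blast
  obtain g h where gh: "f = g + h" "g \<in> supported T" "h \<in> supported ((+) b ` T)"
    using supported_union_decomp[OF f(1)] by blast
  obtain h' where h': "h' \<in> supported T" "h = fps_X ^ b * h'" using gh(3) unfolding supported_shift by blast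
  have "(fps_X :: 'k fps) ^ 0 \<in> supported K" "(fps_X :: 'k fps) ^ b \<in> supported K"
    using zero_in by (intro supported_X_power; force simp: K_def)+
  then have "(q * fps_X ^ 0) \<otimes>\<^bsub>R\<^esub> (q' * g) \<oplus>\<^bsub>R\<^esub> (q * fps_X ^ b) \<otimes>\<^bsub>R\<^esub> (q' * h') \<in>
      ((*) q ` supported K) \<cdot>\<^bsub>R\<^esub> ((*) q' ` supported T)"
    using gh(2) h'(1) by (intro ideal_prod.sum ideal_prod.prod) auto
  also have "(q * fps_X ^ 0) \<otimes>\<^bsub>R\<^esub> (q' * g) \<oplus>\<^bsub>R\<^esub> (q * fps_X ^ b) \<otimes>\<^bsub>R\<^esub> (q' * h') = x"
    using f(2) gh(1) h'(2) by (simp add: algebra_simps)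
  finally show "x \<in> ((*) q ` supported K) \<cdot>\<^bsub>R\<^esub> ((*) q' ` supported T)" .
qed

lemma contains_tail_RH: "contains_tail (Suc F) (RH :: 'k::field fps set)"
  unfolding contains_tail_def supported_def
proof clarify
  fix f :: "'k fps" and n assume "\<forall>n<Suc F. f $ n = 0" "n \<notin> H"
  then show "f $ n = 0" using above_F[of n] by (meson not_less_eq)
qed

lemma contains_tail_K: "contains_tail (Suc F) (supported K)"
  by (rule contains_tail_mono[OF contains_tail_RH supported_mono]) (simp add: K_def)

text \<open>By type one, \<open>I = {f. f g \<in> t\<^bsup>N - F\<^esup> K}\<close>. If the order of \<open>g\<close> were greater than \<open>N - F\<close>, then \<open>I\<close>
  would contain a series of order \<open>F\<close>, which is impossible inside \<open>R\<close>. So \<open>g\<close> divides \<open>t\<^bsup>N - F\<^esup>\<close>.\<close>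

lemma canonical_ideal_eq_times:
  fixes I :: "'k::field fps set"
  assumes "canonical_ideal R I"
  obtains q where "q \<noteq> 0" "I = (*) q ` supported K"
proof -
  have I: "Rmod I" "I \<subseteq> RH" "I \<noteq> RH" and type: "CM_type_one R (ideal_mod R I)"
    and ne: "I \<noteq> {0}"
    using assms unfolding canonical_ideal_def canonical_mod_def maximal_CM_mod_def ideal_R_iff by simp_all
  have "I \<subseteq> mH"
  proof
    fix f assume f: "f \<in> I"
    have "f $ 0 = 0"
    proof (rule ccontr)
      assume f0: "f $ 0 \<noteq> 0"
      have fR: "f \<in> RH" using f I(2) by blast
      have "r \<in> I" if "r \<in> RH" for r
      proof -
        have "(r * inverse f) * f \<in> I"
          using f by (intro Rmod_mult[OF I(1)] RH_mult that RH_inverse[OF fR f0])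
        then show ?thesis using inverse_mult_eq_1[OF f0] by (simp add: mult.assoc)
      qed
      then show False using I(2,3) by blast
    qed
    then show "f \<in> mH" using f I(2) by (auto simp: mH_def)
  qed
  obtain f where f: "f \<in> I" "f \<noteq> 0" using ne Rmod_zero[OF I(1)] by blast
  have "contains_tail (Suc F + subdegree f) ((*) f ` RH)"
    by (rule contains_tail_times[OF f(2) contains_tail_RH])
  moreover have "(*) f ` RH \<subseteq> I" using Rmod_mult[OF I(1) _ f(1)] by (auto simp: mult.commute)
  ultimately have tail: "contains_tail (Suc (F + subdegree f)) I"
    using contains_tail_mono by simp
  define N where "N = F + subdegree f"
  obtain g where g: "I = {f. f * g \<in> canon N}" "g \<noteq> 0"
    using type_one_is_canon_multiple[OF type I(1) \<open>I \<subseteq> mH\<close> tail] unfolding N_def by blast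
  define d where "d = subdegree g"
  define v where "v = fps_shift d g"
  have gv: "g = v * fps_X ^ d" unfolding v_def d_def by (rule subdegree_decompose)
  have v0: "v $ 0 \<noteq> 0" using g(2) by (simp add: v_def d_def)
  have vv: "inverse v * v = 1" using v0 by (rule inverse_mult_eq_1)
  have "d \<le> N - F"
  proof (rule ccontr)
    assume "\<not> d \<le> N - F"
    then have lt: "N < F + d" by linarith
    have "inverse v * fps_X ^ F * g = fps_X ^ (F + d) * (inverse v * v)"
      unfolding gv by (simp add: power_add ac_simps)
    then have "inverse v * fps_X ^ F * g = fps_X ^ (F + d)" unfolding vv by simp
    moreover have "fps_X ^ (F + d) \<in> canon N" using lt by (auto simp: canon_def)
    ultimately have "inverse v * fps_X ^ F \<in> RH" using g(1) I(2) by auto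
    then have "(inverse v * fps_X ^ F) $ F = 0" using F_gap by (simp add: supported_def)
    then show False using v0 by (simp add: fps_X_power_mult_right_nth)
  qed
  then obtain s where s: "N - F = d + s" using le_Suc_ex by blast
  have "F \<le> N" by (simp add: N_def)
  define q where "q = inverse v * fps_X ^ s"
  have "q \<noteq> 0" unfolding q_def using v0 by auto
  moreover have "I = (*) q ` supported K"
  proof (intro equalityI subsetI)
    fix f assume "f \<in> I"
    then obtain k where k: "k \<in> supported K" "f * g = fps_X ^ (d + s) * k"
      using g(1) canon_eq_times[OF \<open>F \<le> N\<close>] s by auto
    have "fps_X ^ d * (f * v) = fps_X ^ d * (fps_X ^ s * k)"
      using k(2) unfolding gv by (simp add: power_add ac_simps)
    then have "f * v = fps_X ^ s * k" by simp
    then have "f * (inverse v * v) = q * k" unfolding q_def by (simp add: ac_simps)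
    then have "f = q * k" unfolding vv by simp
    then show "f \<in> (*) q ` supported K" using k(1) by blast
  next
    fix f assume "f \<in> (*) q ` supported K"
    then obtain k where k: "k \<in> supported K" "f = q * k" by blast
    have "f * g = fps_X ^ (d + s) * (inverse v * v * k)"
      unfolding k(2) q_def gv by (simp add: power_add ac_simps)
    then have "f * g = fps_X ^ (N - F) * k" unfolding vv s by simp
    then show "f \<in> I" using g(1) canon_eq_times[OF \<open>F \<le> N\<close>] k(1) by auto
  qed
  ultimately show thesis by (rule that)
qed

lemma vals_times_supported:
  fixes q :: "'k::field fps"
  shows "q \<noteq> 0 \<Longrightarrow> vals ((*) q ` supported S) = (+) (subdegree q) ` S"
  using vals_times[of q "supported S"] vals_supported[of S, where 'k = 'k] unfolding vals_def by simp

text \<open>Multiplication by a series shifts all orders alike, and \<open>x\<close> has order \<open>0\<close>. So the length of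
  \<open>q\<^sup>2K\<^sup>2/q x q K\<close> is the number of exponents of \<open>K\<^sup>2\<close> outside \<open>K\<close>.\<close>

lemma quot_length_square:
  fixes q x :: "'k::field fps"
  assumes q: "q \<noteq> 0" and sub: "(*) q ` supported K \<subseteq> RH" and x: "x \<in> supported K" "x $ 0 \<noteq> 0"
  shows "quot_length R (regular_mod R) ((*) (q * q) ` supported (shift_join K))
      ((*) (q * x) ` (*) q ` supported K) = enat (card {h \<in> H. h + b \<notin> H})"
proof -
  have x': "x \<noteq> 0" "subdegree x = 0" using x(2) by auto
  have L: "Rmod ((*) (q * x) ` (*) q ` supported K)"
    by (intro Rmod_times Rmod_H_stable H_stable_K)
  have N: "Rmod ((*) (q * q) ` supported (shift_join K) :: 'k fps set)"
    by (intro Rmod_times Rmod_H_stable H_stable_shift_join H_stable_K)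
  have KK: "x * k \<in> supported (shift_join K)" if k: "k \<in> supported K" for k :: "'k fps"
    using x(1) k by (rule supported_mult) (rule K_add_stable[OF H_stable_K])
  have LN: "(*) (q * x) ` (*) q ` supported K \<subseteq> (*) (q * q) ` supported (shift_join K)"
  proof
    fix f assume "f \<in> (*) (q * x) ` (*) q ` supported K"
    then obtain k where k: "k \<in> supported K" "f = q * x * (q * k)" by blast
    then have "f = q * q * (x * k)" by (simp add: ac_simps)
    then show "f \<in> (*) (q * q) ` supported (shift_join K)" using KK[OF k(1)] by blast
  qed
  have I: "ideal ((*) q ` supported K) R"
    unfolding ideal_R_iff using sub by (intro conjI Rmod_times Rmod_H_stable H_stable_K)
  have NR: "(*) (q * q) ` supported (shift_join K) \<subseteq> RH"
    using ring.ideal_prod_in_carrier[OF cring.axioms(1)[OF cring_R] I I]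
    unfolding ideal_prod_supported[OF H_stable_K] by simp
  have "contains_tail (Suc F + subdegree q + subdegree (q * x)) ((*) (q * x) ` (*) q ` supported K)"
    using q x' by (intro contains_tail_times contains_tail_K) auto
  then have "quot_length R (regular_mod R) ((*) (q * q) ` supported (shift_join K))
      ((*) (q * x) ` (*) q ` supported K) =
      enat (card (vals ((*) (q * q) ` supported (shift_join K)) - vals ((*) (q * x) ` (*) q ` supported K)))"
    by (rule quot_length_eq_card_vals[OF L N NR LN])
  also have "vals ((*) (q * x) ` (*) q ` supported K) = (+) (subdegree (q * q)) ` K"
    unfolding times_image_image using q x' by (simp add: vals_times_supported)
  also have "vals ((*) (q * q) ` supported (shift_join K) :: 'k fps set) = (+) (subdegree (q * q)) ` shift_join K"
    using q by (intro vals_times_supported) simp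
  also have "(+) (subdegree (q * q)) ` shift_join K - (+) (subdegree (q * q)) ` K =
      (+) (subdegree (q * q)) ` (shift_join K - K)"
    by auto
  also have "card \<dots> = card (shift_join K - K)"
    by (intro card_image) (simp add: inj_on_def)
  finally show ?thesis unfolding card_shift_join .
qed

text \<open>Cancelling \<open>q\<^sup>3\<close> gives \<open>K\<^sup>3 = x K\<^sup>2\<close>. From \<open>1 \<in> K\<^sup>3\<close> it follows that \<open>x\<close> has order \<open>0\<close>, and
  then from \<open>t\<^bsup>3b\<^esup> \<in> x K\<^sup>2\<close> that \<open>3b\<close> is an exponent of \<open>K\<^sup>2\<close>.\<close>

lemma Goto_ring_imp:
  assumes "Goto_ring n (R :: 'k::field fps ring)"
  shows "3 * b \<in> H" "n = card {h \<in> H. h + b \<notin> H}"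
proof -
  obtain I a where I: "canonical_ideal (R :: 'k fps ring) I" and a: "a \<in> I"
    and cube: "I \<cdot>\<^bsub>R\<^esub> (I \<cdot>\<^bsub>R\<^esub> I) = (PIdl\<^bsub>R\<^esub> a) \<cdot>\<^bsub>R\<^esub> (I \<cdot>\<^bsub>R\<^esub> I)"
    and len: "quot_length R (regular_mod R) (I \<cdot>\<^bsub>R\<^esub> I) ((PIdl\<^bsub>R\<^esub> a) \<cdot>\<^bsub>R\<^esub> I) = enat n"
    using assms unfolding Goto_ring_def by blast
  obtain q where q: "q \<noteq> 0" "I = (*) q ` supported K" using canonical_ideal_eq_times[OF I] .
  have sub: "(*) q ` supported K \<subseteq> RH"
    using I unfolding q(2) canonical_ideal_def ideal_R_iff by blast
  obtain x where x: "x \<in> supported K" "a = q * x" using a q(2) by blast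
  let ?K2 = "shift_join K" and ?K3 = "shift_join (shift_join K)"
  note K2 = H_stable_shift_join[OF H_stable_K]
  have II: "I \<cdot>\<^bsub>R\<^esub> I = (*) (q * q) ` supported ?K2"
    unfolding q(2) by (rule ideal_prod_supported[OF H_stable_K])
  have "I \<cdot>\<^bsub>R\<^esub> (I \<cdot>\<^bsub>R\<^esub> I) = (*) (q * (q * q)) ` supported ?K3"
    unfolding II unfolding q(2) by (rule ideal_prod_supported[OF K2])
  moreover have "(PIdl\<^bsub>R\<^esub> a) \<cdot>\<^bsub>R\<^esub> (I \<cdot>\<^bsub>R\<^esub> I) = (*) (q * (q * q)) ` (*) x ` supported ?K2"
    unfolding II x(2) ideal_prod_principal[OF Rmod_times[OF Rmod_H_stable[OF K2]]] times_image_image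
    by (simp add: ac_simps)
  ultimately have "(*) (q * (q * q)) ` (supported ?K3 :: 'k fps set) = (*) (q * (q * q)) ` (*) x ` supported ?K2"
    using cube by simp
  then have K3: "supported ?K3 = (*) x ` supported ?K2"
    by (rule times_image_cancel) (use q(1) in simp)
  have "0 \<in> ?K3" using zero_in by (simp add: K_def)
  then have "(fps_X :: 'k fps) ^ 0 \<in> supported ?K3" by (rule supported_X_power)
  then obtain f where f: "1 = x * f" unfolding K3 by auto
  then have x0: "x $ 0 \<noteq> 0" by (metis fps_mult_nth_0 fps_one_nth mult_zero_left zero_neq_one)
  have "b + (b + (b + 0)) \<in> ?K3" using zero_in unfolding K_def by blast
  then have "(fps_X :: 'k fps) ^ (b + (b + (b + 0))) \<in> supported ?K3" by (rule supported_X_power)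
  then obtain g where g: "g \<in> supported ?K2" "fps_X ^ (3 * b) = x * g"
    unfolding K3 by (auto simp: numeral_3_eq_3)
  have "inverse x * fps_X ^ (3 * b) = inverse x * x * g" unfolding g(2) by (simp add: mult.assoc)
  then have "g = inverse x * fps_X ^ (3 * b)" using inverse_mult_eq_1[OF x0] by simp
  then have "g $ (3 * b) \<noteq> 0" using x0 by (simp add: fps_X_power_mult_right_nth)
  then have "3 * b \<in> ?K2" using g(1) by (auto simp: supported_def)
  then show "3 * b \<in> H" using three_b_iff by blast
  have "(PIdl\<^bsub>R\<^esub> a) \<cdot>\<^bsub>R\<^esub> I = (*) (q * x) ` (*) q ` supported K"
    unfolding q(2) x(2) by (rule ideal_prod_principal[OF Rmod_times[OF Rmod_H_stable[OF H_stable_K]]])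
  then have "enat n = enat (card {h \<in> H. h + b \<notin> H})"
    using len quot_length_square[OF q(1) sub x(1) x0] unfolding II by simp
  then show "n = card {h \<in> H. h + b \<notin> H}" by simp
qed

text \<open>The factor \<open>t\<^bsup>F + 1\<^esup>\<close> moves \<open>K\<close> into \<open>R\<close>; it corresponds to \<open>canon N\<close> for \<open>N = 2F + 1\<close>.\<close>

lemma canonical_ideal_times:
  shows "canonical_ideal (R :: 'k::field fps ring) ((*) (fps_X ^ Suc F) ` supported K)"
proof -
  let ?N = "2 * F + 1"
  let ?I = "(*) (fps_X ^ Suc F) ` supported K :: 'k fps set"
  have N: "F \<le> ?N" "?N - F = Suc F" by simp_all
  have canon: "canon ?N = ?I" using canon_eq_times[OF N(1)] unfolding N(2) .
  have I: "Rmod ?I" by (intro Rmod_times Rmod_H_stable H_stable_K)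
  have "?I \<subseteq> mH"
  proof
    fix f assume "f \<in> ?I"
    then obtain k where k: "f = fps_X ^ Suc F * k" by blast
    have "f $ n = 0" if "n \<le> F" for n
      unfolding k using that by (simp add: fps_X_power_mult_nth del: power_Suc)
    then have "f $ n = 0" if "n \<notin> H" for n using above_F[of n] that by (metis not_less)
    moreover have "f $ 0 = 0" using \<open>\<And>n. n \<le> F \<Longrightarrow> f $ n = 0\<close> by simp
    ultimately show "f \<in> mH" by (simp add: mH_def supported_def)
  qed
  then have I_RH: "?I \<subseteq> RH" "1 \<notin> ?I" by (auto simp: mH_def)
  have ideal: "ideal ?I R" unfolding ideal_R_iff using I I_RH(1) by blast
  obtain c d where res: "free_resolution_of R (residue_field_mod (R :: 'k fps ring)) c d"
    using residue_resolution_exists by blast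
  have type: "CM_type_one R (ideal_mod R ?I)"
    using CM_type_one_if_colon[OF res I[folded canon] \<open>?I \<subseteq> mH\<close>[folded canon]
        X_power_colon_canon X_power_not_canon colon_canon] unfolding canon .
  have inj: "finite_injective_dimension R (ideal_mod R ?I)"
    unfolding canon[symmetric]
    by (rule finite_injective_dimension_canon) (rule apery_le_canon[OF N(1)])
  have X_in: "fps_X ^ Suc F \<in> ?I"
    using supported_X_power[of 0 K, where 'k = 'k] zero_in by (intro image_eqI[of _ _ 1]) (auto simp: K_def)
  have fg: "finitely_generated_mod R (ideal_mod R ?I)"
    unfolding finitely_generated_mod_def
  proof (intro exI bexI)
    let ?p = "\<lambda>x\<in>Rn 2. fps_X ^ Suc F * (x 0 + fps_X ^ b * x (1::nat)) :: 'k fps"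
    have in_I: "fps_X ^ Suc F * (f + fps_X ^ b * g) \<in> ?I" if "f \<in> RH" "g \<in> RH" for f g
    proof -
      have "fps_X ^ b * g \<in> supported ((+) b ` H)" unfolding supported_shift using that(2) by blast
      then have "f + fps_X ^ b * g \<in> supported K"
        using that(1) supported_mono[of H K] supported_mono[of "(+) b ` H" K]
        by (intro supported_add) (auto simp: K_def)
      then show ?thesis by blast
    qed
    show p: "?p \<in> mod_homs R (free_mod R 2) (ideal_mod R ?I)"
      unfolding Homs_def[symmetric]
    proof (rule HomsI)
      show "fps_X ^ Suc F * (x 0 + fps_X ^ b * x 1) \<in> ?I" if "x \<in> Rn 2" for x
        using Rn_nth[OF that] by (intro in_I) auto
    qed (simp_all add: algebra_simps)
    show "?p ` Rn 2 = carrier (ideal_mod R ?I)"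
    proof (intro equalityI subsetI)
      fix f assume "f \<in> ?p ` Rn 2"
      then obtain x where x: "f = ?p x" "x \<in> Rn 2" by blast
      have "?p x \<in> ?I" using p[folded Homs_def] x(2) by (rule HomsD(1))
      then show "f \<in> carrier (ideal_mod R ?I)" unfolding x(1) ideal_mod_simps .
    next
      fix f assume "f \<in> carrier (ideal_mod R ?I)"
      then obtain k where k: "k \<in> supported (H \<union> (+) b ` H)" "f = fps_X ^ Suc F * k"
        by (auto simp: K_def)
      obtain g h where gh: "k = g + h" "g \<in> RH" "h \<in> supported ((+) b ` H)"
        using supported_union_decomp[OF k(1)] by blast
      obtain h' where h': "h' \<in> RH" "h = fps_X ^ b * h'" using gh(3) unfolding supported_shift by blast
      let ?x = "\<lambda>i\<in>{..<2::nat}. if i = 0 then g else h'"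
      have x: "?x \<in> Rn 2" using gh(2) h'(1) by (auto simp: carrier_free_mod)
      have "f = ?p ?x" using x k(2) gh(1) h'(2) by simp
      then show "f \<in> ?p ` Rn 2" using x by (rule image_eqI)
    qed
  qed
  have "maximal_CM_mod R (ideal_mod R ?I)"
    unfolding maximal_CM_mod_def
  proof (intro conjI module_ideal_mod[OF ideal] fg)
    show "carrier (ideal_mod R ?I) \<noteq> {\<zero>\<^bsub>ideal_mod R ?I\<^esub>}"
    proof
      assume "carrier (ideal_mod R ?I) = {\<zero>\<^bsub>ideal_mod R ?I\<^esub>}"
      then have "?I = {0}" by simp
      then have "fps_X ^ Suc F = (0 :: 'k fps)" using X_in by blast
      then show False by simp
    qed
    show "\<exists>x\<in>carrier R - Units R. \<forall>c\<in>carrier (ideal_mod R ?I).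
        x \<odot>\<^bsub>ideal_mod R ?I\<^esub> c = \<zero>\<^bsub>ideal_mod R ?I\<^esub> \<longrightarrow> c = \<zero>\<^bsub>ideal_mod R ?I\<^esub>"
      unfolding nonunits_R using X_power_e by (intro bexI[of _ "fps_X ^ e"]) auto
  qed
  then have "canonical_mod R (ideal_mod R ?I)" unfolding canonical_mod_def using type inj by blast
  moreover have "?I \<noteq> carrier R" using I_RH(2) RH_one by auto
  ultimately show ?thesis unfolding canonical_ideal_def using ideal by blast
qed

lemma Goto_ring_if:
  assumes "3 * b \<in> H"
  shows "Goto_ring (card {h \<in> H. h + b \<notin> H}) (R :: 'k::field fps ring)"
proof -
  let ?q = "fps_X ^ Suc F :: 'k fps"
  let ?I = "(*) ?q ` supported K"
  have q: "?q \<noteq> 0" by simp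
  have can: "canonical_ideal R ?I" by (rule canonical_ideal_times)
  have sub: "?I \<subseteq> RH" using can unfolding canonical_ideal_def ideal_R_iff by blast
  have "(fps_X :: 'k fps) ^ 0 \<in> supported K" using zero_in by (intro supported_X_power) (simp add: K_def)
  then have one: "(1 :: 'k fps) \<in> supported K" by simp
  then have qI: "?q \<in> ?I" by (intro image_eqI[of _ _ 1]) simp_all
  note K2 = H_stable_shift_join[OF H_stable_K]
  have II: "?I \<cdot>\<^bsub>R\<^esub> ?I = (*) (?q * ?q) ` supported (shift_join K)"
    by (rule ideal_prod_supported[OF H_stable_K])
  have "?I \<cdot>\<^bsub>R\<^esub> (?I \<cdot>\<^bsub>R\<^esub> ?I) = (*) (?q * (?q * ?q)) ` supported (shift_join K)"
    unfolding II ideal_prod_supported[OF K2] shift_join_stable[OF assms] ..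
  also have "\<dots> = (PIdl\<^bsub>R\<^esub> ?q) \<cdot>\<^bsub>R\<^esub> (?I \<cdot>\<^bsub>R\<^esub> ?I)"
    unfolding II ideal_prod_principal[OF Rmod_times[OF Rmod_H_stable[OF K2]]] times_image_image ..
  finally have cube: "?I \<cdot>\<^bsub>R\<^esub> (?I \<cdot>\<^bsub>R\<^esub> ?I) = (PIdl\<^bsub>R\<^esub> ?q) \<cdot>\<^bsub>R\<^esub> (?I \<cdot>\<^bsub>R\<^esub> ?I)" .
  have "quot_length R (regular_mod R) (?I \<cdot>\<^bsub>R\<^esub> ?I) ((PIdl\<^bsub>R\<^esub> ?q) \<cdot>\<^bsub>R\<^esub> ?I) =
      enat (card {h \<in> H. h + b \<notin> H})"
    using quot_length_square[OF q sub one]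
    unfolding II ideal_prod_principal[OF Rmod_times[OF Rmod_H_stable[OF H_stable_K]]] by simp
  moreover have "parameter_element R ?q"
  proof -
    have qR: "?q \<in> RH" using qI sub by blast
    have P: "PIdl\<^bsub>R\<^esub> ?q = (*) ?q ` RH" by (auto simp: cgenideal_def mult.commute)
    have tail: "contains_tail (Suc F + subdegree ?q) ((*) ?q ` RH)"
      by (rule contains_tail_times[OF q contains_tail_RH])
    have sub': "(*) ?q ` RH \<subseteq> RH" using RH_mult[OF qR] by blast
    have "quot_length R (regular_mod R) RH ((*) ?q ` RH) = enat (card (vals (RH :: 'k fps set) - vals ((*) ?q ` RH)))"
      by (rule quot_length_eq_card_vals[OF Rmod_times[OF Rmod_RH] Rmod_RH order_refl sub' tail])
    then show ?thesis using qR by (simp add: parameter_element_def P Units_R del: power_Suc)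
  qed
  ultimately show ?thesis unfolding Goto_ring_def using can qI cube by blast
qed

end

section \<open>The Goto property of a Herzog semigroup ring\<close>

context type_two_semigroup
begin

lemma Goto_ring_iff:
  "Goto_ring n (R :: 'k::field fps ring) \<longleftrightarrow> 3 * b \<in> H \<and> n = card {h \<in> H. h + b \<notin> H}"
  using Goto_ring_imp Goto_ring_if by blast

end

context herzog_data
begin

lemma Goto_ring_iff:
  assumes "m < m'"
  shows "Goto_ring n (semigroup_ring H :: 'k::field fps ring) \<longleftrightarrow>
    3 * (m' - m) \<in> H \<and> n = \<alpha> * \<beta> * \<gamma>"
proof -
  obtain F where F: "F \<notin> H" "F - (m' - m) \<notin> H" "m' - m \<le> F"
    "\<And>y. y \<notin> H \<Longrightarrow> \<exists>h\<in>H. y + h = F \<or> y + h + (m' - m) = F"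
    using type_two(2)[OF assms] by blast
  interpret type_two_semigroup H F "m' - m"
    using zero_in_H add_in_H cofinite F type_two(1)[OF assms] by unfold_locales
  show ?thesis using Goto_ring_iff card_gaps_of_shift[OF assms] by simp
qed

end

theorem theorem7p1:
  fixes a1 a2 a3 :: nat
    and \<alpha> \<beta> \<gamma> \<alpha>' \<beta>' \<gamma>' :: nat
    and n m m' b :: nat
    and H :: "nat set"
    and R :: "'k::field fps ring"
  assumes "a1 > 0" "a2 > 0" "a3 > 0"
    and "gcd a1 (gcd a2 a3) = 1"
    and "distinct [a1, a2, a3]" "minimal_gens {a1, a2, a3}"
    and "H = gen_semigroup {a1, a2, a3}"
    and "R = semigroup_ring H"
    and "\<not> gorenstein_local_ring R"
    and "\<alpha> > 0" "\<beta> > 0" "\<gamma> > 0" "\<alpha>' > 0" "\<beta>' > 0" "\<gamma>' > 0"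
    and "a_kernel (ring_on UNIV) (ring_on UNIV)
           (monomial_map a1 a2 a3 :: 'k poly poly poly \<Rightarrow> 'k poly) =
         I2 [varX ^ \<alpha>, varY ^ \<beta>, varZ ^ \<gamma>] [varY ^ \<beta>', varZ ^ \<gamma>', varX ^ \<alpha>']"
    and "m = a1 * \<alpha> + a3 * (\<gamma> + \<gamma>')"
    and "m' = a1 * \<alpha>' + a2 * (\<beta> + \<beta>')"
    and "b = nat \<bar>int m - int m'\<bar>"
    and "n \<ge> 1"
  shows "Goto_ring n R \<longleftrightarrow>
    3 * b \<in> H \<and> ((m' > m \<and> n = \<alpha> * \<beta> * \<gamma>) \<or> (m > m' \<and> n = \<alpha>' * \<beta>' * \<gamma>'))"
proof -
  have ker: "a_kernel (ring_on UNIV) (ring_on UNIV) (monomial_map a1 a2 a3 :: 'k poly poly poly \<Rightarrow> 'k poly) =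
      I2 [varX ^ \<alpha>, varY ^ \<beta>, varZ ^ \<gamma>] [varY ^ \<beta>', varZ ^ \<gamma>', varX ^ \<alpha>']"
    by fact
  have H: "x \<in> H \<longleftrightarrow> (\<exists>i j l. x = i * a1 + j * a2 + l * a3)" for x
    unfolding \<open>H = gen_semigroup {a1, a2, a3}\<close> gen_semigroup_three by blast
  have "\<exists>c. \<forall>n\<ge>c. n \<in> H"
    unfolding \<open>H = gen_semigroup {a1, a2, a3}\<close> by (rule numerical_semigroup_cofinite) fact
  then interpret D: herzog_data a1 a2 a3 \<alpha> \<beta> \<gamma> \<alpha>' \<beta>' \<gamma>' H
    using H minors_in_kernel[OF ker] move_closed_of_kernel[OF ker]
      \<open>a1 > 0\<close> \<open>a2 > 0\<close> \<open>a3 > 0\<close> \<open>\<alpha> > 0\<close> \<open>\<beta> > 0\<close> \<open>\<gamma> > 0\<close> \<open>\<alpha>' > 0\<close> \<open>\<beta>' > 0\<close> \<open>\<gamma>' > 0\<close>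
    by unfold_locales
  \<comment> \<open>Exchanging the rows of the matrix, together with \<open>Y\<close> and \<open>Z\<close>, gives a matrix of the same
    shape with \<open>m\<close> and \<open>m'\<close> exchanged.\<close>
  interpret S: herzog_data a1 a3 a2 \<alpha>' \<gamma>' \<beta>' \<alpha> \<gamma> \<beta> H
    by (rule D.swapped)
  have D: "D.m = m" "D.m' = m'" and S: "S.m = m'" "S.m' = m"
    unfolding D.m_def D.m'_def S.m_def S.m'_def
      \<open>m = a1 * \<alpha> + a3 * (\<gamma> + \<gamma>')\<close> \<open>m' = a1 * \<alpha>' + a2 * (\<beta> + \<beta>')\<close>
    by simp_all
  consider "m < m'" | "m' < m"
    using D.m_neq_m' unfolding D by linarith
  then show ?thesis
  proof cases
    case 1
    then have "b = m' - m" using \<open>b = nat \<bar>int m - int m'\<bar>\<close> by simp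
    then show ?thesis
      using D.Goto_ring_iff[where 'k = 'k, unfolded D, OF 1, of n] 1 \<open>R = semigroup_ring H\<close> by simp
  next
    case 2
    then have "b = m - m'" using \<open>b = nat \<bar>int m - int m'\<bar>\<close> by simp
    then show ?thesis
      using S.Goto_ring_iff[where 'k = 'k, unfolded S, OF 2, of n] 2 \<open>R = semigroup_ring H\<close>
      by (simp add: ac_simps)
  qed
qed

end
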